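(* Let $D\subset\mathbb{R}^n$ be a bounded open set with Lipschitz boundary. Let $\Phi$ be a Young function with $\phi=\Phi'$ such that, for some fixed numbers $p^\pm$, $1<p^-\le \frac{t\phi'(t)}{\phi(t)}\le p^+<\infty$ for all $t>0$, such that $\phi$ is convex on $[0,\infty)$, and such that $$\int_1^\infty\frac{\Phi^{-1}(t)}{t^{1+1/n}}\,dt<\infty .$$ Let $f\in L^{\Phi^*}(D)$, and let $\Omega_k$ ($k\in\mathbb{N}$) and $\Omega$ be open subsets of $D$ with $\Omega_k\to\Omega$ in the Hausdorff complementary topology. Then $u_{\Omega_k,f}\rightharpoonup u_{\Omega,f}$ weakly in $W^{1,\Phi}_0(D)$.
   Context: A Young function is $\Phi:[0,\infty)\to[0,\infty)$ of the form $\Phi(t)=\int_0^t\phi(\tau)\,d\tau$, where $\phi$ is right continuous and nondecreasing, $\phi(0)=0$, $\phi(t)>0$ for $t>0$, and $\phi(t)\to\infty$ as $t\to\infty$ (when $\phi'$ appears, $\phi$ is assumed differentiable on $(0,\infty)$). Its complementary function is $\Phi^*(t)=\sup\{tw-\Phi(w):w>0\}$; $\Phi^{-1}$ is the inverse function of $\Phi$. For open $\Omega\subset\mathbb{R}^n$, $L^\Phi(\Omega)$ is the set of measurable $u$ with $\int_\Omega\Phi(|u|)\,dx<\infty$, normed by $\|u\|_{L^\Phi(\Omega)}=\inf\{\lambda>0:\int_\Omega\Phi(|u|/\lambda)\,dx\le1\}$; $L^{\Phi^*}(\Omega)$ is defined likewise with $\Phi^*$. $W^{1,\Phi}(\Omega)=\{u\in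 L^\Phi(\Omega):|\nabla u|\in L^\Phi(\Omega)\}$ (distributional derivatives) with norm $\|u\|_{L^\Phi(\Omega)}+\|\nabla u\|_{L^\Phi(\Omega)}$, and $W^{1,\Phi}_0(\Omega)$ is the closure of $C_c^\infty(\Omega)$ in this norm. For open $\Omega\subset D$ and $f\in L^{\Phi^*}(D)$, $u_{\Omega,f}\in W^{1,\Phi}_0(\Omega)$ denotes the weak solution of $-\Delta_\phi u=f$ in $\Omega$, $u=0$ on $\partial\Omega$, where $\Delta_\phi u=\mathrm{div}\big(\frac{\phi(|\nabla u|)}{|\nabla u|}\nabla u\big)$; that is, $\int_\Omega\frac{\phi(|\nabla u|)}{|\nabla u|}\nabla u\cdot\nabla v\,dx=\int_\Omega fv\,dx$ for all $v\in W^{1,\Phi}_0(\Omega)$ (with $\frac{\phi(|a|)}{|a|}a:=0$ for $a=0$). Functions in $W^{1,\Phi}_0(\Omega)$ are extended by zero and regarded as elements of $W^{1,\Phi}_0(D)$. Hausdorff complementary topology: for open $\Omega_1,\Omega_2\subset D$, $d_{H^c}(\Omega_1,\Omega_2)=d(\Omega_1^c,\Omega_2^c)$, where $d$ is the usual Hausdorff distance and $^c$ denotes complement in $\mathbb{R}^n$; $\Omega_k\to\Omega$ in this topology means $d_{H^c}(\Omega_k,\Omega)\to0$. *)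

theory Defs
  imports "HOL-Analysis.Analysis"
begin

(* Functions on a set \<Omega> are represented by total functions on the ambient space
   whose values outside \<Omega> are irrelevant; elements of the function spaces below are
   representatives, not almost-everywhere classes. *)

section \<open>Young functions\<close>

text \<open>Only the values on the nonnegative half-line matter.\<close>

definition young_function :: "(real \<Rightarrow> real) \<Rightarrow> (real \<Rightarrow> real) \<Rightarrow> bool" where
  "young_function \<Phi> \<phi> \<longleftrightarrow>
     (\<forall>t\<ge>0. continuous (at_right t) \<phi>) \<and> mono_on {0..} \<phi> \<and>
     \<phi> 0 = 0 \<and> (\<forall>t>0. \<phi> t > 0) \<and> filterlim \<phi> at_top at_top \<and>
     (\<forall>t\<ge>0. \<Phi> t = integral {0..t} \<phi>)"

definition young_conj :: "(real \<Rightarrow> real) \<Rightarrow> real \<Rightarrow> real" where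
  "young_conj \<Phi> t = (SUP w\<in>{0<..}. t * w - \<Phi> w)"

section \<open>Orlicz spaces\<close>

definition orlicz :: "(real \<Rightarrow> real) \<Rightarrow> 'a::euclidean_space set \<Rightarrow> ('a \<Rightarrow> real) set" where
  "orlicz \<Phi> \<Omega> = {u \<in> borel_measurable (lebesgue_on \<Omega>).
     (\<integral>\<^sup>+x. ennreal (\<Phi> \<bar>u x\<bar>) \<partial>lebesgue_on \<Omega>) < \<infinity>}"

definition orlicz_norm :: "(real \<Rightarrow> real) \<Rightarrow> 'a::euclidean_space set \<Rightarrow> ('a \<Rightarrow> real) \<Rightarrow> real" where
  "orlicz_norm \<Phi> \<Omega> u =
     Inf {c. c > 0 \<and> (\<integral>\<^sup>+x. ennreal (\<Phi> (\<bar>u x\<bar> / c)) \<partial>lebesgue_on \<Omega>) \<le> 1}"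

section \<open>Test functions and weak gradients\<close>

definition partial_deriv :: "'n \<Rightarrow> (real^'n \<Rightarrow> real) \<Rightarrow> real^'n \<Rightarrow> real" where
  "partial_deriv i f x = frechet_derivative f (at x) (axis i 1)"

fun Ck :: "nat \<Rightarrow> (real^'n \<Rightarrow> real) \<Rightarrow> bool" where
  "Ck 0 f \<longleftrightarrow> continuous_on UNIV f"
| "Ck (Suc k) f \<longleftrightarrow> (\<forall>x. f differentiable (at x)) \<and> (\<forall>i. Ck k (partial_deriv i f))"

definition test_functions :: "(real^'n) set \<Rightarrow> (real^'n \<Rightarrow> real) set" where
  "test_functions \<Omega> = {\<psi>. (\<forall>k. Ck k \<psi>) \<and>
     compact (closure {x. \<psi> x \<noteq> 0}) \<and> closure {x. \<psi> x \<noteq> 0} \<subseteq> \<Omega>}"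

definition locally_integrable ::
  "'a::euclidean_space set \<Rightarrow> ('a \<Rightarrow> 'b::euclidean_space) \<Rightarrow> bool" where
  "locally_integrable \<Omega> u \<longleftrightarrow> (\<forall>K. compact K \<and> K \<subseteq> \<Omega> \<longrightarrow> set_integrable lebesgue K u)"

definition has_weak_gradient ::
  "(real^'n) set \<Rightarrow> (real^'n \<Rightarrow> real) \<Rightarrow> (real^'n \<Rightarrow> real^'n) \<Rightarrow> bool" where
  "has_weak_gradient \<Omega> u g \<longleftrightarrow>
     u \<in> borel_measurable (lebesgue_on \<Omega>) \<and> g \<in> borel_measurable (lebesgue_on \<Omega>) \<and>
     locally_integrable \<Omega> u \<and> locally_integrable \<Omega> g \<and>
     (\<forall>\<psi>\<in>test_functions \<Omega>. \<forall>i.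
        (\<integral>x. u x * partial_deriv i \<psi> x \<partial>lebesgue_on \<Omega>) =
        - (\<integral>x. g x $ i * \<psi> x \<partial>lebesgue_on \<Omega>))"

text \<open>On an open set a weak gradient is unique up to null sets, and everything below is
  insensitive to null sets, so the choice of representative is immaterial.\<close>

definition weak_gradient ::
  "(real^'n) set \<Rightarrow> (real^'n \<Rightarrow> real) \<Rightarrow> real^'n \<Rightarrow> real^'n" where
  "weak_gradient \<Omega> u = (SOME g. has_weak_gradient \<Omega> u g)"

section \<open>Orlicz-Sobolev spaces\<close>

definition W1 :: "(real \<Rightarrow> real) \<Rightarrow> (real^'n) set \<Rightarrow> (real^'n \<Rightarrow> real) set" where
  "W1 \<Phi> \<Omega> = {u \<in> orlicz \<Phi> \<Omega>. \<exists>g. has_weak_gradient \<Omega> u g \<and> (\<lambda>x. norm (g x)) \<in> orlicz \<Phi> \<Omega>}"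

definition W1_norm :: "(real \<Rightarrow> real) \<Rightarrow> (real^'n) set \<Rightarrow> (real^'n \<Rightarrow> real) \<Rightarrow> real" where
  "W1_norm \<Phi> \<Omega> u = orlicz_norm \<Phi> \<Omega> u + orlicz_norm \<Phi> \<Omega> (\<lambda>x. norm (weak_gradient \<Omega> u x))"

definition W1_0 :: "(real \<Rightarrow> real) \<Rightarrow> (real^'n) set \<Rightarrow> (real^'n \<Rightarrow> real) set" where
  "W1_0 \<Phi> \<Omega> = {u \<in> W1 \<Phi> \<Omega>.
     \<forall>\<epsilon>>0. \<exists>\<psi>\<in>test_functions \<Omega>. W1_norm \<Phi> \<Omega> (\<lambda>x. u x - \<psi> x) < \<epsilon>}"

definition zero_extension :: "'a set \<Rightarrow> ('a \<Rightarrow> real) \<Rightarrow> 'a \<Rightarrow> real" where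
  "zero_extension \<Omega> u x = (if x \<in> \<Omega> then u x else 0)"

text \<open>Continuous linear functionals on a space of representatives: the bound by the
  seminorm forces them to respect almost-everywhere equality.\<close>

definition bounded_functional ::
  "('a \<Rightarrow> real) set \<Rightarrow> (('a \<Rightarrow> real) \<Rightarrow> real) \<Rightarrow> (('a \<Rightarrow> real) \<Rightarrow> real) \<Rightarrow> bool" where
  "bounded_functional X N l \<longleftrightarrow>
     (\<forall>u\<in>X. \<forall>v\<in>X. l (\<lambda>x. u x + v x) = l u + l v) \<and>
     (\<forall>c. \<forall>u\<in>X. l (\<lambda>x. c * u x) = c * l u) \<and>
     (\<exists>C. \<forall>u\<in>X. \<bar>l u\<bar> \<le> C * N u)"

definition weakly_converges ::
  "('a \<Rightarrow> real) set \<Rightarrow> (('a \<Rightarrow> real) \<Rightarrow> real) \<Rightarrow> (nat \<Rightarrow> 'a \<Rightarrow> real) \<Rightarrow> ('a \<Rightarrow> real) \<Rightarrow> bool" where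
  "weakly_converges X N us u \<longleftrightarrow>
     (\<forall>k. us k \<in> X) \<and> u \<in> X \<and>
     (\<forall>l. bounded_functional X N l \<longrightarrow> (\<lambda>k. l (us k)) \<longlonglongrightarrow> l u)"

section \<open>Weak solutions\<close>

text \<open>For \<open>a = 0\<close> the flux vanishes, as required.\<close>

definition flux :: "(real \<Rightarrow> real) \<Rightarrow> real^'n \<Rightarrow> real^'n" where
  "flux \<phi> a = (\<phi> (norm a) / norm a) *\<^sub>R a"

definition weak_solution ::
  "(real \<Rightarrow> real) \<Rightarrow> (real \<Rightarrow> real) \<Rightarrow> (real^'n) set \<Rightarrow> (real^'n \<Rightarrow> real) \<Rightarrow> (real^'n \<Rightarrow> real) \<Rightarrow> bool" where
  "weak_solution \<Phi> \<phi> \<Omega> f u \<longleftrightarrow> u \<in> W1_0 \<Phi> \<Omega> \<and>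
     (\<forall>v\<in>W1_0 \<Phi> \<Omega>.
        (\<integral>x. flux \<phi> (weak_gradient \<Omega> u x) \<bullet> weak_gradient \<Omega> v x \<partial>lebesgue_on \<Omega>) =
        (\<integral>x. f x * v x \<partial>lebesgue_on \<Omega>))"

section \<open>Domains\<close>

text \<open>Near each boundary point \<open>D\<close> is the strict epigraph, in some direction \<open>e\<close>, of a
  Lipschitz function on the hyperplane orthogonal to \<open>e\<close>.\<close>

definition lipschitz_boundary :: "'a::euclidean_space set \<Rightarrow> bool" where
  "lipschitz_boundary D \<longleftrightarrow>
     (\<forall>x\<in>frontier D. \<exists>r>0. \<exists>e L \<gamma>. norm e = 1 \<and> L-lipschitz_on {y. y \<bullet> e = 0} \<gamma> \<and>
        D \<inter> ball x r = {y \<in> ball x r. y \<bullet> e > \<gamma> (y - (y \<bullet> e) *\<^sub>R e)})"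

definition hausdorff_dist :: "'a::metric_space set \<Rightarrow> 'a set \<Rightarrow> real" where
  "hausdorff_dist A B = max (SUP x\<in>A. infdist x B) (SUP y\<in>B. infdist y A)"

text \<open>For subsets of a common bounded set the complements are nonempty and the suprema
  in their Hausdorff distance are finite.\<close>

definition hausdorff_compl_dist :: "'a::metric_space set \<Rightarrow> 'a set \<Rightarrow> real" where
  "hausdorff_compl_dist U V = hausdorff_dist (- U) (- V)"

end

theory Submission
  imports Defs
begin

text \<open>Convexity of \<open>\<phi>\<close> makes \<open>t \<mapsto> \<Phi> (sqrt t)\<close> convex, whence the Clarkson-type inequality
  \<open>\<Phi> \<bar>a\<bar> + flux a \<bullet> (b - a) + 2 \<Phi> (\<bar>b - a\<bar> / 2) \<le> \<Phi> \<bar>b\<bar>\<close>. Hence a weak solution minimises the energy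
  \<open>\<integral> \<Phi> \<bar>\<nabla>v\<bar> - f v\<close>, and the energy gap of a competitor controls its distance to the solution.

  The integral condition on the inverse of \<open>\<Phi>\<close> gives a Morrey estimate: test functions with
  bounded energy share a modulus of continuity and a sup bound. A test function \<open>\<eta>\<close> near the
  solution on \<open>\<Omega>\<^sub>k\<close> is therefore uniformly small near the complement of \<open>\<Omega>\<close> for large \<open>k\<close>, so its
  smooth truncation at a small level \<open>e\<close> is a test function on \<open>\<Omega>\<close>, with hardly more energy.
  Conversely a test function on \<open>\<Omega>\<close> is one on \<open>\<Omega>\<^sub>k\<close> for large \<open>k\<close>. So the minimal energies
  converge, and the energy gap forces strong convergence of the solutions; neither reflexivity nor
  weak compactness is needed.\<close>

section \<open>Young functions\<close>

text \<open>Members of \<open>W1_0\<close> are known only as limits of test functions, while the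
  Morrey estimate, the truncation and the change of domain are all carried out on test functions.
  Each solution is therefore replaced by a test function with hardly more energy, and no continuous
  representative is ever formed. This is why the truncation has to be smooth: it must stay in the
  class. Its slope is at most 1, so the gradient term does not grow, and the linear term changes by
  at most \<open>2 * e\<close> times the L1 norm of the datum. The gap in the minimality inequality
  is kept only once, on the varying domain: a test function near the limit solution competes on
  \<open>\<Omega>s k\<close>, and the truncation supplies the lower bound for the energy there that
  makes the gap small. The quadratic decay \<open>\<Phi> (c * t) \<le> c\<^sup>2 * \<Phi> t\<close>
  makes sup norms grow like the square root of the gradient energy. This gives coercivity, and the
  same sup bound turns small gradients into small functions.\<close>

lemma small_factor:
  fixes a b :: real
  assumes "0 \<le> a" "0 < b"
  obtains e where "0 < e" "e < 1" "e * a \<le> b"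
proof
  let ?e = "min (1/2) (b / (a + 1))"
  show "0 < ?e" "?e < 1" using assms by auto
  have "?e * a \<le> b / (a + 1) * a" using assms by (intro mult_right_mono) auto
  also have "\<dots> \<le> b" using assms by (simp add: pos_divide_le_eq algebra_simps)
  finally show "?e * a \<le> b" .
qed

locale convex_young =
  fixes \<Phi> \<phi> :: "real \<Rightarrow> real" and pp :: real
  assumes young: "young_function \<Phi> \<phi>"
    and conv: "convex_on {0..} \<phi>"
    and diffble: "\<And>t. t > 0 \<Longrightarrow> \<phi> field_differentiable (at t)"
    and upper: "\<And>t. t > 0 \<Longrightarrow> t * deriv \<phi> t / \<phi> t \<le> pp"
begin

section \<open>Calculus of \<open>\<phi>\<close> and its primitive\<close>

lemma phi_mono: "0 \<le> s \<Longrightarrow> s \<le> t \<Longrightarrow> \<phi> s \<le> \<phi> t"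
  using young unfolding young_function_def mono_on_def by auto

lemma phi_0 [simp]: "\<phi> 0 = 0"
  using young unfolding young_function_def by auto

lemma phi_pos: "t > 0 \<Longrightarrow> \<phi> t > 0"
  using young unfolding young_function_def by auto

lemma phi_nonneg: "t \<ge> 0 \<Longrightarrow> \<phi> t \<ge> 0"
  using phi_pos[of t] by (cases "t = 0") auto

lemma continuous_on_phi: "continuous_on {0..} \<phi>"
proof (rule continuous_on_eq_continuous_within[THEN iffD2], intro ballI)
  fix x :: real assume x: "x \<in> {0..}"
  show "continuous (at x within {0..}) \<phi>"
  proof (cases "x = 0")
    case True
    have "continuous (at_right 0) \<phi>"
      using young unfolding young_function_def by auto
    then have "continuous (at 0 within {0..}) \<phi>"
      unfolding continuous_within
      by (metis at_within_Ici_at_right)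
    then show ?thesis using True by simp
  next
    case False
    then show ?thesis
      using diffble[of x] x
      by (auto dest!: field_differentiable_imp_continuous_at intro: continuous_at_imp_continuous_at_within)
  qed
qed

text \<open>Convexity and \<open>\<phi> 0 = 0\<close> place the graph under its chord from the
  origin: \<open>\<phi> t / t\<close> is nondecreasing. Convexity of \<open>\<phi>\<close> enters
  the argument only through this.\<close>

lemma phi_scale: "0 \<le> c \<Longrightarrow> c \<le> 1 \<Longrightarrow> t \<ge> 0 \<Longrightarrow> \<phi> (c * t) \<le> c * \<phi> t"
  using convex_onD[OF conv, of c 0 t] by simp

lemma Phi_eq: "t \<ge> 0 \<Longrightarrow> \<Phi> t = integral {0..t} \<phi>"
  using young unfolding young_function_def by auto

lemma Phi_0 [simp]: "\<Phi> 0 = 0"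
  using Phi_eq[of 0] by simp

lemma Phi_deriv_within:
  assumes "0 \<le> t" "t \<le> b"
  shows "(\<Phi> has_real_derivative \<phi> t) (at t within {0..b})"
proof -
  have "((\<lambda>u. integral {0..u} \<phi>) has_real_derivative \<phi> t) (at t within {0..b})"
    by (rule integral_has_real_derivative)
      (use assms in \<open>auto intro: continuous_on_subset[OF continuous_on_phi]\<close>)
  then show ?thesis
    by (rule has_field_derivative_transform_within[where d=1]) (use assms Phi_eq in auto)
qed

lemma Phi_deriv: "t > 0 \<Longrightarrow> (\<Phi> has_real_derivative \<phi> t) (at t)"
  using Phi_deriv_within[of t "t + 1"] at_within_Icc_at[of 0 t "t+1"] by simp

lemma continuous_on_Phi: "continuous_on {0..} \<Phi>"
proof (rule continuous_on_eq_continuous_within[THEN iffD2], intro ballI)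
  fix x :: real assume x: "x \<in> {0..}"
  have "continuous (at x within {0..x+1}) \<Phi>"
    using Phi_deriv_within[of x "x + 1"] x by (auto intro: DERIV_continuous)
  moreover have "at x within {0..} = at x within {0..x+1}"
    by (rule at_within_nhd[where S="{..<x+1}"]) (use x in auto)
  ultimately show "continuous (at x within {0..}) \<Phi>"
    by (metis continuous_within)
qed

lemma Phi_mvt:
  assumes "0 \<le> a" "a < b"
  obtains z where "a < z" "z < b" "\<Phi> b - \<Phi> a = (b - a) * \<phi> z"
proof -
  have "continuous_on {a..b} \<Phi>"
    by (rule continuous_on_subset[OF continuous_on_Phi]) (use assms in auto)
  then obtain z where "a < z" "z < b" "\<Phi> b - \<Phi> a = (*) (\<phi> z) (b - a)"
    using mvt[of a b \<Phi> "\<lambda>x. (*) (\<phi> x)"] Phi_deriv assms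
    by (auto simp: has_field_derivative_def)
  then show ?thesis using that by (simp add: mult.commute)
qed

lemma Phi_strict_mono: assumes "0 \<le> a" "a < b" shows "\<Phi> a < \<Phi> b"
  using Phi_mvt[OF assms] phi_pos assms
  by (metis diff_gt_0_iff_gt mult_pos_pos order.strict_trans1)

lemma Phi_mono: "0 \<le> a \<Longrightarrow> a \<le> b \<Longrightarrow> \<Phi> a \<le> \<Phi> b"
  using Phi_strict_mono[of a b] by (cases "a = b") auto

lemma Phi_nonneg: "0 \<le> a \<Longrightarrow> 0 \<le> \<Phi> a"
  using Phi_mono[of 0 a] by simp

lemma Phi_pos: "0 < a \<Longrightarrow> 0 < \<Phi> a"
  using Phi_strict_mono[of 0 a] by simp

lemma Phi_tangent:
  assumes "0 \<le> a" "0 \<le> b" shows "\<Phi> a + \<phi> a * (b - a) \<le> \<Phi> b"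
proof (cases a b rule: linorder_cases)
  case less
  then obtain z where z: "a < z" "z < b" "\<Phi> b - \<Phi> a = (b - a) * \<phi> z" using Phi_mvt assms by metis
  have "(b - a) * \<phi> a \<le> (b - a) * \<phi> z" using z assms less by (intro mult_left_mono phi_mono) auto
  then show ?thesis using z by (simp add: algebra_simps)
next
  case greater
  then obtain z where z: "b < z" "z < a" "\<Phi> a - \<Phi> b = (a - b) * \<phi> z" using Phi_mvt assms by metis
  have "(a - b) * \<phi> z \<le> (a - b) * \<phi> a" using z assms greater by (intro mult_left_mono phi_mono) auto
  then show ?thesis using z by (simp add: algebra_simps)
qed auto

lemma Phi_convex:
  assumes "0 \<le> a" "0 \<le> b" "0 \<le> c" "c \<le> 1"
  shows "\<Phi> ((1 - c) * a + c * b) \<le> (1 - c) * \<Phi> a + c * \<Phi> b"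
proof -
  define m where "m = (1 - c) * a + c * b"
  have m: "0 \<le> m" using assms by (auto simp: m_def)
  have "(1 - c) * (\<Phi> m + \<phi> m * (a - m)) \<le> (1 - c) * \<Phi> a"
    using Phi_tangent[OF m assms(1)] assms by (intro mult_left_mono) auto
  moreover have "c * (\<Phi> m + \<phi> m * (b - m)) \<le> c * \<Phi> b"
    using Phi_tangent[OF m assms(2)] assms by (intro mult_left_mono) auto
  moreover have "(1 - c) * (\<Phi> m + \<phi> m * (a - m)) + c * (\<Phi> m + \<phi> m * (b - m)) = \<Phi> m"
    unfolding m_def by (simp add: algebra_simps)
  ultimately show ?thesis unfolding m_def[symmetric] by linarith
qed

text \<open>The derivative in \<open>s\<close> of
  \<open>c\<^sup>2 * \<Phi> s - \<Phi> (c * s)\<close> is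
  \<open>c * (c * \<phi> s - \<phi> (c * s))\<close>, nonnegative by \<open>phi_scale\<close>.
  Convexity of \<open>\<Phi>\<close> alone would give the factor \<open>c\<close>; the square is
  what makes the energy coercive later.\<close>

lemma Phi_scale_square:
  assumes "0 \<le> c" "c \<le> 1" "0 \<le> t" shows "\<Phi> (c * t) \<le> c\<^sup>2 * \<Phi> t"
proof (cases "t = 0 \<or> c = 0")
  case False
  then have t: "t > 0" "c > 0" using assms by auto
  define h where "h s = c\<^sup>2 * \<Phi> s - \<Phi> (c * s)" for s
  have "h 0 \<le> h t"
  proof (rule DERIV_nonneg_imp_increasing_open[of 0 t h])
    show "0 \<le> t" using t by simp
    show "\<exists>y. (h has_real_derivative y) (at s) \<and> 0 \<le> y" if s: "0 < s" "s < t" for s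
    proof (intro exI conjI)
      show "(h has_real_derivative (c\<^sup>2 * \<phi> s - \<phi> (c * s) * c)) (at s)"
        unfolding h_def
        by (rule derivative_eq_intros refl Phi_deriv DERIV_chain2[of \<Phi>] | use s t in simp)+
      show "0 \<le> c\<^sup>2 * \<phi> s - \<phi> (c * s) * c"
        using mult_right_mono[OF phi_scale[of c s], of c] assms s
        by (simp add: power2_eq_square algebra_simps)
    qed
    show "continuous_on {0..t} h" unfolding h_def
      by (intro continuous_intros continuous_on_compose2[OF continuous_on_Phi]) (use t in auto)
  qed
  then show ?thesis by (simp add: h_def)
qed auto

lemma Phi_scale_le: "0 \<le> c \<Longrightarrow> c \<le> 1 \<Longrightarrow> 0 \<le> t \<Longrightarrow> \<Phi> (c * t) \<le> c * \<Phi> t"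
  using Phi_convex[of 0 t c] by simp

section \<open>Doubling and its consequences\<close>

lemma phi_double: assumes "t > 0" shows "\<phi> (2 * t) \<le> 2 powr pp * \<phi> t"
proof -
  \<comment> \<open>The hypothesis \<open>upper\<close> bounds the logarithmic derivative of
    \<open>\<phi>\<close> by \<open>pp / s\<close>, so \<open>\<phi> s / s powr pp\<close> is
    nonincreasing; \<open>h\<close> is its logarithm.\<close>
  define h where "h s = ln (\<phi> s) - pp * ln s" for s
  have "h (2 * t) \<le> h t"
  proof (rule DERIV_nonpos_imp_nonincreasing[of t "2 * t" h])
    show "t \<le> 2 * t" using assms by simp
  next
    fix s assume s: "t \<le> s" "s \<le> 2 * t"
    then have s0: "s > 0" using assms by simp
    have D: "(\<phi> has_real_derivative deriv \<phi> s) (at s)"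
      using diffble[OF s0] by (simp add: field_differentiable_derivI)
    have "(h has_real_derivative (deriv \<phi> s / \<phi> s - pp / s)) (at s)"
      unfolding h_def using phi_pos[OF s0] s0
      by (auto intro!: derivative_eq_intros D)
    moreover have "deriv \<phi> s / \<phi> s - pp / s \<le> 0"
      using upper[OF s0] s0 phi_pos[OF s0] by (simp add: field_simps)
    ultimately show "\<exists>y. (h has_real_derivative y) (at s) \<and> y \<le> 0" by blast
  qed
  then have "ln (\<phi> (2*t)) \<le> ln (\<phi> t) + pp * ln 2"
    using assms by (simp add: h_def ln_mult algebra_simps)
  then have "ln (\<phi> (2*t)) \<le> ln (2 powr pp * \<phi> t)"
    using assms phi_pos[OF assms] by (simp add: ln_mult ln_powr)
  then show ?thesis using phi_pos assms by (simp add: zero_less_mult_iff)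
qed

text \<open>A doubling constant for \<open>\<Phi>\<close>: \<open>2 powr pp\<close> comes from
  \<open>\<phi>\<close>, the other factor 2 from the chain rule for \<open>\<Phi> (2 * s)\<close>.
  It also serves as the quasi-triangle constant of the modular.\<close>

definition "Kd = 2 * 2 powr pp"

lemma Phi_double: assumes "0 \<le> t" shows "\<Phi> (2 * t) \<le> Kd * \<Phi> t"
proof (cases "t = 0")
  case False
  then have t: "t > 0" using assms by auto
  define h where "h s = Kd * \<Phi> s - \<Phi> (2 * s)" for s
  have "h 0 \<le> h t"
  proof (rule DERIV_nonneg_imp_increasing_open[of 0 t h])
    show "0 \<le> t" using t by simp
    show "\<exists>y. (h has_real_derivative y) (at s) \<and> 0 \<le> y" if s: "0 < s" "s < t" for s
    proof (intro exI conjI)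
      show "(h has_real_derivative (Kd * \<phi> s - \<phi> (2 * s) * 2)) (at s)"
        unfolding h_def
        by (rule derivative_eq_intros refl Phi_deriv DERIV_chain2[of \<Phi>] | use s t in simp)+
      show "0 \<le> Kd * \<phi> s - \<phi> (2 * s) * 2"
        using phi_double[of s] s by (simp add: Kd_def)
    qed
    show "continuous_on {0..t} h" unfolding h_def
      by (intro continuous_intros continuous_on_compose2[OF continuous_on_Phi]) (use t in auto)
  qed
  then show ?thesis by (simp add: h_def)
qed auto

lemma Kd_pos: "Kd > 0" by (simp add: Kd_def)

text \<open>Iterated doubling, with some \<open>2 ^ m\<close> above \<open>c\<close>. It lets
  smallness of a modular survive multiplication by a fixed constant.\<close>

lemma Phi_mult_bound: "\<exists>K>0. \<forall>t\<ge>0. \<Phi> (c * t) \<le> K * \<Phi> t" if "c \<ge> 0"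
proof -
  obtain m where "c < 2 ^ m" using real_arch_pow[of 2 c] by auto
  then have m: "c \<le> 2 ^ m" by simp
  have *: "\<Phi> (2 ^ k * t) \<le> Kd ^ k * \<Phi> t" if "t \<ge> 0" for k t
  proof (induction k)
    case (Suc k)
    have "\<Phi> (2 ^ Suc k * t) \<le> Kd * \<Phi> (2 ^ k * t)"
      using Phi_double[of "2 ^ k * t"] that by (simp add: mult.assoc)
    also have "\<dots> \<le> Kd * (Kd ^ k * \<Phi> t)" using Suc Kd_pos by (intro mult_left_mono) auto
    finally show ?case by simp
  qed simp
  have "\<Phi> (c * t) \<le> Kd ^ m * \<Phi> t" if "t \<ge> 0" for t
    using Phi_mono[of "c * t" "2 ^ m * t"] *[OF that, of m] m that \<open>c \<ge> 0\<close>
    by (meson mult_nonneg_nonneg mult_right_mono order_trans)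
  then show ?thesis using Kd_pos by (intro exI[of _ "Kd ^ m"]) auto
qed

text \<open>Write \<open>a + b\<close> as twice the midpoint: doubling removes the factor 2,
  convexity splits the midpoint.\<close>

lemma Phi_add_le: assumes "0 \<le> a" "0 \<le> b" shows "\<Phi> (a + b) \<le> Kd * (\<Phi> a + \<Phi> b)"
proof -
  have "\<Phi> (a + b) \<le> Kd * \<Phi> ((1 - 1/2) * a + 1/2 * b)"
    using Phi_double[of "(a+b)/2"] assms by (simp add: add_divide_distrib)
  also have "\<dots> \<le> Kd * ((1 - 1/2) * \<Phi> a + 1/2 * \<Phi> b)"
    by (intro mult_left_mono Phi_convex) (use assms Kd_pos in auto)
  also have "\<dots> \<le> Kd * (\<Phi> a + \<Phi> b)"
    by (intro mult_left_mono) (use assms Kd_pos Phi_nonneg[of a] Phi_nonneg[of b] in auto)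
  finally show ?thesis .
qed

text \<open>The tangent at \<open>t\<close>, evaluated at \<open>2 * t\<close>, gives
  \<open>\<Phi> t + t * \<phi> t \<le> \<Phi> (2 * t)\<close>; doubling does the rest.\<close>

lemma t_phi_le: assumes "0 \<le> t" shows "t * \<phi> t \<le> Kd * \<Phi> t"
  using Phi_tangent[of t "2 * t"] Phi_double[of t] Phi_nonneg[of t] assms by (simp add: mult.commute)

text \<open>Replacing the smaller argument by the larger reduces both cases to
  \<open>t_phi_le\<close>. This makes the flux integrable against every gradient of finite modular,
  without estimating the complementary function at \<open>\<phi> s\<close>.\<close>

lemma phi_mult_le: assumes "0 \<le> s" "0 \<le> t" shows "\<phi> s * t \<le> Kd * (\<Phi> s + \<Phi> t)"
proof (cases "t \<le> s")
  case True
  have "\<phi> s * t \<le> s * \<phi> s" using True phi_nonneg[OF assms(1)] by (simp add: mult.commute[of "\<phi> s"] mult_right_mono)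
  then show ?thesis using t_phi_le[OF assms(1)] Phi_nonneg[OF assms(2)] Kd_pos
    by (smt (verit) mult_less_cancel_left_pos)
next
  case False
  have "\<phi> s * t \<le> t * \<phi> t" using False phi_mono[of s t] assms by (simp add: mult.commute mult_left_mono)
  then show ?thesis using t_phi_le[OF assms(2)] Phi_nonneg[OF assms(1)] Kd_pos
    by (smt (verit) mult_less_cancel_left_pos)
qed

text \<open>Either \<open>t \<le> e\<close>, or \<open>\<Phi> e \<le> (e / t) * \<Phi> t\<close>.
  With the threshold \<open>e\<close> free, this linear bound stands in for Jensen's inequality on
  cubes and for Hoelder's inequality on sets of finite measure.\<close>

lemma le_Phi: assumes "0 < e" "0 \<le> t" shows "t \<le> e + e * \<Phi> t / \<Phi> e"
proof (cases "t \<le> e")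
  case False
  have "\<Phi> (e / t * t) \<le> e / t * \<Phi> t" by (rule Phi_scale_le) (use False assms in auto)
  then have "t \<le> e * \<Phi> t / \<Phi> e" using False assms Phi_pos[of e] by (simp add: field_simps)
  then show ?thesis using assms by simp
next
  case True
  have "0 \<le> e * \<Phi> t / \<Phi> e" using assms Phi_nonneg[of t] Phi_pos[of e] by simp
  then show ?thesis using True by simp
qed

text \<open>Monotonicity of \<open>t \<mapsto> \<phi> t / t\<close> says that \<open>s \<mapsto> \<Phi> (sqrt s)\<close> is convex; this is its
  tangent line inequality in the variable \<open>t\<^sup>2\<close>.\<close>

lemma Phi_square_tangent:
  assumes a: "0 < a" and b: "0 \<le> b"
  shows "\<Phi> a + (b\<^sup>2 - a\<^sup>2) * (\<phi> a / (2 * a)) \<le> \<Phi> b"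
proof -
  define h where "h s = \<Phi> s - s\<^sup>2 * (\<phi> a / (2 * a))" for s
  have D: "(h has_real_derivative (\<phi> s - s * \<phi> a / a)) (at s)" if "0 < s" for s
    unfolding h_def using that a by (auto intro!: derivative_eq_intros Phi_deriv)
  have C: "continuous_on {s..t} h" if "0 \<le> s" for s t
    unfolding h_def
    by (intro continuous_intros continuous_on_subset[OF continuous_on_Phi]) (use that a in auto)
  have "h a \<le> h b"
  proof (cases "a \<le> b")
    case True
    show ?thesis
    proof (rule DERIV_nonneg_imp_increasing_open[OF True _ C])
      fix s assume s: "a < s" "s < b"
      have "\<phi> a \<le> a / s * \<phi> s" using phi_scale[of "a / s" s] s a by simp
      then have "0 \<le> \<phi> s - s * \<phi> a / a" using s a by (simp add: field_simps)
      then show "\<exists>y. (h has_real_derivative y) (at s) \<and> 0 \<le> y" using D[of s] s a by force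
    qed (use a in auto)
  next
    case False
    then have "b \<le> a" by simp
    then show ?thesis
    proof (rule DERIV_nonpos_imp_decreasing_open[OF _ _ C])
      fix s assume s: "b < s" "s < a"
      have "\<phi> s \<le> s / a * \<phi> a" using phi_scale[of "s / a" a] s a b by simp
      then have "\<phi> s - s * \<phi> a / a \<le> 0" using s a by (simp add: field_simps)
      then show "\<exists>y. (h has_real_derivative y) (at s) \<and> y \<le> 0" using D[of s] s b by force
    qed (use b in auto)
  qed
  then show ?thesis by (simp add: h_def algebra_simps)
qed

text \<open>A convex function vanishing at 0 is superadditive on the nonnegative half-line; here
  that function is \<open>s \<mapsto> \<Phi> (sqrt s)\<close>, evaluated at \<open>x\<^sup>2\<close>
  and \<open>y\<^sup>2\<close>.\<close>

lemma Phi_square_superadd: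
  assumes "0 \<le> x" "0 \<le> y" "0 \<le> z" "x\<^sup>2 + y\<^sup>2 = z\<^sup>2" shows "\<Phi> x + \<Phi> y \<le> \<Phi> z"
proof (cases "z = 0")
  case True then show ?thesis using assms by simp
next
  case False
  then have z: "z > 0" using assms by simp
  have le: "x \<le> z" "y \<le> z"
    using assms by (smt (verit) power2_le_imp_le zero_le_power2)+
  have "\<Phi> x \<le> (x / z)\<^sup>2 * \<Phi> z" "\<Phi> y \<le> (y / z)\<^sup>2 * \<Phi> z"
    using Phi_scale_square[of "x / z" z] Phi_scale_square[of "y / z" z] z le assms by auto
  moreover have "(x / z)\<^sup>2 * \<Phi> z + (y / z)\<^sup>2 * \<Phi> z = \<Phi> z"
    using assms(4) z by (simp add: power_divide flip: distrib_right add_divide_distrib)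
  ultimately show ?thesis by linarith
qed

text \<open>By the parallelogram law the squared norms of the half sum and the half difference add
  up to \<open>z\<^sup>2\<close>, the mean of the squared norms of \<open>a\<close> and
  \<open>b\<close>. Superadditivity of \<open>s \<mapsto> \<Phi> (sqrt s)\<close> handles the left
  side, its convexity the right.\<close>

lemma clarkson:
  fixes a b :: "'a::real_inner"
  shows "2 * \<Phi> (norm ((1/2) *\<^sub>R (a + b))) + 2 * \<Phi> (norm ((1/2) *\<^sub>R (b - a))) \<le> \<Phi> (norm a) + \<Phi> (norm b)"
proof -
  define x y where "x = norm ((1/2) *\<^sub>R (a + b))" and "y = norm ((1/2) *\<^sub>R (b - a))"
  define z where "z = sqrt ((norm a ^ 2 + norm b ^ 2) / 2)"
  have z2: "z\<^sup>2 = (norm a ^ 2 + norm b ^ 2) / 2" and z0: "0 \<le> z" by (auto simp: z_def)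
  have "x\<^sup>2 + y\<^sup>2 = z\<^sup>2"
    unfolding x_def y_def z2 power2_norm_eq_inner
    by (simp add: inner_commute algebra_simps)
  then have "\<Phi> x + \<Phi> y \<le> \<Phi> z" by (intro Phi_square_superadd) (auto simp: x_def y_def z0)
  moreover have "2 * \<Phi> z \<le> \<Phi> (norm a) + \<Phi> (norm b)"
  proof (cases "z = 0")
    case True
    then show ?thesis using Phi_nonneg[of "norm a"] Phi_nonneg[of "norm b"] by simp
  next
    case False
    then have z: "z > 0" using z0 by simp
    \<comment> \<open>At the mean \<open>z\<^sup>2\<close> the two tangent corrections
      cancel.\<close>
    have "2 * \<Phi> z + ((norm a)\<^sup>2 - z\<^sup>2 + ((norm b)\<^sup>2 - z\<^sup>2)) * (\<phi> z / (2 * z)) \<le> \<Phi> (norm a) + \<Phi> (norm b)"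
      using Phi_square_tangent[OF z, of "norm a"] Phi_square_tangent[OF z, of "norm b"]
      by (simp add: algebra_simps)
    moreover have "(norm a)\<^sup>2 - z\<^sup>2 + ((norm b)\<^sup>2 - z\<^sup>2) = 0" using z2 by simp
    ultimately show ?thesis by simp
  qed
  ultimately show ?thesis unfolding x_def y_def by linarith
qed

text \<open>\<open>flux\<close> is the gradient of \<open>a \<mapsto> \<Phi> (norm a)\<close>;
  Cauchy-Schwarz reduces the claim to the scalar tangent inequality at
  \<open>norm a\<close>.\<close>

lemma Phi_flux_convex:
  fixes a b :: "real^'n"
  shows "\<Phi> (norm a) + flux \<phi> a \<bullet> (b - a) \<le> \<Phi> (norm b)"
proof -
  have "flux \<phi> a \<bullet> (b - a) \<le> \<phi> (norm a) * (norm b - norm a)"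
  proof (cases "a = 0")
    case False
    have "flux \<phi> a \<bullet> (b - a) = \<phi> (norm a) / norm a * (a \<bullet> b - norm a * norm a)"
      by (simp add: flux_def inner_diff_right flip: power2_norm_eq_inner) (use False in \<open>simp add: power2_eq_square field_simps\<close>)
    also have "\<dots> \<le> \<phi> (norm a) / norm a * (norm a * norm b - norm a * norm a)"
      by (intro mult_left_mono diff_right_mono norm_cauchy_schwarz) (simp add: phi_nonneg)
    also have "\<dots> = \<phi> (norm a) * (norm b - norm a)" using False by (simp add: field_simps)
    finally show ?thesis .
  qed (simp add: flux_def)
  then show ?thesis using Phi_tangent[of "norm a" "norm b"] by simp
qed

text \<open>First-order convexity at the midpoint, doubled, gives
  \<open>2 * \<Phi> (norm a) + flux \<phi> a \<bullet> (b - a)\<close> as a lower bound for twice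
  the midpoint value; \<open>clarkson\<close> leaves the quantitative remainder.\<close>

lemma Phi_flux_uniform:
  fixes a b :: "real^'n"
  shows "\<Phi> (norm a) + flux \<phi> a \<bullet> (b - a) + 2 * \<Phi> (norm ((1/2) *\<^sub>R (b - a))) \<le> \<Phi> (norm b)"
proof -
  have "(1/2) *\<^sub>R (a + b) - a = (1/2) *\<^sub>R (b - a)" by (simp add: vec_eq_iff field_simps)
  then show ?thesis
    using clarkson[of a b] Phi_flux_convex[of a "(1/2) *\<^sub>R (a + b)"] by simp
qed

lemma norm_flux [simp]: "norm (flux \<phi> a) = \<phi> (norm a)"
  by (cases "a = 0") (auto simp: flux_def phi_nonneg)

text \<open>The supremum in \<open>young_conj\<close> is taken in the reals and says nothing unless
  the set is bounded above. Since \<open>\<phi>\<close> tends to infinity, some \<open>w0\<close>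
  has slope at least \<open>t\<close>, and beyond it \<open>t * w - \<Phi> w\<close> gains
  nothing.\<close>

lemma conj_bdd: assumes "0 \<le> t" shows "bdd_above ((\<lambda>w. t * w - \<Phi> w) ` {0<..})"
proof -
  have "eventually (\<lambda>w. \<phi> w \<ge> t) at_top"
    using young unfolding young_function_def filterlim_at_top by blast
  then obtain w0 where w0: "\<phi> w0 \<ge> t" "w0 > 0"
    unfolding eventually_at_top_linorder by (metis gt_ex linorder_le_cases order.strict_trans2)
  have "t * w - \<Phi> w \<le> t * w0" if w: "w > 0" for w
  proof (cases "w \<le> w0")
    case True
    then show ?thesis using Phi_nonneg[of w] w assms mult_left_mono[OF True assms] by simp
  next
    case False
    have "t * (w - w0) \<le> \<phi> w0 * (w - w0)" using w0 False by (intro mult_right_mono) auto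
    then show ?thesis using Phi_tangent[of w0 w] Phi_nonneg[of w0] w0 w by (simp add: algebra_simps)
  qed
  then show ?thesis by (auto intro!: bdd_aboveI)
qed

lemma young_ineq: assumes "0 \<le> t" "0 \<le> w" shows "t * w \<le> young_conj \<Phi> t + \<Phi> w"
proof (cases "w = 0")
  case False
  then show ?thesis unfolding young_conj_def
    using cSUP_upper[OF _ conj_bdd[OF assms(1)], of w] assms by simp
next
  case True
  \<comment> \<open>The supremum ranges over positive \<open>w\<close> only, so \<open>w = 0\<close>
    is reached by letting \<open>e\<close> tend to 0.\<close>
  have "t * e \<le> young_conj \<Phi> t + \<Phi> e" if "e > 0" for e
    unfolding young_conj_def using cSUP_upper[OF _ conj_bdd[OF assms(1)], of e] that by simp
  then have "eventually (\<lambda>e. t * e \<le> young_conj \<Phi> t + \<Phi> e) (at_right 0)"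
    by (auto simp: eventually_at_filter)
  moreover have "((\<lambda>e. t * e) \<longlongrightarrow> t * 0) (at_right 0)" by (intro tendsto_intros)
  moreover have "((\<lambda>e. young_conj \<Phi> t + \<Phi> e) \<longlongrightarrow> young_conj \<Phi> t + \<Phi> 0) (at_right 0)"
    using continuous_on_Phi unfolding continuous_on
    by (intro tendsto_intros) (metis atLeast_iff at_within_Ici_at_right order_refl)
  ultimately have "t * 0 \<le> young_conj \<Phi> t + \<Phi> 0"
    by (intro tendsto_le[of "at_right 0"]) auto
  then show ?thesis using True by simp
qed

text \<open>\<open>a + h\<close> is the convex combination of \<open>a\<close> and
  \<open>a + h / c\<close> with weights \<open>1 - c\<close> and \<open>c\<close>. The small weight
  also multiplies the loss \<open>Kd\<close> from splitting the second point, so the coefficient of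
  \<open>\<Phi> a\<close> stays near 1.\<close>

lemma Phi_perturb:
  assumes "0 < d" "d < 1"
  shows "\<exists>K>0. \<forall>a\<ge>0. \<forall>h\<ge>0. \<Phi> (a + h) \<le> (1 + d) * \<Phi> a + K * \<Phi> h"
proof -
  define c where "c = min (1/2) (d / Kd)"
  have c: "0 < c" "c \<le> 1/2" "c * Kd \<le> d" using Kd_pos assms by (auto simp: c_def min_def field_simps)
  obtain K where K: "K > 0" "\<And>t. t \<ge> 0 \<Longrightarrow> \<Phi> (1 / c * t) \<le> K * \<Phi> t"
    using Phi_mult_bound[of "1/c"] c by auto
  have "\<Phi> (a + h) \<le> (1 + d) * \<Phi> a + Kd * K * \<Phi> h" if ah: "a \<ge> 0" "h \<ge> 0" for a h
  proof -
    have "a + h = (1 - c) * a + c * (a + 1 / c * h)" using c by (simp add: field_simps)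
    then have "\<Phi> (a + h) \<le> (1 - c) * \<Phi> a + c * \<Phi> (a + 1 / c * h)"
      using Phi_convex[of a "a + 1/c * h" c] ah c by simp
    also have "\<dots> \<le> 1 * \<Phi> a + c * (Kd * (\<Phi> a + K * \<Phi> h))"
    proof -
      have "\<Phi> (a + 1 / c * h) \<le> Kd * (\<Phi> a + \<Phi> (1 / c * h))" using ah c by (intro Phi_add_le) auto
      also have "\<dots> \<le> Kd * (\<Phi> a + K * \<Phi> h)" using K ah Kd_pos by (intro mult_left_mono add_left_mono) auto
      finally show ?thesis using c ah Phi_nonneg[of a] by (intro add_mono mult_right_mono mult_left_mono) auto
    qed
    also have "\<dots> = \<Phi> a + (c * Kd) * \<Phi> a + c * (Kd * K * \<Phi> h)" by (simp add: algebra_simps)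
    also have "\<dots> \<le> \<Phi> a + d * \<Phi> a + 1 * (Kd * K * \<Phi> h)"
      using c Phi_nonneg[OF ah(1)] Phi_nonneg[OF ah(2)] Kd_pos K
      by (intro add_mono mult_right_mono order_refl) auto
    finally show ?thesis by (simp add: algebra_simps)
  qed
  then show ?thesis using Kd_pos K by (intro exI[of _ "Kd * K"]) auto
qed

end

section \<open>Functions of class Ck\<close>

lemma Ck_SucD: "Ck (Suc k) f \<Longrightarrow> Ck k f"
proof (induction k arbitrary: f)
  case 0
  then show ?case
    by (simp add: continuous_at_imp_continuous_on differentiable_imp_continuous_within)
next
  case (Suc k) then show ?case by (metis Ck.simps(2))
qed

lemma Ck_le: "j \<le> k \<Longrightarrow> Ck k f \<Longrightarrow> Ck j f"
  by (induction k rule: dec_induct) (use Ck_SucD in blast)+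

lemma Ck_continuous: "Ck k f \<Longrightarrow> continuous_on S f"
  using Ck_le[of 0 k f] continuous_on_subset[of UNIV f S] by simp

definition grad :: "(real^'n \<Rightarrow> real) \<Rightarrow> real^'n \<Rightarrow> real^'n" where
  "grad f x = (\<chi> i. partial_deriv i f x)"

lemma grad_nth [simp]: "grad f x $ i = partial_deriv i f x"
  by (simp add: grad_def)

lemma has_derivative_grad:
  assumes "f differentiable (at x)"
  shows "(f has_derivative (\<lambda>h. grad f x \<bullet> h)) (at x)"
proof -
  have D: "(f has_derivative frechet_derivative f (at x)) (at x)"
    using assms by (simp add: frechet_derivative_works)
  have L: "linear (frechet_derivative f (at x))" using D by (rule has_derivative_linear)
  have "frechet_derivative f (at x) h = grad f x \<bullet> h" for h
  proof -
    have "frechet_derivative f (at x) h = frechet_derivative f (at x) (\<Sum>i\<in>UNIV. h $ i *\<^sub>R axis i 1)"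
      by (simp only: basis_expansion scalar_mult_eq_scaleR[symmetric])
    also have "\<dots> = (\<Sum>i\<in>UNIV. h $ i * partial_deriv i f x)"
      by (simp add: linear_sum[OF L] linear_cmul[OF L] partial_deriv_def)
    also have "\<dots> = grad f x \<bullet> h" by (simp add: inner_vec_def mult.commute)
    finally show ?thesis .
  qed
  then have "frechet_derivative f (at x) = (\<lambda>h. grad f x \<bullet> h)" by blast
  then show ?thesis using D by simp
qed

lemma partial_derivI:
  "(f has_derivative (\<lambda>h. g \<bullet> h)) (at x) \<Longrightarrow> partial_deriv i f x = g $ i"
  unfolding partial_deriv_def
  by (metis (lifting) frechet_derivative_at inner_axis inner_real_def mult.right_neutral)

lemma gradI: "(f has_derivative (\<lambda>h. g \<bullet> h)) (at x) \<Longrightarrow> grad f x = g"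
  by (simp add: vec_eq_iff partial_derivI)

text \<open>Smoothness is certified by exhibiting a gradient field; no partial derivative has to be
  computed from its definition.\<close>

lemma Ck_SucI:
  assumes "\<And>x. (f has_derivative (\<lambda>h. g x \<bullet> h)) (at x)" "\<And>i. Ck k (\<lambda>x. g x $ i)"
  shows "Ck (Suc k) f"
proof -
  have "partial_deriv i f = (\<lambda>x. g x $ i)" for i using assms(1) by (auto intro: partial_derivI)
  then show ?thesis using assms by (auto simp: differentiable_def)
qed

lemma Ck_const [simp]: "Ck k (\<lambda>x. c)"
proof (induction k arbitrary: c)
  case (Suc k) show ?case by (rule Ck_SucI[where g="\<lambda>x. 0"]) (auto intro!: derivative_eq_intros Suc)
qed simp

lemma Ck_add: "Ck k f \<Longrightarrow> Ck k g \<Longrightarrow> Ck k (\<lambda>x. f x + g x)"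
proof (induction k arbitrary: f g)
  case 0 then show ?case by (auto intro: continuous_intros)
next
  case (Suc k)
  show ?case
  proof (rule Ck_SucI)
    show "((\<lambda>x. f x + g x) has_derivative (\<lambda>h. (grad f x + grad g x) \<bullet> h)) (at x)" for x
      using Suc.prems by (auto intro!: derivative_eq_intros has_derivative_grad simp: inner_add_left)
    show "Ck k (\<lambda>x. (grad f x + grad g x) $ i)" for i using Suc by auto
  qed
qed

lemma Ck_mult: "Ck k f \<Longrightarrow> Ck k g \<Longrightarrow> Ck k (\<lambda>x. f x * g x)"
proof (induction k arbitrary: f g)
  case 0 then show ?case by (auto intro: continuous_intros)
next
  case (Suc k)
  show ?case
  proof (rule Ck_SucI)
    show "((\<lambda>x. f x * g x) has_derivative (\<lambda>h. (f x *\<^sub>R grad g x + g x *\<^sub>R grad f x) \<bullet> h)) (at x)" for x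
      using Suc.prems
      by (auto intro!: derivative_eq_intros has_derivative_grad simp: inner_add_left)
    show "Ck k (\<lambda>x. (f x *\<^sub>R grad g x + g x *\<^sub>R grad f x) $ i)" for i
      using Suc Ck_SucD[of k f] Ck_SucD[of k g] by (auto intro!: Ck_add)
  qed
qed

lemma Ck_minus: "Ck k f \<Longrightarrow> Ck k (\<lambda>x. - f x)"
  using Ck_mult[of k "\<lambda>x. -1" f] by simp

lemma Ck_diff: "Ck k f \<Longrightarrow> Ck k g \<Longrightarrow> Ck k (\<lambda>x. f x - g x)"
  using Ck_add[of k f "\<lambda>x. - g x"] by (simp add: Ck_minus)

lemma Ck_prod: "finite I \<Longrightarrow> (\<And>i. i \<in> I \<Longrightarrow> Ck k (f i)) \<Longrightarrow> Ck k (\<lambda>x. \<Prod>i\<in>I. f i x)"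
  by (induction I rule: finite_induct) (auto intro: Ck_mult)

lemma Ck_component: "Ck k (\<lambda>x. x $ i)"
proof (cases k)
  case (Suc m)
  show ?thesis unfolding Suc
    by (rule Ck_SucI[where g="\<lambda>x. axis i 1"])
      (auto simp: inner_axis' intro: bounded_linear_imp_has_derivative[OF bounded_linear_vec_nth])
qed (auto intro: continuous_intros)

text \<open>The outer function comes with the whole tower \<open>F n\<close> of its derivatives, so
  the induction on \<open>k\<close> with \<open>n\<close> arbitrary needs no separate notion of
  smoothness on the line.\<close>

lemma Ck_compose:
  assumes F: "\<And>n x. (F n has_real_derivative F (Suc n) x) (at x)" and f: "Ck k f"
  shows "Ck k (\<lambda>x. F n (f x))"
  using f
proof (induction k arbitrary: n)
  case 0
  have "continuous_on UNIV (F n)" using F by (meson DERIV_continuous_on has_field_derivative_at_within)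
  then show ?case using 0 by (auto intro: continuous_on_compose2)
next
  case (Suc k)
  show ?case
  proof (rule Ck_SucI)
    show "((\<lambda>x. F n (f x)) has_derivative (\<lambda>h. (F (Suc n) (f x) *\<^sub>R grad f x) \<bullet> h)) (at x)" for x
      using has_derivative_compose[OF has_derivative_grad F[THEN has_field_derivative_imp_has_derivative], of f x n] Suc.prems
      by simp
    show "Ck k (\<lambda>x. (F (Suc n) (f x) *\<^sub>R grad f x) $ i)" for i
      using Suc Ck_SucD[of k f] by (auto intro!: Ck_mult)
  qed
qed

section \<open>A flat function and smooth truncation\<close>

text \<open>With \<open>y = 1 / x\<close>, the derivative in \<open>x\<close> of
  \<open>p(y) exp(-y)\<close> is \<open>y^2 (p(y) - p'(y)) exp(-y)\<close>; the polynomial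
  \<open>[:0, 0, 1:]\<close> is \<open>y^2\<close>.\<close>

fun bump_poly :: "nat \<Rightarrow> real poly" where
  "bump_poly 0 = 1"
| "bump_poly (Suc n) = [:0, 0, 1:] * (bump_poly n - pderiv (bump_poly n))"

text \<open>\<open>bump n\<close> is the \<open>n\<close>-th derivative of the function equal to \<open>exp (-1/x)\<close> for \<open>x > 0\<close>
  and to \<open>0\<close> for \<open>x \<le> 0\<close>.\<close>

definition bump :: "nat \<Rightarrow> real \<Rightarrow> real" where
  "bump n x = (if x > 0 then poly (bump_poly n) (1 / x) * exp (- 1 / x) else 0)"

lemma poly_exp_tendsto_0: "((\<lambda>y. poly p y * exp (- y)) \<longlongrightarrow> (0::real)) at_top"
proof -
  have "((\<lambda>y. \<Sum>i\<le>degree p. coeff p i * (y ^ i / exp y)) \<longlongrightarrow> (\<Sum>i\<le>degree p. coeff p i * 0)) at_top"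
    by (intro tendsto_intros tendsto_power_div_exp_0)
  then show ?thesis by (simp add: poly_altdef sum_distrib_right exp_minus divide_inverse mult.assoc)
qed

lemma bump_deriv: "(bump n has_real_derivative bump (Suc n) x) (at x)"
proof -
  consider "x > 0" | "x < 0" | "x = 0" by linarith
  then show ?thesis
  proof cases
    case 1
    have "((\<lambda>x. poly (bump_poly n) (1 / x) * exp (- 1 / x)) has_real_derivative bump (Suc n) x) (at x)"
      using 1 by (auto intro!: derivative_eq_intros DERIV_chain2[OF poly_DERIV]
          simp: bump_def field_simps power2_eq_square)
    then show ?thesis
      by (rule has_field_derivative_transform_within_open[where S="{0<..}"]) (use 1 in \<open>auto simp: bump_def\<close>)
  next
    case 2
    have "((\<lambda>x. 0) has_real_derivative bump (Suc n) x) (at x)" using 2 by (auto simp: bump_def)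
    then show ?thesis
      by (rule has_field_derivative_transform_within_open[where S="{..<0}"]) (use 2 in \<open>auto simp: bump_def\<close>)
  next
    case 3
    have "((\<lambda>h. (bump n (0 + h) - bump n 0) / h) \<longlongrightarrow> 0) (at 0)"
    proof (rule filterlim_split_at)
      \<comment> \<open>With \<open>y = 1 / h\<close> the quotient \<open>bump n h / h\<close>
        becomes \<open>y * poly (bump_poly n) y * exp (- y)\<close>.\<close>
      have "((\<lambda>y. poly ([:0,1:] * bump_poly n) y * exp (- y)) \<longlongrightarrow> 0) at_top" by (rule poly_exp_tendsto_0)
      then have "((\<lambda>h. poly ([:0,1:] * bump_poly n) (inverse h) * exp (- (inverse h))) \<longlongrightarrow> 0) (at_right 0)"
        by (rule filterlim_compose[OF _ filterlim_inverse_at_top_right])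
      then show "((\<lambda>h. (bump n (0 + h) - bump n 0) / h) \<longlongrightarrow> 0) (at_right 0)"
        by (rule Lim_transform_eventually)
          (auto simp: eventually_at_filter bump_def field_simps)
      show "((\<lambda>h. (bump n (0 + h) - bump n 0) / h) \<longlongrightarrow> 0) (at_left 0)"
        by (rule Lim_transform_eventually[OF tendsto_const]) (auto simp: eventually_at_filter bump_def)
    qed
    then show ?thesis using 3 by (simp add: DERIV_def bump_def)
  qed
qed

lemma Ck_bump: "Ck k f \<Longrightarrow> Ck k (\<lambda>x. bump n (f x))"
  by (rule Ck_compose[of bump, OF bump_deriv])

lemma bump_0_bounds: "0 \<le> bump 0 x" "bump 0 x \<le> 1"
  by (auto simp: bump_def)

lemma bump_nonpos [simp]: "x \<le> 0 \<Longrightarrow> bump n x = 0"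
  by (auto simp: bump_def)

text \<open>The profile \<open>s * exp (-e/s)\<close>, of slope \<open>exp (-e/s) * (1 + e/s) \<le> 1\<close>, placed on either side
  of the dead zone \<open>\<bar>t\<bar> \<le> e\<close>.\<close>

definition trunc :: "real \<Rightarrow> real \<Rightarrow> real" where
  "trunc e t = (t - e) * bump 0 ((t - e) / e) + (t + e) * bump 0 (- (t + e) / e)"

definition trunc' :: "real \<Rightarrow> real \<Rightarrow> real" where
  "trunc' e t = bump 0 ((t - e) / e) + (t - e) * bump 1 ((t - e) / e) / e
     + bump 0 (- (t + e) / e) - (t + e) * bump 1 (- (t + e) / e) / e"

lemma trunc_deriv: "e > 0 \<Longrightarrow> (trunc e has_real_derivative trunc' e t) (at t)"
  unfolding trunc_def[abs_def] trunc'_def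
  by (rule derivative_eq_intros DERIV_chain2[OF bump_deriv[of 0]] refl | simp)+
    (simp add: field_simps)

lemma trunc_zero: "\<bar>t\<bar> \<le> e \<Longrightarrow> e > 0 \<Longrightarrow> trunc e t = 0"
  by (auto simp: trunc_def divide_nonpos_pos)

text \<open>The upper slope bound is \<open>1 + r \<le> exp r\<close> at \<open>r = e / s\<close>;
  the lower bound for the value is the same inequality at \<open>- r\<close>.\<close>

lemma flat_bounds:
  assumes "e > 0" "s > 0"
  shows "0 \<le> bump 0 (s / e) + s * bump 1 (s / e) / e" "bump 0 (s / e) + s * bump 1 (s / e) / e \<le> 1"
    "s - e \<le> s * bump 0 (s / e)" "s * bump 0 (s / e) \<le> s"
proof -
  have *: "bump 0 (s / e) + s * bump 1 (s / e) / e = exp (- (e / s)) * (1 + e / s)"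
    using assms by (simp add: bump_def field_simps power2_eq_square)
  show "0 \<le> bump 0 (s / e) + s * bump 1 (s / e) / e" unfolding * using assms by simp
  have "exp (- (e / s)) * (1 + e / s) \<le> exp (- (e / s)) * exp (e / s)"
    by (intro mult_left_mono exp_ge_add_one_self) auto
  then show "bump 0 (s / e) + s * bump 1 (s / e) / e \<le> 1" unfolding * by (simp flip: exp_add)
  have "1 - e / s \<le> bump 0 (s / e)" using exp_ge_add_one_self[of "- (e / s)"] assms by (simp add: bump_def)
  then have "s * (1 - e / s) \<le> s * bump 0 (s / e)" using assms by (intro mult_left_mono) auto
  then show "s - e \<le> s * bump 0 (s / e)" using assms by (simp add: algebra_simps)
  show "s * bump 0 (s / e) \<le> s" using assms bump_0_bounds mult_left_mono[of "bump 0 (s/e)" 1 s] by simp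
qed

lemma trunc'_bounds: assumes "e > 0" shows "\<bar>trunc' e t\<bar> \<le> 1"
proof -
  consider "t > e" | "t < -e" | "\<bar>t\<bar> \<le> e" by linarith
  then show ?thesis
  proof cases
    case 1
    then show ?thesis using flat_bounds[OF assms, of "t - e"] assms by (simp add: trunc'_def divide_nonpos_pos)
  next
    case 2
    then have "trunc' e t = bump 0 (- (t + e) / e) + (- (t + e)) * bump 1 (- (t + e) / e) / e"
      using assms by (simp add: trunc'_def divide_nonpos_pos) (simp add: field_simps)
    then show ?thesis using flat_bounds(1,2)[OF assms, of "- (t + e)"] 2 assms by linarith
  qed (use assms in \<open>simp add: trunc'_def divide_nonpos_pos\<close>)
qed

text \<open>The dead zone costs \<open>e\<close>, the flat factor at most another
  \<open>e\<close>.\<close>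

lemma trunc_close: assumes "e > 0" shows "\<bar>trunc e t - t\<bar> \<le> 2 * e"
proof -
  consider "t > e" | "t < -e" | "\<bar>t\<bar> \<le> e" by linarith
  then show ?thesis
  proof cases
    case 1
    then have "trunc e t = (t - e) * bump 0 ((t - e) / e)" using assms by (simp add: trunc_def divide_nonpos_pos)
    then show ?thesis using flat_bounds(3,4)[OF assms, of "t - e"] 1 assms by linarith
  next
    case 2
    then have "trunc e t = - (- (t + e) * bump 0 (- (t + e) / e))" using assms by (simp add: trunc_def divide_nonpos_pos) (simp add: field_simps)
    then show ?thesis using flat_bounds(3,4)[OF assms, of "- (t + e)"] 2 assms by linarith
  qed (use assms in \<open>simp add: trunc_zero\<close>)
qed

lemma Ck_trunc: "Ck k f \<Longrightarrow> e > 0 \<Longrightarrow> Ck k (\<lambda>x. trunc e (f x))"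
  unfolding trunc_def divide_inverse
  by (intro Ck_add Ck_mult Ck_diff Ck_bump Ck_minus Ck_const)

section \<open>Test functions\<close>

lemma test_functionsI:
  assumes "\<And>k. Ck k \<psi>" "compact K" "K \<subseteq> \<Omega>" "\<And>x. x \<notin> K \<Longrightarrow> \<psi> x = 0"
  shows "\<psi> \<in> test_functions \<Omega>"
proof -
  have "closure {x. \<psi> x \<noteq> 0} \<subseteq> K"
    using assms by (intro closure_minimal compact_imp_closed) auto
  then show ?thesis unfolding test_functions_def using assms
    by (auto intro: compact_closure[THEN iffD2] bounded_subset[OF compact_imp_bounded] closure_subset[THEN subsetD])
qed

lemma grad_zero_locally:
  assumes "open S" "x \<in> S" "\<And>y. y \<in> S \<Longrightarrow> f y = 0"
  shows "grad f x = 0"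
proof (rule gradI)
  have "((\<lambda>x. 0) has_derivative (\<lambda>h. 0 \<bullet> h)) (at x)" by simp
  then show "(f has_derivative (\<lambda>h. 0 \<bullet> h)) (at x)"
    by (rule has_derivative_transform_within_open[OF _ assms(1,2)]) (use assms in auto)
qed

text \<open>One compact set serves both \<open>\<psi>\<close> and its gradient, because off the
  closed support \<open>\<psi>\<close> vanishes on a neighbourhood.\<close>

lemma test_functionsE:
  assumes "\<psi> \<in> test_functions \<Omega>"
  obtains K where "compact K" "K \<subseteq> \<Omega>" "\<And>x. x \<notin> K \<Longrightarrow> \<psi> x = 0" "\<And>x. x \<notin> K \<Longrightarrow> grad \<psi> x = 0"
proof
  let ?K = "closure {x. \<psi> x \<noteq> 0}"
  show "compact ?K" "?K \<subseteq> \<Omega>" using assms by (auto simp: test_functions_def)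
  show *: "\<psi> x = 0" if "x \<notin> ?K" for x using that closure_subset[of "{x. \<psi> x \<noteq> 0}"] by auto
  show "grad \<psi> x = 0" if x: "x \<notin> ?K" for x
    by (rule grad_zero_locally[of "- ?K"]; (rule *)?) (use x in \<open>simp_all add: open_Compl\<close>)
qed

lemma test_Ck: "\<psi> \<in> test_functions \<Omega> \<Longrightarrow> Ck k \<psi>"
  by (auto simp: test_functions_def)

lemma test_mono: "\<Omega> \<subseteq> \<Omega>' \<Longrightarrow> \<psi> \<in> test_functions \<Omega> \<Longrightarrow> \<psi> \<in> test_functions \<Omega>'"
  by (auto simp: test_functions_def)

lemma test_zero: "(\<lambda>x. 0) \<in> test_functions \<Omega>"
  by (rule test_functionsI[where K="{}"]) auto

lemma test_add:
  assumes "\<psi> \<in> test_functions \<Omega>" "\<eta> \<in> test_functions \<Omega>"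
  shows "(\<lambda>x. \<psi> x + \<eta> x) \<in> test_functions \<Omega>"
proof -
  obtain K L where "compact K" "K \<subseteq> \<Omega>" "\<And>x. x \<notin> K \<Longrightarrow> \<psi> x = 0" "compact L" "L \<subseteq> \<Omega>" "\<And>x. x \<notin> L \<Longrightarrow> \<eta> x = 0"
    using assms by (metis test_functionsE)
  then show ?thesis using assms by (intro test_functionsI[where K="K \<union> L"]) (auto intro!: Ck_add test_Ck[OF assms(1)] test_Ck[OF assms(2)])
qed

lemma test_cmult:
  assumes "\<psi> \<in> test_functions \<Omega>" shows "(\<lambda>x. c * \<psi> x) \<in> test_functions \<Omega>"
proof -
  obtain K where "compact K" "K \<subseteq> \<Omega>" "\<And>x. x \<notin> K \<Longrightarrow> \<psi> x = 0"
    using assms by (metis test_functionsE)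
  then show ?thesis using assms by (intro test_functionsI[where K=K]) (auto intro!: Ck_mult test_Ck[OF assms])
qed

lemma test_diff:
  "\<psi> \<in> test_functions \<Omega> \<Longrightarrow> \<eta> \<in> test_functions \<Omega> \<Longrightarrow> (\<lambda>x. \<psi> x - \<eta> x) \<in> test_functions \<Omega>"
  using test_add[of \<psi> \<Omega> "\<lambda>x. (-1) * \<eta> x"] test_cmult[of \<eta> \<Omega> "-1"] by simp

lemma test_has_derivative:
  "\<psi> \<in> test_functions \<Omega> \<Longrightarrow> (\<psi> has_derivative (\<lambda>h. grad \<psi> x \<bullet> h)) (at x)"
  using test_Ck[of \<psi> \<Omega> "Suc 0"] by (intro has_derivative_grad) simp

lemma grad_add:
  "\<psi> \<in> test_functions \<Omega> \<Longrightarrow> \<eta> \<in> test_functions \<Omega> \<Longrightarrow> grad (\<lambda>x. \<psi> x + \<eta> x) x = grad \<psi> x + grad \<eta> x"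
  by (rule gradI) (auto intro!: derivative_eq_intros test_has_derivative simp: inner_add_left)

lemma grad_diff:
  "\<psi> \<in> test_functions \<Omega> \<Longrightarrow> \<eta> \<in> test_functions \<Omega> \<Longrightarrow> grad (\<lambda>x. \<psi> x - \<eta> x) x = grad \<psi> x - grad \<eta> x"
  by (rule gradI) (auto intro!: derivative_eq_intros test_has_derivative simp: inner_diff_left)

lemma grad_cmult:
  "\<psi> \<in> test_functions \<Omega> \<Longrightarrow> grad (\<lambda>x. c * \<psi> x) x = c *\<^sub>R grad \<psi> x"
  by (rule gradI) (auto intro!: derivative_eq_intros test_has_derivative)

lemma grad_zero [simp]: "grad (\<lambda>x. 0) x = 0"
  by (rule gradI) simp

lemma test_continuous: "\<psi> \<in> test_functions \<Omega> \<Longrightarrow> continuous_on S \<psi>"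
  using Ck_continuous[of 0] test_Ck by blast

lemma test_continuous_partial: "\<psi> \<in> test_functions \<Omega> \<Longrightarrow> continuous_on S (partial_deriv i \<psi>)"
  using Ck_continuous[of 0 "partial_deriv i \<psi>"] test_Ck[of \<psi> \<Omega> "Suc 0"] by auto

lemma test_continuous_grad: "\<psi> \<in> test_functions \<Omega> \<Longrightarrow> continuous_on S (grad \<psi>)"
  unfolding grad_def[abs_def] by (intro continuous_on_vec_lambda test_continuous_partial)

text \<open>The dead zone confines the support to a superlevel set, which is closed and lies in the
  compact support of \<open>\<psi>\<close>. The truncation thus belongs to any
  \<open>\<Omega>\<close> containing that set, whatever \<open>E\<close> is; slope at most 1 gives
  the gradient bound.\<close>

lemma test_trunc:
  assumes \<psi>: "\<psi> \<in> test_functions E" and e: "e > 0" and sub: "{x. e \<le> \<bar>\<psi> x\<bar>} \<subseteq> \<Omega>"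
  shows "(\<lambda>x. trunc e (\<psi> x)) \<in> test_functions \<Omega>"
    and "norm (grad (\<lambda>x. trunc e (\<psi> x)) x) \<le> norm (grad \<psi> x)"
proof -
  obtain K where K: "compact K" "\<And>x. x \<notin> K \<Longrightarrow> \<psi> x = 0" using \<psi> by (metis test_functionsE)
  have "closed {x. e \<le> \<bar>\<psi> x\<bar>}"
    by (intro closed_Collect_le continuous_intros test_continuous[OF \<psi>])
  moreover have "{x. e \<le> \<bar>\<psi> x\<bar>} \<subseteq> K" using K e by force
  ultimately have "compact {x. e \<le> \<bar>\<psi> x\<bar>}" using K by (metis Int_absorb1 compact_Int_closed)
  then show "(\<lambda>x. trunc e (\<psi> x)) \<in> test_functions \<Omega>"
    using sub e by (intro test_functionsI) (auto intro!: Ck_trunc test_Ck[OF \<psi>] trunc_zero)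
  have "grad (\<lambda>x. trunc e (\<psi> x)) x = trunc' e (\<psi> x) *\<^sub>R grad \<psi> x"
    using has_derivative_compose[OF test_has_derivative[OF \<psi>] trunc_deriv[OF e, THEN has_field_derivative_imp_has_derivative], of x]
    by (intro gradI) (simp add: mult.commute)
  then show "norm (grad (\<lambda>x. trunc e (\<psi> x)) x) \<le> norm (grad \<psi> x)"
    using mult_right_mono[OF trunc'_bounds[OF e, of "\<psi> x"], of "norm (grad \<psi> x)"] by simp
qed

section \<open>Integration by parts\<close>

lemma compact_support_integrable:
  fixes f :: "'a::euclidean_space \<Rightarrow> 'b::euclidean_space"
  assumes "continuous_on UNIV f" "compact K" "\<And>x. x \<notin> K \<Longrightarrow> f x = 0"
  shows "integrable lborel f" "integrable lebesgue f"
proof -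
  have "integrable lborel (\<lambda>x. indicator K x *\<^sub>R f x)"
    using assms by (intro borel_integrable_compact) (auto intro: continuous_on_subset)
  moreover have "(\<lambda>x. indicator K x *\<^sub>R f x) = f" using assms(3) by (auto simp: indicator_def)
  ultimately show "integrable lborel f" by simp
  then show "integrable lebesgue f" by (subst integrable_completion) auto
qed

lemma integral_cbox_compact_support:
  fixes f :: "'a::euclidean_space \<Rightarrow> real"
  assumes "continuous_on UNIV f" "\<And>x. x \<notin> cbox a b \<Longrightarrow> f x = 0"
  shows "integral (cbox a b) f = integral\<^sup>L lborel f"
proof -
  have "(f has_integral (integral\<^sup>L lborel f)) UNIV"
    by (intro has_integral_integral_lborel compact_support_integrable[where K="cbox a b"]) (use assms in auto)
  moreover have "f = (\<lambda>x. if x \<in> cbox a b then f x else 0)" using assms(2) by auto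
  ultimately have "(f has_integral (integral\<^sup>L lborel f)) (cbox a b)"
    by (metis has_integral_restrict_UNIV)
  then show ?thesis by (rule integral_unique)
qed

lemma integral_affine:
  fixes g :: "'a::euclidean_space \<Rightarrow> real"
  assumes g: "integrable lborel g" and c: "c \<noteq> 0"
  shows "integrable lborel (\<lambda>h. g (z + c *\<^sub>R h))"
    and "integral\<^sup>L lborel (\<lambda>h. g (z + c *\<^sub>R h)) = integral\<^sup>L lborel g / \<bar>c\<bar> ^ DIM('a)"
proof -
  have [measurable]: "g \<in> borel_measurable borel" using g by auto
  have eq: "lborel = density (distr lborel borel (\<lambda>x. z + c *\<^sub>R x)) (\<lambda>_. \<bar>c\<bar>^DIM('a))"
    by (rule lborel_affine[OF c])
  have "integrable (distr lborel borel (\<lambda>x. z + c *\<^sub>R x)) (\<lambda>x. \<bar>c\<bar>^DIM('a) *\<^sub>R g x)"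
    using g by (subst (asm) eq, subst (asm) integrable_density) auto
  then show "integrable lborel (\<lambda>h. g (z + c *\<^sub>R h))"
    using c by (simp add: integrable_distr_eq)
  have "integral\<^sup>L lborel g = integral\<^sup>L (distr lborel borel (\<lambda>x. z + c *\<^sub>R x)) (\<lambda>x. \<bar>c\<bar>^DIM('a) *\<^sub>R g x)"
    by (subst eq, subst integral_density) auto
  also have "\<dots> = \<bar>c\<bar>^DIM('a) * integral\<^sup>L lborel (\<lambda>h. g (z + c *\<^sub>R h))"
    by (subst integral_distr) auto
  finally show "integral\<^sup>L lborel (\<lambda>h. g (z + c *\<^sub>R h)) = integral\<^sup>L lborel g / \<bar>c\<bar> ^ DIM('a)"
    using c by simp
qed

text \<open>Differentiation under the integral. Centre \<open>z + t *\<^sub>R w\<close> and radius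
  \<open>c + t * d\<close> move together, so one formula serves translations (integration by parts)
  and dilations (the Morrey estimate); the radius may be 0.\<close>

lemma cube_average_deriv:
  fixes \<psi> :: "real^'n \<Rightarrow> real"
  assumes \<psi>: "Ck (Suc 0) \<psi>"
  shows "((\<lambda>t. integral (cbox a b) (\<lambda>h. \<psi> ((z + t *\<^sub>R w) + (c + t * d) *\<^sub>R h))) has_real_derivative
     integral (cbox a b) (\<lambda>h. grad \<psi> ((z + t *\<^sub>R w) + (c + t * d) *\<^sub>R h) \<bullet> (w + d *\<^sub>R h))) (at t)"
proof (rule leibniz_rule_field_derivative[where U=UNIV])
  have G: "continuous_on UNIV (grad \<psi>)"
    using \<psi> unfolding grad_def[abs_def] by (intro continuous_on_vec_lambda) auto
  show "((\<lambda>t. \<psi> ((z + t *\<^sub>R w) + (c + t * d) *\<^sub>R h)) has_real_derivative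
     grad \<psi> ((z + t *\<^sub>R w) + (c + t * d) *\<^sub>R h) \<bullet> (w + d *\<^sub>R h)) (at t)" for t h
  proof -
    have "((\<lambda>t. (z + t *\<^sub>R w) + (c + t * d) *\<^sub>R h) has_derivative (\<lambda>s. s *\<^sub>R (w + d *\<^sub>R h))) (at t)"
      by (auto intro!: derivative_eq_intros simp: algebra_simps)
    then show ?thesis unfolding has_field_derivative_def
      by (rule has_derivative_eq_rhs[OF has_derivative_compose[OF _ has_derivative_grad]])
        (use \<psi> in \<open>auto simp: fun_eq_iff\<close>)
  qed
  show "(\<lambda>h. \<psi> ((z + t *\<^sub>R w) + (c + t * d) *\<^sub>R h)) integrable_on cbox a b" for t
    by (intro integrable_continuous continuous_on_compose2[OF Ck_continuous[OF \<psi>, of UNIV]] continuous_intros) auto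
  show "continuous_on (UNIV \<times> cbox a b)
     (\<lambda>(t, h). grad \<psi> ((z + t *\<^sub>R w) + (c + t * d) *\<^sub>R h) \<bullet> (w + d *\<^sub>R h))"
    unfolding case_prod_beta
    by (intro continuous_intros continuous_on_compose2[OF G]) auto
qed auto

text \<open>Translation along axis \<open>i\<close> leaves the integral of \<open>F\<close>
  unchanged, and the derivative of the translated integral at \<open>t = 0\<close> is the integral
  of the partial derivative. This avoids iterated integrals.\<close>

lemma integral_partial_deriv_zero:
  fixes F :: "real^'n \<Rightarrow> real"
  assumes F: "Ck (Suc 0) F" and K: "compact K" "\<And>x. x \<notin> K \<Longrightarrow> F x = 0"
  shows "(\<integral>x. partial_deriv i F x \<partial>lebesgue) = 0"
proof -
  obtain R where R: "K \<subseteq> ball 0 R" using bounded_subset_ballD[OF compact_imp_bounded[OF K(1)]] by metis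
  \<comment> \<open>The margin 1 keeps every translate with \<open>\<bar>t\<bar> < 1\<close>
    supported inside the fixed box.\<close>
  obtain B where B: "cball 0 (R + 1) \<subseteq> cbox (- B) (B :: real^'n)"
    using bounded_subset_cbox_symmetric[OF bounded_cball] by metis
  define e where "e = (axis i 1 :: real^'n)"
  define A where "A t = integral (cbox (-B) B) (\<lambda>h. F ((0 + t *\<^sub>R e) + (1 + t * 0) *\<^sub>R h))" for t
  have D: "(A has_real_derivative integral (cbox (-B) B) (\<lambda>h. grad F ((0 + 0 *\<^sub>R e) + (1 + 0 * 0) *\<^sub>R h) \<bullet> (e + 0 *\<^sub>R h))) (at 0)"
    unfolding A_def by (rule cube_average_deriv[OF F])
  have c: "continuous_on UNIV F" by (rule Ck_continuous[OF F])
  have const: "A t = integral\<^sup>L lborel F" if "\<bar>t\<bar> < 1" for t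
  proof -
    have "A t = integral (cbox (-B) B) (\<lambda>h. F (t *\<^sub>R e + 1 *\<^sub>R h))" by (simp add: A_def)
    also have "\<dots> = integral\<^sup>L lborel (\<lambda>h. F (t *\<^sub>R e + 1 *\<^sub>R h))"
    proof (rule integral_cbox_compact_support)
      show "continuous_on UNIV (\<lambda>h. F (t *\<^sub>R e + 1 *\<^sub>R h))"
        by (intro continuous_on_compose2[OF c] continuous_intros) auto
      fix h assume "h \<notin> cbox (-B) B"
      then have "norm h > R + 1" using B by (force simp: dist_norm)
      then have "norm (t *\<^sub>R e + 1 *\<^sub>R h) > R"
        using norm_diff_ineq[of h "t *\<^sub>R e"] that by (simp add: e_def add.commute)
      then show "F (t *\<^sub>R e + 1 *\<^sub>R h) = 0" using K(2) R by (force simp: dist_norm)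
    qed
    also have "\<dots> = integral\<^sup>L lborel F"
      using integral_affine(2)[OF compact_support_integrable(1)[OF c K], of 1] by simp
    finally show ?thesis .
  qed
  have "(A has_real_derivative 0) (at 0)"
    by (rule has_field_derivative_transform_within_open[where f="\<lambda>_. integral\<^sup>L lborel F" and S="{-1<..<1}"])
      (auto simp: const)
  then have "integral (cbox (-B) B) (\<lambda>h. grad F h \<bullet> e) = 0" using DERIV_unique[OF D] by simp
  then have "integral (cbox (-B) B) (partial_deriv i F) = 0"
    by (simp add: e_def inner_axis)
  moreover have c': "continuous_on UNIV (partial_deriv i F)" using F by auto
  moreover have "partial_deriv i F x = 0" if "x \<notin> cbox (-B) B" for x
  proof -
    have "x \<notin> K" using that R B by (auto simp: subset_iff dist_norm)
    then have "grad F x = 0"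
      by (intro grad_zero_locally[of "- K"]) (use K compact_imp_closed in auto)
    then show ?thesis by (metis grad_nth zero_index)
  qed
  ultimately have "integral\<^sup>L lborel (partial_deriv i F) = 0"
    using integral_cbox_compact_support[OF c', of "-B" B] by simp
  then show ?thesis by (subst integral_completion) (auto intro: borel_measurable_continuous_onI c')
qed

lemma test_integrable_mult:
  assumes "\<psi> \<in> test_functions \<Omega>" "continuous_on UNIV g"
  shows "integrable lebesgue (\<lambda>x. g x * \<psi> x)" "integrable lebesgue (\<lambda>x. g x * partial_deriv i \<psi> x)"
proof -
  obtain K where K: "compact K" "\<And>x. x \<notin> K \<Longrightarrow> \<psi> x = 0" "\<And>x. x \<notin> K \<Longrightarrow> grad \<psi> x = 0"
    using assms by (metis test_functionsE)
  show "integrable lebesgue (\<lambda>x. g x * \<psi> x)"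
    by (rule compact_support_integrable[OF _ K(1)])
      (auto intro!: continuous_intros assms test_continuous[OF assms(1)] K)
  show "integrable lebesgue (\<lambda>x. g x * partial_deriv i \<psi> x)"
    by (rule compact_support_integrable[OF _ K(1)])
      (auto intro!: continuous_intros assms test_continuous_partial[OF assms(1)], metis K(3) grad_nth zero_index)
qed

lemma test_by_parts:
  assumes \<psi>: "\<psi> \<in> test_functions \<Omega>" and \<eta>: "\<eta> \<in> test_functions \<Omega>'"
  shows "(\<integral>x. \<psi> x * partial_deriv i \<eta> x \<partial>lebesgue) = - (\<integral>x. partial_deriv i \<psi> x * \<eta> x \<partial>lebesgue)"
proof -
  obtain K where K: "compact K" "\<And>x. x \<notin> K \<Longrightarrow> \<psi> x = 0" using assms by (metis test_functionsE)
  have g: "grad (\<lambda>x. \<psi> x * \<eta> x) x = \<psi> x *\<^sub>R grad \<eta> x + \<eta> x *\<^sub>R grad \<psi> x" for x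
    using \<psi> \<eta> by (intro gradI) (auto intro!: derivative_eq_intros test_has_derivative simp: inner_add_left)
  have p: "partial_deriv i (\<lambda>x. \<psi> x * \<eta> x) x = \<psi> x * partial_deriv i \<eta> x + partial_deriv i \<psi> x * \<eta> x" for x
    using arg_cong[OF g[of x], of "\<lambda>v. v $ i"] by (simp add: mult.commute)
  have "(\<integral>x. \<psi> x * partial_deriv i \<eta> x + partial_deriv i \<psi> x * \<eta> x \<partial>lebesgue) = 0"
    using integral_partial_deriv_zero[OF Ck_mult[OF test_Ck[OF \<psi>] test_Ck[OF \<eta>]] K(1), of i] K(2)
    by (simp add: p)
  then show ?thesis
    using test_integrable_mult(2)[OF \<eta> test_continuous[OF \<psi>]] test_integrable_mult(1)[OF \<eta> test_continuous_partial[OF \<psi>]]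
    by simp
qed

section \<open>The fundamental lemma of the calculus of variations\<close>

text \<open>The positive and negative parts are densities of two measures that agree on boxes, a
  generating family stable under intersection, hence agree everywhere; densities of the same measure
  coincide almost everywhere.\<close>

lemma AE_zero_of_box_integrals:
  fixes H :: "'a::euclidean_space \<Rightarrow> real"
  assumes H: "integrable lebesgue H" and z: "\<And>a b. (\<integral>x. indicator (box a b) x * H x \<partial>lebesgue) = 0"
  shows "AE x in lebesgue. H x = 0"
proof -
  \<comment> \<open>Boxes generate only the Borel sets, so \<open>H\<close> is first replaced by a
    Borel representative.\<close>
  obtain G where G[measurable]: "G \<in> borel_measurable lborel" and HG: "AE x in lborel. H x = G x"
    using completion_ex_borel_measurable_real[of H lborel] H by auto
  have HG': "AE x in lebesgue. H x = G x" using HG by (rule AE_completion)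
  have "integrable lebesgue G" using H HG'
    by (subst integrable_cong_AE[of _ _ H]) (auto intro: measurable_completion)
  then have Gi: "integrable lborel G" by (simp add: integrable_completion)
  have Gz: "(\<integral>x. indicator (box a b) x * G x \<partial>lborel) = 0" for a b
  proof -
    have "(\<integral>x. indicator (box a b) x * G x \<partial>lborel) = (\<integral>x. indicator (box a b) x * G x \<partial>lebesgue)"
      by (rule integral_completion[symmetric]) auto
    also have "\<dots> = (\<integral>x. indicator (box a b) x * H x \<partial>lebesgue)"
      using HG' H by (intro integral_cong_AE) (auto intro!: borel_measurable_times intro: measurable_completion)
    finally show ?thesis using z by simp
  qed
  define p n where "p x = max 0 (G x)" and "n x = max 0 (- G x)" for x
  have pn: "integrable lborel p" "integrable lborel n" unfolding p_def[abs_def] n_def[abs_def] using Gi by auto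
  have pn0: "0 \<le> p x" "0 \<le> n x" for x by (auto simp: p_def n_def)
  have [measurable]: "p \<in> borel_measurable borel" "n \<in> borel_measurable borel"
    using pn by auto
  have emp: "emeasure (density lborel (\<lambda>x. ennreal (q x))) (box a b) = ennreal (\<integral>x. indicator (box a b) x * q x \<partial>lborel)"
    if q: "integrable lborel q" "\<And>x. 0 \<le> q x" for q a b
  proof -
    have [measurable]: "q \<in> borel_measurable borel" using q by auto
    have "emeasure (density lborel (\<lambda>x. ennreal (q x))) (box a b) = (\<integral>\<^sup>+x. ennreal (indicator (box a b) x * q x) \<partial>lborel)"
      by (subst emeasure_density) (auto intro!: nn_integral_cong simp: indicator_def)
    also have "\<dots> = ennreal (\<integral>x. indicator (box a b) x * q x \<partial>lborel)"
      using integrable_mult_indicator[OF _ q(1), of "box a b"] q(2) by (intro nn_integral_eq_integral) auto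
    finally show ?thesis .
  qed
  have "density lborel (\<lambda>x. ennreal (p x)) = density lborel (\<lambda>x. ennreal (n x))"
  proof (rule measure_eqI_generator_eq[where E="range (\<lambda>(a, b). box a b)" and \<Omega>=UNIV
        and A="\<lambda>n::nat. box (- (real n *\<^sub>R One)) (real n *\<^sub>R One)"])
    show "Int_stable (range (\<lambda>(a, b). box a b :: 'a set))"
      by (auto simp: Int_stable_def box_Int_box)
    show "emeasure (density lborel (\<lambda>x. ennreal (p x))) X = emeasure (density lborel (\<lambda>x. ennreal (n x))) X"
      if X: "X \<in> range (\<lambda>(a, b). box a b)" for X
    proof -
      obtain a b where X: "X = box a b" using X by auto
      have i: "integrable lborel (\<lambda>x. indicator (box a b) x * p x)" "integrable lborel (\<lambda>x. indicator (box a b) x * n x)"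
        using integrable_mult_indicator[OF _ pn(1), of "box a b"] integrable_mult_indicator[OF _ pn(2), of "box a b"] by auto
      have "(\<integral>x. indicator (box a b) x * G x \<partial>lborel) =
          (\<integral>x. indicator (box a b) x * p x - indicator (box a b) x * n x \<partial>lborel)"
        by (intro Bochner_Integration.integral_cong) (auto simp: p_def n_def max_def indicator_def)
      also have "\<dots> = (\<integral>x. indicator (box a b) x * p x \<partial>lborel) - (\<integral>x. indicator (box a b) x * n x \<partial>lborel)"
        using i by (rule Bochner_Integration.integral_diff)
      finally show ?thesis using Gz[of a b] unfolding X by (simp add: emp pn pn0)
    qed
    show "emeasure (density lborel (\<lambda>x. ennreal (p x))) (box (- (real k *\<^sub>R One)) (real k *\<^sub>R One)) \<noteq> \<infinity>" for k
      using emp[OF pn(1)] by (simp add: p_def)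
    show "(\<Union>n::nat. box (- (real n *\<^sub>R One)) (real n *\<^sub>R One)) = (UNIV :: 'a set)"
      by (rule UN_box_eq_UNIV)
  qed (auto simp: borel_eq_box)
  then have "AE x in lborel. ennreal (p x) = ennreal (n x)"
    by (intro sigma_finite_measure.density_unique[OF lborel.sigma_finite_measure_axioms]) auto
  then have "AE x in lborel. G x = 0"
    by eventually_elim (auto simp: p_def n_def max_def split: if_splits)
  then have "AE x in lebesgue. G x = 0" by (rule AE_completion)
  then show ?thesis using HG' by eventually_elim simp
qed

text \<open>Smooth bumps converge boundedly to the indicator of a box, so \<open>g\<close>
  integrates to 0 over every box whose closed box lies in \<open>\<Omega>\<close>; countably many
  closed boxes cover \<open>\<Omega>\<close>.\<close>

lemma fundamental_lemma:
  fixes g :: "real^'n \<Rightarrow> real"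
  assumes \<Omega>: "open \<Omega>" and li: "locally_integrable \<Omega> g"
    and z: "\<And>\<psi>. \<psi> \<in> test_functions \<Omega> \<Longrightarrow> (\<integral>x. g x * \<psi> x \<partial>lebesgue_on \<Omega>) = 0"
  shows "AE x in lebesgue. x \<in> \<Omega> \<longrightarrow> g x = 0"
proof -
  have \<Omega>m: "\<Omega> \<in> sets lebesgue" using \<Omega> by auto
  have boxint: "(\<integral>x. indicator (box a b) x * g x \<partial>lebesgue) = 0" if ab: "cbox a b \<subseteq> \<Omega>" for a b
  proof -
    \<comment> \<open>Each factor \<open>bump 0 (real m * s)\<close> tends to 1 for
      \<open>s > 0\<close> and is 0 otherwise, so the product tends to the indicator of
      \<open>box a b\<close> and vanishes off it.\<close>
    define B where "B m x = (\<Prod>i\<in>UNIV. bump 0 (real m * (x $ i - a $ i)) * bump 0 (real m * (b $ i - x $ i)))" for m and x :: "real^'n"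
    have gi: "set_integrable lebesgue (cbox a b) g" using li ab by (auto simp: locally_integrable_def)
    have B0: "B m x = 0" if x: "x \<notin> box a b" for m x
    proof -
      obtain i where "\<not> (a $ i < x $ i \<and> x $ i < b $ i)" using x unfolding mem_box_cart by blast
      then have "x $ i \<le> a $ i \<or> b $ i \<le> x $ i" by linarith
      then have "bump 0 (real m * (x $ i - a $ i)) * bump 0 (real m * (b $ i - x $ i)) = 0"
        by (auto simp: mult_nonneg_nonpos)
      then show ?thesis unfolding B_def by (intro prod_zero) auto
    qed
    have Bb: "0 \<le> B m x" "B m x \<le> 1" for m x
      unfolding B_def by (auto intro!: prod_nonneg prod_le_1 mult_le_one simp: bump_0_bounds)
    have Bt: "B m \<in> test_functions \<Omega>" for m
    proof (rule test_functionsI[where K="cbox a b"])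
      show "Ck k (B m)" for k
        unfolding B_def[abs_def] by (intro Ck_prod Ck_mult Ck_bump Ck_diff Ck_component Ck_const) auto
      show "B m x = 0" if "x \<notin> cbox a b" for x using B0 that box_subset_cbox by blast
    qed (use ab in auto)
    have Blim: "(\<lambda>m. B m x) \<longlonglongrightarrow> indicator (box a b) x" for x
    proof (cases "x \<in> box a b")
      case True
      have 1: "(\<lambda>m. bump 0 (real m * t)) \<longlonglongrightarrow> 1" if "t > 0" for t
      proof -
        have "(\<lambda>m. exp (- ((1 / t) / real m))) \<longlonglongrightarrow> exp (- 0)"
          by (intro tendsto_intros lim_const_over_n)
        then have "(\<lambda>m. exp (- ((1 / t) / real m))) \<longlonglongrightarrow> 1" by simp
        then show ?thesis
        proof (rule Lim_transform_eventually)
          show "eventually (\<lambda>m. exp (- ((1 / t) / real m)) = bump 0 (real m * t)) sequentially"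
            using eventually_gt_at_top[of 0] by eventually_elim (use that in \<open>simp add: bump_def field_simps\<close>)
        qed
      qed
      have "(\<lambda>m. B m x) \<longlonglongrightarrow> (\<Prod>i\<in>(UNIV::'n set). 1 * 1)"
        unfolding B_def by (intro tendsto_prod tendsto_mult 1) (use True in \<open>auto simp: mem_box_cart\<close>)
      then show ?thesis using True by simp
    qed (use B0 in simp)
    have Bz: "(\<integral>x. B m x * (indicator (cbox a b) x * g x) \<partial>lebesgue) = 0" for m
    proof -
      have "0 = (\<integral>x. g x * B m x \<partial>lebesgue_on \<Omega>)" using z[OF Bt] by simp
      also have "\<dots> = (\<integral>x. indicator \<Omega> x *\<^sub>R (g x * B m x) \<partial>lebesgue)"
        by (rule integral_restrict_space) (use \<Omega>m in auto)
      also have "\<dots> = (\<integral>x. B m x * (indicator (cbox a b) x * g x) \<partial>lebesgue)"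
        using B0 ab box_subset_cbox[of a b]
        by (intro Bochner_Integration.integral_cong) (auto simp: indicator_def)
      finally show ?thesis by simp
    qed
    have "(\<lambda>m. (\<integral>x. B m x * (indicator (cbox a b) x * g x) \<partial>lebesgue)) \<longlonglongrightarrow>
        (\<integral>x. indicator (box a b) x * (indicator (cbox a b) x * g x) \<partial>lebesgue)"
    proof (rule integral_dominated_convergence[where w="\<lambda>x. \<bar>indicator (cbox a b) x * g x\<bar>"])
      have gm: "(\<lambda>x. indicator (cbox a b) x * g x) \<in> borel_measurable lebesgue"
        using gi by (auto simp: set_integrable_def)
      show "(\<lambda>x. indicator (box a b) x * (indicator (cbox a b) x * g x)) \<in> borel_measurable lebesgue"
        by (rule borel_measurable_times[OF borel_measurable_indicator gm]) auto
      have "B m \<in> borel_measurable lebesgue" for m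
        using borel_measurable_continuous_onI[OF test_continuous[OF Bt]] measurable_completion[of "B m" lborel] by simp
      then show "(\<lambda>x. B m x * (indicator (cbox a b) x * g x)) \<in> borel_measurable lebesgue" for m
        using gm by (rule borel_measurable_times)
      show "integrable lebesgue (\<lambda>x. \<bar>indicator (cbox a b) x * g x\<bar>)"
        using gi by (auto simp: set_integrable_def intro!: integrable_abs)
      show "AE x in lebesgue. (\<lambda>m. B m x * (indicator (cbox a b) x * g x)) \<longlonglongrightarrow> indicator (box a b) x * (indicator (cbox a b) x * g x)"
        by (intro AE_I2 tendsto_mult Blim tendsto_const)
      show "AE x in lebesgue. norm (B m x * (indicator (cbox a b) x * g x)) \<le> \<bar>indicator (cbox a b) x * g x\<bar>" for m
        using Bb by (intro AE_I2) (auto simp: abs_mult intro: mult_left_le_one_le)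
    qed
    then have "(\<integral>x. indicator (box a b) x * (indicator (cbox a b) x * g x) \<partial>lebesgue) = 0"
      unfolding Bz by (simp add: LIMSEQ_const_iff)
    moreover have "(\<lambda>x. indicator (box a b) x * (indicator (cbox a b) x * g x)) = (\<lambda>x. indicator (box a b) x * g x)"
      using box_subset_cbox[of a b] by (auto simp: indicator_def fun_eq_iff)
    ultimately show ?thesis by simp
  qed
  have local0: "AE x in lebesgue. x \<in> box a b \<longrightarrow> g x = 0" if ab: "cbox a b \<subseteq> \<Omega>" for a b
  proof -
    have gi: "set_integrable lebesgue (cbox a b) g" using li ab by (auto simp: locally_integrable_def)
    have "AE x in lebesgue. indicator (box a b) x * g x = 0"
    proof (rule AE_zero_of_box_integrals)
      have "set_integrable lebesgue (box a b) g"
        by (rule set_integrable_subset[OF gi]) (use box_subset_cbox in auto)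
      then show "integrable lebesgue (\<lambda>x. indicator (box a b) x * g x)" by (simp add: set_integrable_def)
      fix c d
      obtain p q where pq: "box c d \<inter> box a b = box p q" by (rule that[OF box_Int_box])
      have "(\<integral>x. indicator (box c d) x * (indicator (box a b) x * g x) \<partial>lebesgue) = (\<integral>x. indicator (box p q) x * g x \<partial>lebesgue)"
        unfolding pq[symmetric] by (intro Bochner_Integration.integral_cong) (auto simp: indicator_def)
      also have "\<dots> = 0"
      proof (cases "box p q = {}")
        case False
        then have "box a b \<noteq> {}" "box p q \<subseteq> box a b" using pq by blast+
        \<comment> \<open>\<open>boxint\<close> needs the closed box inside \<open>\<Omega>\<close>.
          Taking closures gives this, but only for nonempty boxes.\<close>
        then have "cbox p q \<subseteq> cbox a b"
          using closure_mono[of "box p q" "box a b"] closure_box[of p q] closure_box[of a b] False by simp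
        then show ?thesis using boxint[of p q] ab by auto
      qed simp
      finally show "(\<integral>x. indicator (box c d) x * (indicator (box a b) x * g x) \<partial>lebesgue) = 0" .
    qed
    then show ?thesis by eventually_elim (auto simp: indicator_def)
  qed
  obtain \<D> where \<D>: "countable \<D>" "\<D> \<subseteq> Pow \<Omega>" "\<And>X. X \<in> \<D> \<Longrightarrow> \<exists>a b. X = cbox a b" "\<Union>\<D> = \<Omega>"
    using open_countable_Union_open_cbox[OF \<Omega>] by metis
  have "AE x in lebesgue. \<forall>X\<in>\<D>. x \<in> X \<longrightarrow> g x = 0"
  proof (rule AE_ball_countable[THEN iffD2, OF \<D>(1)], intro ballI)
    fix X assume "X \<in> \<D>"
    then have "X \<subseteq> \<Omega>" using \<D>(2) by blast
    moreover obtain a b where "X = cbox a b" using \<D>(3)[OF \<open>X \<in> \<D>\<close>] by blast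
    ultimately have X: "X = cbox a b" "cbox a b \<subseteq> \<Omega>" by auto
    \<comment> \<open>The cover uses closed boxes while \<open>local0\<close> speaks of open ones;
      the faces are null.\<close>
    have "AE x in lebesgue. x \<notin> cbox a b - box a b"
      using negligible_frontier_interval[of a b] by (intro AE_not_in) (simp add: negligible_iff_null_sets)
    with local0[OF X(2)] show "AE x in lebesgue. x \<in> X \<longrightarrow> g x = 0"
      unfolding X(1) by eventually_elim auto
  qed
  then show ?thesis by eventually_elim (use \<D>(4) in blast)
qed

section \<open>A Morrey estimate\<close>

context convex_young
begin

section \<open>The inverse function and dyadic scales\<close>

definition PhiInv :: "real \<Rightarrow> real" where "PhiInv = the_inv_into {0..} \<Phi>"

lemma inj_on_Phi: "inj_on \<Phi> {0..}"
  by (rule linorder_inj_onI) (use Phi_strict_mono in force)+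

lemma Phi_surj: assumes "0 \<le> t" shows "\<exists>s\<ge>0. \<Phi> s = t"
proof -
  \<comment> \<open>Convexity gives \<open>\<Phi> b \<ge> b * \<Phi> 1 = \<Phi> 1 + t\<close>, so
    \<open>t\<close> lies between two values of \<open>\<Phi>\<close>.\<close>
  define b where "b = 1 + t / \<Phi> 1"
  have p: "\<Phi> 1 > 0" by (rule Phi_pos) simp
  have b: "b \<ge> 1" using assms p by (simp add: b_def)
  have "\<Phi> (1 / b * b) \<le> 1 / b * \<Phi> b" by (rule Phi_scale_le) (use b in auto)
  then have "b * \<Phi> 1 \<le> \<Phi> b" using b by (simp add: field_simps)
  moreover have "b * \<Phi> 1 = \<Phi> 1 + t" using p by (simp add: b_def field_simps)
  ultimately have "t \<le> \<Phi> b" using p by simp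
  then show ?thesis
    using IVT'[of \<Phi> 0 t b] assms b continuous_on_subset[OF continuous_on_Phi, of "{0..b}"] by auto
qed

lemma
  assumes "0 \<le> t"
  shows PhiInv_nonneg: "0 \<le> PhiInv t" and Phi_PhiInv: "\<Phi> (PhiInv t) = t"
proof -
  have t: "t \<in> \<Phi> ` {0..}" using Phi_surj[OF assms] by auto
  show "0 \<le> PhiInv t" using the_inv_into_into[OF inj_on_Phi t subset_refl] by (simp add: PhiInv_def)
  show "\<Phi> (PhiInv t) = t" using f_the_inv_into_f[OF inj_on_Phi t] by (simp add: PhiInv_def)
qed

lemma PhiInv_mono: "0 \<le> s \<Longrightarrow> s \<le> t \<Longrightarrow> PhiInv s \<le> PhiInv t"
  using Phi_strict_mono[of "PhiInv t" "PhiInv s"] PhiInv_nonneg Phi_PhiInv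
  by (metis linorder_not_less order_trans)

lemma PhiInv_pos: "0 < t \<Longrightarrow> 0 < PhiInv t"
  using PhiInv_nonneg[of t] Phi_PhiInv[of t] by (cases "PhiInv t = 0") auto

text \<open>The integral test on the blocks from \<open>2 ^ (N * j)\<close> to
  \<open>2 ^ (N * (j + 1))\<close>. With \<open>r = (1/2) ^ j\<close> the summand is
  \<open>r * PhiInv (1 / r ^ N)\<close>, which will bound the change of averages between consecutive
  dyadic cubes.\<close>

lemma dyadic_summable:
  assumes I: "set_integrable lborel {1..} (\<lambda>t. PhiInv t / t powr (1 + 1 / real N))" and N: "N \<ge> 1"
  shows "summable (\<lambda>j. (1/2) ^ j * PhiInv (2 ^ (N * j)))"
proof -
  define f where "f t = PhiInv t / t powr (1 + 1 / real N)" for t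
  define a where "a j = (2::real) ^ (N * j)" for j :: nat
  have a1: "1 \<le> a j" "a j \<le> a (Suc j)" for j by (auto simp: a_def)
  have f0: "0 \<le> f t" if "t \<ge> 1" for t using PhiInv_nonneg[of t] that by (simp add: f_def)
  have fi: "set_integrable lborel S f" if "S \<subseteq> {1..}" "S \<in> sets borel" for S
    using set_integrable_subset[OF I] that unfolding f_def by auto
  \<comment> \<open>On block \<open>j\<close> the power of \<open>t\<close> is at most
    \<open>2 ^ ((N + 1) * (j + 1))\<close> and the block is at least
    \<open>a j = 2 ^ (N * j)\<close> long; the quotient of length by power is
    \<open>c * (1/2) ^ j\<close>.\<close>
  define c where "c = (1/2::real) ^ (N + 1)"
  have c: "c > 0" by (simp add: c_def)
  have step: "c * ((1/2) ^ j * PhiInv (a j)) \<le> (LINT t:{a j..<a (Suc j)}|lborel. f t)" for j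
  proof -
    define v where "v = PhiInv (a j) / (2 ^ ((N + 1) * (j + 1)))"
    have v: "v \<le> f t" if t: "t \<in> {a j..<a (Suc j)}" for t
    proof -
      have t1: "1 \<le> t" using t a1[of j] by auto
      have "t powr (1 + 1 / real N) \<le> a (Suc j) powr (1 + 1 / real N)"
        using t t1 by (intro powr_mono2) auto
      also have "\<dots> = 2 powr (real (N * Suc j) * (1 + 1 / real N))"
        by (simp add: a_def powr_powr flip: powr_realpow)
      also have "real (N * Suc j) * (1 + 1 / real N) = real ((N + 1) * (j + 1))"
        using N by (simp add: field_simps)
      also have "2 powr real ((N + 1) * (j + 1)) = 2 ^ ((N + 1) * (j + 1))" by (rule powr_realpow) simp
      finally have "t powr (1 + 1 / real N) \<le> 2 ^ ((N + 1) * (j + 1))" .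
      moreover have "PhiInv (a j) \<le> PhiInv t" using t a1[of j] by (intro PhiInv_mono) auto
      ultimately show ?thesis unfolding v_def f_def
        using t1 PhiInv_nonneg[of "a j"] a1[of j] by (intro frac_le) auto
    qed
    have vi: "set_integrable lborel {a j..<a (Suc j)} (\<lambda>_. v)"
      using a1[of j] by (auto simp: set_integrable_def)
    have "(a (Suc j) - a j) * v = (LINT t:{a j..<a (Suc j)}|lborel. v)"
      using a1[of j] by (simp add: set_lebesgue_integral_def)
    also have "\<dots> \<le> (LINT t:{a j..<a (Suc j)}|lborel. f t)"
      by (rule set_integral_mono[OF vi fi v]) (use a1[of j] in auto)
    finally have "(a (Suc j) - a j) * v \<le> (LINT t:{a j..<a (Suc j)}|lborel. f t)" .
    moreover have "c * ((1/2) ^ j * PhiInv (a j)) \<le> (a (Suc j) - a j) * v"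
    proof -
      have v0: "0 \<le> v" unfolding v_def using PhiInv_nonneg[of "a j"] a1[of j] by simp
      have "(2::real) ^ 1 \<le> 2 ^ N" using N by (intro power_increasing) auto
      then have "a j * 2 \<le> a j * 2 ^ N" using a1[of j] by (intro mult_left_mono) auto
      then have "a j \<le> a (Suc j) - a j" by (simp add: a_def power_add)
      then have "a j * v \<le> (a (Suc j) - a j) * v" using v0 by (rule mult_right_mono)
      moreover have "a j * v = c * ((1/2) ^ j * PhiInv (a j))"
        by (simp add: v_def c_def a_def power_add power_divide algebra_simps)
      ultimately show ?thesis by simp
    qed
    ultimately show ?thesis by linarith
  qed
  have S: "(\<Sum>j<m. c * ((1/2) ^ j * PhiInv (a j))) \<le> (LINT t:{1..<a m}|lborel. f t)" for m
  proof (induction m)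
    case 0 show ?case by (simp add: a_def set_lebesgue_integral_def)
  next
    case (Suc m)
    have "{1..<a (Suc m)} = {1..<a m} \<union> {a m..<a (Suc m)}" using a1[of m] by auto
    moreover have "set_integrable lborel {1..<a m} f" "set_integrable lborel {a m..<a (Suc m)} f"
      using a1[of m] by (auto intro!: fi)
    ultimately have "(LINT t:{1..<a (Suc m)}|lborel. f t) = (LINT t:{1..<a m}|lborel. f t) + (LINT t:{a m..<a (Suc m)}|lborel. f t)"
      using set_integral_Un[of "{1..<a m}" "{a m..<a (Suc m)}" lborel f] by auto
    then show ?case using Suc step[of m] by simp
  qed
  have "summable (\<lambda>j. c * ((1/2) ^ j * PhiInv (a j)))"
  proof (rule summableI_nonneg_bounded)
    show "0 \<le> c * ((1/2) ^ j * PhiInv (a j))" for j using c PhiInv_nonneg[of "a j"] a1[of j] by simp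
    show "(\<Sum>j<m. c * ((1/2) ^ j * PhiInv (a j))) \<le> (LINT t:{1..}|lborel. f t)" for m
    proof -
      have "(LINT t:{1..<a m}|lborel. f t) \<le> (LINT t:{1..}|lborel. f t)"
        unfolding set_lebesgue_integral_def
      proof (rule integral_mono)
        show "integrable lborel (\<lambda>x. indicat_real {1..<a m} x *\<^sub>R f x)"
          using fi[of "{1..<a m}"] unfolding set_integrable_def by force
        show "integrable lborel (\<lambda>x. indicat_real {1..} x *\<^sub>R f x)"
          using fi[of "{1..}"] unfolding set_integrable_def by force
      qed (use f0 in \<open>auto simp: indicator_def\<close>)
      then show ?thesis using S[of m] by linarith
    qed
  qed
  then show ?thesis using c by (simp add: a_def summable_cmult_iff)
qed

section \<open>Averages over cubes\<close>

lemma continuous_Phi_norm: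
  assumes "continuous_on S h" shows "continuous_on S (\<lambda>x. \<Phi> (norm (h x)))"
  by (rule continuous_on_compose2[OF continuous_on_Phi]) (auto intro: assms continuous_intros)

text \<open>The modular, always over the whole space. A Bochner integral that does not exist is 0,
  so smallness of \<open>rho h\<close> is informative only together with integrability, recorded
  below as \<open>Lphi h\<close>.\<close>

definition rho :: "('a::euclidean_space \<Rightarrow> 'b::euclidean_space) \<Rightarrow> real" where
  "rho h = (\<integral>x. \<Phi> (norm (h x)) \<partial>lebesgue)"

lemma test_Phi_grad:
  assumes "\<psi> \<in> test_functions \<Omega>"
  shows "integrable lborel (\<lambda>x. \<Phi> (norm (grad \<psi> x)))" "rho (grad \<psi>) = (\<integral>x. \<Phi> (norm (grad \<psi> x)) \<partial>lborel)"
proof -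
  obtain K where K: "compact K" "\<And>x. x \<notin> K \<Longrightarrow> grad \<psi> x = 0" using assms by (metis test_functionsE)
  have c: "continuous_on UNIV (\<lambda>x. \<Phi> (norm (grad \<psi> x)))"
    by (intro continuous_Phi_norm test_continuous_grad[OF assms])
  show "integrable lborel (\<lambda>x. \<Phi> (norm (grad \<psi> x)))"
    by (rule compact_support_integrable[OF c K(1)]) (simp add: K)
  show "rho (grad \<psi>) = (\<integral>x. \<Phi> (norm (grad \<psi> x)) \<partial>lborel)"
    unfolding rho_def by (rule integral_completion) (use c in \<open>auto intro: borel_measurable_continuous_onI\<close>)
qed

abbreviation "Q \<equiv> cbox (-1) (1 :: real^'n)"

lemma measure_Q: "measure lborel (Q :: (real^'n) set) = 2 ^ CARD('n)"
  by (subst content_cbox_cart) (auto simp: interval_eq_empty_cart)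

lemma norm_Q: "h \<in> Q \<Longrightarrow> norm h \<le> real CARD('n)" for h :: "real^'n"
  using norm_le_l1_cart[of h] sum_mono[of UNIV "\<lambda>i. \<bar>h $ i\<bar>" "\<lambda>_. 1"]
  by (force simp: mem_box_cart abs_le_iff)

text \<open>A substitute for Jensen's inequality: \<open>le_Phi\<close> with threshold
  \<open>PhiInv A\<close>. The measure of \<open>Q\<close> contributes \<open>2 ^ CARD('n)\<close>,
  the modular term 1. Any \<open>A\<close> above \<open>1 / r ^ CARD('n)\<close> is allowed, so that
  one bound covers a range of radii.\<close>

lemma cube_grad_bound:
  fixes \<psi> :: "real^'n \<Rightarrow> real"
  assumes \<psi>: "\<psi> \<in> test_functions \<Omega>" and 1: "rho (grad \<psi>) \<le> 1" and r: "r > 0" and A: "1 / r ^ CARD('n) \<le> A"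
  shows "integral Q (\<lambda>h. norm (grad \<psi> (z + r *\<^sub>R h))) \<le> (2 ^ CARD('n) + 1) * PhiInv A"
proof -
  define G where "G y = \<Phi> (norm (grad \<psi> y))" for y
  have A0: "A > 0" using r A by (smt (verit) divide_pos_pos zero_less_power)
  define s where "s = PhiInv A"
  have s: "s > 0" "\<Phi> s = A" using A0 PhiInv_pos Phi_PhiInv by (auto simp: s_def)
  have cg: "continuous_on UNIV (grad \<psi>)" by (rule test_continuous_grad[OF \<psi>])
  have cG: "continuous_on UNIV G" unfolding G_def by (intro continuous_Phi_norm cg)
  have c1: "continuous_on S (\<lambda>h. norm (grad \<psi> (z + r *\<^sub>R h)))" for S
    by (intro continuous_intros continuous_on_compose2[OF cg]) auto
  have c2: "continuous_on S (\<lambda>h. G (z + r *\<^sub>R h))" for S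
    by (intro continuous_intros continuous_on_compose2[OF cG]) auto
  have Gi: "integrable lborel G" "(\<integral>x. G x \<partial>lborel) \<le> 1"
    using test_Phi_grad[OF \<psi>] 1 by (auto simp: G_def[abs_def])
  have Gz: "integrable lborel (\<lambda>h. G (z + r *\<^sub>R h))" by (rule integral_affine[OF Gi(1)]) (use r in auto)
  have G0: "0 \<le> G y" for y by (simp add: G_def Phi_nonneg)
  have "integral Q (\<lambda>h. G (z + r *\<^sub>R h)) \<le> integral UNIV (\<lambda>h. G (z + r *\<^sub>R h))"
    by (intro integral_subset_le integrable_continuous c2 integrable_on_lborel[OF Gz]) (auto simp: G0)
  also have "\<dots> = (\<integral>h. G (z + r *\<^sub>R h) \<partial>lborel)" by (rule integral_lborel[OF Gz])
  also have "\<dots> = (\<integral>x. G x \<partial>lborel) / r ^ CARD('n)"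
    using integral_affine(2)[OF Gi(1), of r z] r by simp
  also have "\<dots> \<le> 1 / r ^ CARD('n)" using Gi r by (intro divide_right_mono) auto
  finally have GQ: "integral Q (\<lambda>h. G (z + r *\<^sub>R h)) \<le> A" using A by linarith
  have "integral Q (\<lambda>h. norm (grad \<psi> (z + r *\<^sub>R h))) \<le> integral Q (\<lambda>h. s + (s / A) * G (z + r *\<^sub>R h))"
  proof (intro integral_le integrable_continuous c1 continuous_on_add continuous_on_mult continuous_on_const c2)
    show "norm (grad \<psi> (z + r *\<^sub>R h)) \<le> s + (s / A) * G (z + r *\<^sub>R h)" for h
      using le_Phi[OF s(1), of "norm (grad \<psi> (z + r *\<^sub>R h))"] s(2) by (simp add: G_def)
  qed
  also have "\<dots> = s * 2 ^ CARD('n) + (s / A) * integral Q (\<lambda>h. G (z + r *\<^sub>R h))"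
    by (subst integral_add)
      (use A0 in \<open>auto intro!: integrable_continuous continuous_intros c2 simp: measure_Q\<close>)
  also have "\<dots> \<le> s * 2 ^ CARD('n) + (s / A) * A"
    using GQ s A0 by (intro add_left_mono mult_left_mono) auto
  finally show ?thesis using A0 by (simp add: s_def algebra_simps)
qed

text \<open>The mean value theorem in the parameter that moves centre and radius together. The
  radius never falls below \<open>c\<close>, so \<open>cube_grad_bound\<close> applies with the same
  \<open>A\<close> throughout; on \<open>Q\<close> the velocity \<open>w + d *\<^sub>R h\<close> has
  norm at most \<open>norm w + real CARD('n) * d\<close>.\<close>

lemma cube_average_lipschitz:
  fixes \<psi> :: "real^'n \<Rightarrow> real"
  assumes \<psi>: "\<psi> \<in> test_functions \<Omega>" and 1: "rho (grad \<psi>) \<le> 1" and c: "c > 0" and d: "d \<ge> 0"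
    and A: "1 / c ^ CARD('n) \<le> A"
  shows "\<bar>integral Q (\<lambda>h. \<psi> ((z + w) + (c + d) *\<^sub>R h)) - integral Q (\<lambda>h. \<psi> (z + c *\<^sub>R h))\<bar>
     \<le> (norm w + real CARD('n) * d) * ((2 ^ CARD('n) + 1) * PhiInv A)"
proof -
  define P where "P t = integral Q (\<lambda>h. \<psi> ((z + t *\<^sub>R w) + (c + t * d) *\<^sub>R h))" for t
  define P' where "P' t = integral Q (\<lambda>h. grad \<psi> ((z + t *\<^sub>R w) + (c + t * d) *\<^sub>R h) \<bullet> (w + d *\<^sub>R h))" for t
  have D: "(P has_real_derivative P' t) (at t)" for t
    unfolding P_def P'_def by (rule cube_average_deriv[OF test_Ck[OF \<psi>]])
  obtain t where t: "0 < t" "t < 1" "P 1 - P 0 = P' t"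
    using MVT2[of 0 1 P P'] D by auto
  define y where "y h = (z + t *\<^sub>R w) + (c + t * d) *\<^sub>R h" for h
  have cg: "continuous_on S (\<lambda>h. grad \<psi> (y h))" for S
    unfolding y_def by (intro continuous_on_compose2[OF test_continuous_grad[OF \<psi>, of UNIV]] continuous_intros) auto
  have r: "c + t * d > 0" "c \<le> c + t * d" using c d t by (auto simp: add_pos_nonneg)
  have "1 / (c + t * d) ^ CARD('n) \<le> 1 / c ^ CARD('n)"
    using r c by (intro divide_left_mono power_mono) auto
  then have A': "1 / (c + t * d) ^ CARD('n) \<le> A" using A by linarith
  have "norm (P' t) \<le> integral Q (\<lambda>h. (norm w + real CARD('n) * d) * norm (grad \<psi> (y h)))"
    unfolding P'_def y_def[symmetric]
  proof (intro integral_norm_bound_integral integrable_continuous continuous_intros cg)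
    fix h :: "real^'n" assume h: "h \<in> Q"
    have "norm (w + d *\<^sub>R h) \<le> norm w + d * norm h"
      using norm_triangle_ineq[of w "d *\<^sub>R h"] d by simp
    also have "\<dots> \<le> norm w + real CARD('n) * d"
      using mult_left_mono[OF norm_Q[OF h] d] by (simp add: mult.commute)
    finally have "norm (w + d *\<^sub>R h) * norm (grad \<psi> (y h)) \<le> (norm w + real CARD('n) * d) * norm (grad \<psi> (y h))"
      by (rule mult_right_mono) simp
    then show "norm (grad \<psi> (y h) \<bullet> (w + d *\<^sub>R h)) \<le> (norm w + real CARD('n) * d) * norm (grad \<psi> (y h))"
      using Cauchy_Schwarz_ineq2[of "grad \<psi> (y h)" "w + d *\<^sub>R h"] by (simp add: mult.commute)
  qed
  also have "\<dots> = (norm w + real CARD('n) * d) * integral Q (\<lambda>h. norm (grad \<psi> (y h)))"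
    by simp
  also have "\<dots> \<le> (norm w + real CARD('n) * d) * ((2 ^ CARD('n) + 1) * PhiInv A)"
    unfolding y_def using d by (intro mult_left_mono cube_grad_bound[OF \<psi> 1 r(1) A']) auto
  finally have "\<bar>P 1 - P 0\<bar> \<le> (norm w + real CARD('n) * d) * ((2 ^ CARD('n) + 1) * PhiInv A)"
    by (simp add: t)
  then show ?thesis by (simp add: P_def)
qed

text \<open>Averages over dyadic cubes around a point telescope, with steps controlled by the
  summable sequence \<open>\<sigma>\<close>, and tend to the point value. Averages around
  \<open>x\<close> and \<open>y\<close> are compared at the scale bounding their distance, so a
  multiple of the tail \<open>\<tau>\<close> is a modulus.\<close>

lemma morrey_modulus:
  assumes I: "set_integrable lborel {1..} (\<lambda>t. PhiInv t / t powr (1 + 1 / real CARD('n)))"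
  obtains \<omega> :: "nat \<Rightarrow> real" where "\<omega> \<longlonglongrightarrow> 0" "\<And>J. 0 \<le> \<omega> J"
    "\<And>\<Omega> (\<psi> :: real^'n \<Rightarrow> real) J x y. \<psi> \<in> test_functions \<Omega> \<Longrightarrow> rho (grad \<psi>) \<le> 1 \<Longrightarrow> norm (x - y) \<le> (1/2) ^ J
       \<Longrightarrow> \<bar>\<psi> x - \<psi> y\<bar> \<le> \<omega> J"
proof -
  let ?n = "CARD('n)"
  define \<sigma> where "\<sigma> j = (1/2::real) ^ j * PhiInv (2 ^ (?n * j))" for j
  define \<tau> where "\<tau> J = (\<Sum>j. \<sigma> (j + J))" for J
  \<comment> \<open>One constant for both uses of \<open>cube_average_lipschitz\<close>: the
    dilation carries the factor \<open>real ?n\<close>, the translation does not.\<close>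
  define C where "C = real ?n * (2 ^ ?n + 1)"
  have s: "summable \<sigma>" unfolding \<sigma>_def by (rule dyadic_summable[OF I]) simp
  have sJ: "summable (\<lambda>j. \<sigma> (j + J))" for J using s by (simp add: summable_iff_shift)
  have \<sigma>0: "0 \<le> \<sigma> j" for j by (simp add: \<sigma>_def PhiInv_nonneg)
  have \<tau>0: "0 \<le> \<tau> J" for J unfolding \<tau>_def by (intro suminf_nonneg sJ \<sigma>0)
  have C: "C \<ge> 2 ^ ?n + 1"
    using mult_right_mono[of 1 "real ?n" "2 ^ ?n + 1"] by (simp add: C_def Suc_le_eq)
  then have C0: "C \<ge> 0" by (smt (verit) zero_le_power)
  have pow: "1 / ((1/2::real) ^ j) ^ ?n = 2 ^ (?n * j)" for j
    by (simp add: power_mult power_divide mult.commute[of _ j])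
  define av where "av \<psi> z r = integral Q (\<lambda>h. \<psi> (z + r *\<^sub>R h))" for \<psi> :: "real^'n \<Rightarrow> real" and z r
  have main: "\<bar>\<psi> x - \<psi> y\<bar> \<le> 2 * C * \<tau> J"
    if \<psi>: "\<psi> \<in> test_functions \<Omega>" "rho (grad \<psi>) \<le> 1" and xy: "norm (x - y) \<le> (1/2) ^ J"
    for \<Omega> and \<psi> :: "real^'n \<Rightarrow> real" and J x y
  proof -
    \<comment> \<open>From radius \<open>(1/2) ^ Suc j\<close>, enlarging by
      \<open>d = (1/2) ^ Suc j\<close> leads back to \<open>(1/2) ^ j\<close>; the centre stays
      fixed.\<close>
    have step: "\<bar>av \<psi> z ((1/2) ^ j) - av \<psi> z ((1/2) ^ Suc j)\<bar> \<le> C * \<sigma> (Suc j)" for z j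
      using cube_average_lipschitz[OF \<psi>, of "(1/2) ^ Suc j" "(1/2) ^ Suc j" "2 ^ (?n * Suc j)" z 0] pow[of "Suc j"]
      by (simp add: av_def C_def \<sigma>_def mult.assoc mult.commute mult.left_commute)
    have tel: "\<bar>av \<psi> z ((1/2) ^ J) - av \<psi> z ((1/2) ^ (m + J))\<bar> \<le> C * (\<Sum>j<m. \<sigma> (j + Suc J))" for z m
    proof (induction m)
      case (Suc m)
      then show ?case using step[of z "m + J"] by (simp add: algebra_simps)
    qed simp
    have tel': "\<bar>av \<psi> z ((1/2) ^ J) - av \<psi> z ((1/2) ^ (m + J))\<bar> \<le> C * \<tau> (Suc J)" for z m
    proof -
      have "(\<Sum>j<m. \<sigma> (j + Suc J)) \<le> \<tau> (Suc J)"
        unfolding \<tau>_def by (intro sum_le_suminf sJ) (auto simp: \<sigma>0)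
      then show ?thesis using tel[of z m] mult_left_mono[OF _ C0] by (meson order_trans)
    qed
    have lim: "\<bar>av \<psi> z ((1/2) ^ J) - 2 ^ ?n * \<psi> z\<bar> \<le> C * \<tau> (Suc J)" for z
    proof (rule LIMSEQ_le_const2)
      \<comment> \<open>With fixed centre and radius \<open>t\<close>, the derivative formula at
        radius 0 gives continuity there. The averages are not normalised, so the limit is
        \<open>2 ^ ?n * \<psi> z\<close>.\<close>
      have "isCont (\<lambda>t. av \<psi> z t) 0"
        using DERIV_isCont[OF cube_average_deriv[OF test_Ck[OF \<psi>(1)], of "-1" 1 z 0 0 1 0]]
        by (simp add: av_def)
      moreover have "av \<psi> z 0 = 2 ^ ?n * \<psi> z" by (simp add: av_def measure_Q)
      moreover have "(\<lambda>m. (1/2::real) ^ (m + J)) \<longlonglongrightarrow> 0"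
        by (rule LIMSEQ_ignore_initial_segment) (simp add: LIMSEQ_power_zero)
      ultimately have "(\<lambda>m. av \<psi> z ((1/2) ^ (m + J))) \<longlonglongrightarrow> 2 ^ ?n * \<psi> z"
        using isCont_tendsto_compose by metis
      then show "(\<lambda>m. \<bar>av \<psi> z ((1/2) ^ J) - av \<psi> z ((1/2) ^ (m + J))\<bar>) \<longlonglongrightarrow> \<bar>av \<psi> z ((1/2) ^ J) - 2 ^ ?n * \<psi> z\<bar>"
        by (intro tendsto_intros)
    qed (use tel' in auto)
    have "\<bar>av \<psi> x ((1/2) ^ J) - av \<psi> y ((1/2) ^ J)\<bar> \<le> norm (x - y) * ((2 ^ ?n + 1) * PhiInv (2 ^ (?n * J)))"
      using cube_average_lipschitz[OF \<psi>, of "(1/2) ^ J" 0 "2 ^ (?n * J)" y "x - y"] pow[of J]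
      by (simp add: av_def)
    also have "\<dots> \<le> (1/2) ^ J * (C * PhiInv (2 ^ (?n * J)))"
      using C xy by (intro mult_mono mult_right_mono) (auto simp: PhiInv_nonneg)
    also have "\<dots> = C * \<sigma> J" by (simp add: \<sigma>_def)
    finally have xyav: "\<bar>av \<psi> x ((1/2) ^ J) - av \<psi> y ((1/2) ^ J)\<bar> \<le> C * \<sigma> J" .
    have "2 ^ ?n * \<bar>\<psi> x - \<psi> y\<bar> = \<bar>2 ^ ?n * \<psi> x - 2 ^ ?n * \<psi> y\<bar>"
      by (simp add: abs_mult flip: right_diff_distrib)
    also have "\<dots> \<le> 2 * C * \<tau> (Suc J) + C * \<sigma> J"
      using lim[of x] lim[of y] xyav by linarith
    also have "\<dots> \<le> 2 * C * \<tau> J"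
    proof -
      have "\<tau> J = \<tau> (Suc J) + \<sigma> J"
        unfolding \<tau>_def using suminf_split_head[OF sJ[of J]] by simp
      then show ?thesis using C0 \<sigma>0[of J] by (simp add: algebra_simps)
    qed
    finally have "2 ^ ?n * \<bar>\<psi> x - \<psi> y\<bar> \<le> 2 * C * \<tau> J" .
    moreover have "1 * \<bar>\<psi> x - \<psi> y\<bar> \<le> 2 ^ ?n * \<bar>\<psi> x - \<psi> y\<bar>" by (intro mult_right_mono) auto
    ultimately show ?thesis by (metis mult_1 order_trans)
  qed
  have "\<tau> \<longlonglongrightarrow> 0"
    unfolding \<tau>_def using suminf_exist_split[OF _ s] by (auto simp: LIMSEQ_iff)
  then have "(\<lambda>J. 2 * C * \<tau> J) \<longlonglongrightarrow> 0" by (rule tendsto_mult_right_zero)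
  then show ?thesis using main \<tau>0 C0 by (intro that[of "\<lambda>J. 2 * C * \<tau> J"]) auto
qed

text \<open>Quadratic scaling: dividing by \<open>sqrt M\<close> divides the modular by at least
  \<open>M\<close>. Hence oscillations grow only like the square root of the modular.\<close>

lemma rho_grad_scale:
  assumes \<psi>: "\<psi> \<in> test_functions \<Omega>" and M: "M \<ge> 1" "rho (grad \<psi>) \<le> M"
  shows "rho (grad (\<lambda>x. (1 / sqrt M) * \<psi> x)) \<le> 1"
proof -
  have t: "(\<lambda>x. (1 / sqrt M) * \<psi> x) \<in> test_functions \<Omega>" by (rule test_cmult[OF \<psi>])
  have "rho (grad (\<lambda>x. (1 / sqrt M) * \<psi> x)) \<le> (\<integral>x. (1 / M) * \<Phi> (norm (grad \<psi> x)) \<partial>lborel)"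
    unfolding test_Phi_grad(2)[OF t]
  proof (intro integral_mono test_Phi_grad[OF t] integrable_mult_right test_Phi_grad[OF \<psi>])
    fix x
    have "\<Phi> (1 / sqrt M * norm (grad \<psi> x)) \<le> (1 / sqrt M)\<^sup>2 * \<Phi> (norm (grad \<psi> x))"
      by (rule Phi_scale_square) (use M in auto)
    then show "\<Phi> (norm (grad (\<lambda>x. (1 / sqrt M) * \<psi> x) x)) \<le> (1 / M) * \<Phi> (norm (grad \<psi> x))"
      using M grad_cmult[OF \<psi>, of "1 / sqrt M" x] by (simp add: power_divide)
  qed
  also have "\<dots> = (1 / M) * rho (grad \<psi>)" by (simp add: test_Phi_grad(2)[OF \<psi>])
  also have "\<dots> \<le> 1" using M by simp
  finally show ?thesis .
qed

lemma morrey_modulus_scaled: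
  assumes I: "set_integrable lborel {1..} (\<lambda>t. PhiInv t / t powr (1 + 1 / real CARD('n)))"
  obtains \<omega> :: "nat \<Rightarrow> real" where "\<omega> \<longlonglongrightarrow> 0" "\<And>J. 0 \<le> \<omega> J"
    "\<And>\<Omega> (\<psi> :: real^'n \<Rightarrow> real) J x y M. \<psi> \<in> test_functions \<Omega> \<Longrightarrow> M \<ge> 1 \<Longrightarrow> rho (grad \<psi>) \<le> M \<Longrightarrow>
       norm (x - y) \<le> (1/2) ^ J \<Longrightarrow> \<bar>\<psi> x - \<psi> y\<bar> \<le> sqrt M * \<omega> J"
proof -
  obtain \<omega> :: "nat \<Rightarrow> real" where \<omega>: "\<omega> \<longlonglongrightarrow> 0" "\<And>J. 0 \<le> \<omega> J"
    "\<And>\<Omega> (\<psi> :: real^'n \<Rightarrow> real) J x y. \<psi> \<in> test_functions \<Omega> \<Longrightarrow> rho (grad \<psi>) \<le> 1 \<Longrightarrow> norm (x - y) \<le> (1/2) ^ J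
       \<Longrightarrow> \<bar>\<psi> x - \<psi> y\<bar> \<le> \<omega> J"
    using morrey_modulus[OF I] by blast
  show thesis
  proof (rule that[OF \<omega>(1,2)])
    fix \<Omega> and \<psi> :: "real^'n \<Rightarrow> real" and J and x y :: "real^'n" and M :: real
    assume \<psi>: "\<psi> \<in> test_functions \<Omega>" and M: "M \<ge> 1" "rho (grad \<psi>) \<le> M" and xy: "norm (x - y) \<le> (1/2) ^ J"
    have "\<bar>(1 / sqrt M) * \<psi> x - (1 / sqrt M) * \<psi> y\<bar> \<le> \<omega> J"
      by (rule \<omega>(3)[OF test_cmult[OF \<psi>] rho_grad_scale[OF \<psi> M] xy])
    moreover have "(1 / sqrt M) * \<psi> x - (1 / sqrt M) * \<psi> y = (\<psi> x - \<psi> y) / sqrt M" by (simp add: diff_divide_distrib)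
    ultimately show "\<bar>\<psi> x - \<psi> y\<bar> \<le> sqrt M * \<omega> J" using M by (simp add: abs_divide field_simps)
  qed
qed

text \<open>A walk in unit steps leaves the bounded set \<open>D\<close>, outside which the function
  vanishes; each step costs at most \<open>sqrt M * \<omega> 0\<close>.\<close>

lemma sup_bound:
  fixes D :: "(real^'n) set"
  assumes I: "set_integrable lborel {1..} (\<lambda>t. PhiInv t / t powr (1 + 1 / real CARD('n)))" and D: "bounded D"
  obtains C where "C > 0"
    "\<And>\<psi> x M. \<psi> \<in> test_functions D \<Longrightarrow> M \<ge> 1 \<Longrightarrow> rho (grad \<psi>) \<le> M \<Longrightarrow> \<bar>\<psi> x\<bar> \<le> C * sqrt M"
proof -
  obtain \<omega> :: "nat \<Rightarrow> real" where \<omega>: "\<omega> \<longlonglongrightarrow> 0" "\<And>J. 0 \<le> \<omega> J"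
    "\<And>\<Omega> (\<psi> :: real^'n \<Rightarrow> real) J x y M. \<psi> \<in> test_functions \<Omega> \<Longrightarrow> M \<ge> 1 \<Longrightarrow> rho (grad \<psi>) \<le> M \<Longrightarrow>
       norm (x - y) \<le> (1/2) ^ J \<Longrightarrow> \<bar>\<psi> x - \<psi> y\<bar> \<le> sqrt M * \<omega> J"
    using morrey_modulus_scaled[OF I] by blast
  obtain R where R: "D \<subseteq> ball 0 R" using bounded_subset_ballD[OF D] by metis
  \<comment> \<open>From \<open>norm x < R\<close>, after \<open>N \<ge> 2 * R\<close> unit steps in
    a fixed direction the norm exceeds \<open>R\<close>. Any coordinate direction serves.\<close>
  obtain N :: nat where N: "real N \<ge> 2 * R" using real_arch_simple by blast
  define e where "e = (axis undefined 1 :: real^'n)"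
  have e: "norm e = 1" by (simp add: e_def)
  have bound: "\<bar>\<psi> x\<bar> \<le> (real N * \<omega> 0 + 1) * sqrt M"
    if \<psi>: "\<psi> \<in> test_functions D" and M: "M \<ge> 1" "rho (grad \<psi>) \<le> M" for \<psi> and x :: "real^'n" and M
  proof (cases "x \<in> D")
    case True
    have step: "\<bar>\<psi> (x + real k *\<^sub>R e) - \<psi> (x + real (Suc k) *\<^sub>R e)\<bar> \<le> sqrt M * \<omega> 0" for k
      by (rule \<omega>(3)[OF \<psi> M]) (simp add: algebra_simps e)
    have chain: "\<bar>\<psi> x - \<psi> (x + real k *\<^sub>R e)\<bar> \<le> real k * (sqrt M * \<omega> 0)" for k
    proof (induction k)
      case (Suc k) then show ?case using step[of k] by (simp add: algebra_simps)
    qed simp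
    have "norm x < R" using True R by auto
    moreover have "norm (x + real N *\<^sub>R e) \<ge> real N - norm x"
      using norm_diff_ineq[of "real N *\<^sub>R e" x] by (simp add: e add.commute)
    ultimately have "x + real N *\<^sub>R e \<notin> D" using R N by auto
    then have "\<psi> (x + real N *\<^sub>R e) = 0" using \<psi> by (metis test_functionsE subsetD)
    then have "\<bar>\<psi> x\<bar> \<le> real N * \<omega> 0 * sqrt M" using chain[of N] by (simp add: ac_simps)
    also have "\<dots> \<le> (real N * \<omega> 0 + 1) * sqrt M" using M by (intro mult_right_mono) auto
    finally show ?thesis .
  next
    case False
    then have "\<psi> x = 0" using \<psi> by (metis test_functionsE subsetD)
    then show ?thesis using \<omega>(2)[of 0] M by simp
  qed
  show thesis by (rule that[of "real N * \<omega> 0 + 1"]) (use bound \<omega>(2)[of 0] in \<open>auto simp: add_nonneg_pos\<close>)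
qed

end

section \<open>Weak gradients\<close>

lemma test_measurable:
  assumes "\<psi> \<in> test_functions \<Omega>"
  shows "\<psi> \<in> borel_measurable lebesgue" "partial_deriv i \<psi> \<in> borel_measurable lebesgue"
    "grad \<psi> \<in> borel_measurable lebesgue"
  using borel_measurable_continuous_onI[OF test_continuous[OF assms]]
    borel_measurable_continuous_onI[OF test_continuous_partial[OF assms]]
    borel_measurable_continuous_onI[OF test_continuous_grad[OF assms]]
  by (auto intro!: measurable_completion)

lemma locally_integrable_mult:
  fixes g :: "'a::euclidean_space \<Rightarrow> real"
  assumes g: "locally_integrable E g" and E: "open E"
    and q: "continuous_on UNIV q" "compact K" "K \<subseteq> E" "\<And>x. x \<notin> K \<Longrightarrow> q x = 0"
  shows "integrable (lebesgue_on E) (\<lambda>x. g x * q x)"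
proof -
  have gi: "integrable lebesgue (\<lambda>x. indicator K x *\<^sub>R g x)"
    using g q unfolding locally_integrable_def set_integrable_def by auto
  obtain B where B: "\<And>x. x \<in> K \<Longrightarrow> norm (q x) \<le> B"
    using compact_imp_bounded[OF compact_continuous_image[OF continuous_on_subset[OF q(1)] q(2)]]
    by (auto simp: bounded_iff)
  have qm: "q \<in> borel_measurable lebesgue"
    using borel_measurable_continuous_onI[OF q(1)] by (auto intro!: measurable_completion)
  have "integrable lebesgue (\<lambda>x. (indicator K x *\<^sub>R g x) * q x)"
  proof (rule Bochner_Integration.integrable_bound)
    show "integrable lebesgue (\<lambda>x. B * (indicator K x *\<^sub>R g x))" using gi by (rule integrable_mult_right)
    show "(\<lambda>x. (indicator K x *\<^sub>R g x) * q x) \<in> borel_measurable lebesgue"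
      using gi qm by (intro borel_measurable_times) auto
    show "AE x in lebesgue. norm ((indicator K x *\<^sub>R g x) * q x) \<le> norm (B * (indicator K x *\<^sub>R g x))"
    proof (intro AE_I2)
      fix x
      have "\<bar>g x\<bar> * \<bar>q x\<bar> \<le> \<bar>g x\<bar> * \<bar>B\<bar>" if "x \<in> K" using B[OF that] by (intro mult_left_mono) auto
      then show "norm ((indicator K x *\<^sub>R g x) * q x) \<le> norm (B * (indicator K x *\<^sub>R g x))"
        by (auto simp: indicator_def abs_mult mult.commute)
    qed
  qed
  moreover have "(\<lambda>x. (indicator K x *\<^sub>R g x) * q x) = (\<lambda>x. indicator E x *\<^sub>R (g x * q x))"
    using q(3,4) by (auto simp: indicator_def fun_eq_iff)
  ultimately show ?thesis using E by (subst integrable_restrict_space) auto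
qed

lemma test_integrable_on:
  fixes g :: "real^'n \<Rightarrow> real"
  assumes "locally_integrable E g" "open E" "\<psi> \<in> test_functions E"
  shows "integrable (lebesgue_on E) (\<lambda>x. g x * \<psi> x)" "integrable (lebesgue_on E) (\<lambda>x. g x * partial_deriv i \<psi> x)"
proof -
  obtain K where K: "compact K" "K \<subseteq> E" "\<And>x. x \<notin> K \<Longrightarrow> \<psi> x = 0" "\<And>x. x \<notin> K \<Longrightarrow> grad \<psi> x = 0"
    using assms(3) by (metis test_functionsE)
  show "integrable (lebesgue_on E) (\<lambda>x. g x * \<psi> x)"
    by (rule locally_integrable_mult[OF assms(1,2) test_continuous[OF assms(3)] K(1,2)]) (use K in auto)
  have "partial_deriv i \<psi> x = 0" if "x \<notin> K" for x using K(4)[OF that] by (metis grad_nth zero_index)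
  then show "integrable (lebesgue_on E) (\<lambda>x. g x * partial_deriv i \<psi> x)"
    by (rule locally_integrable_mult[OF assms(1,2) test_continuous_partial[OF assms(3)] K(1,2)])
qed

lemma locally_integrable_component:
  fixes g :: "real^'n \<Rightarrow> real^'n"
  assumes "locally_integrable E g" shows "locally_integrable E (\<lambda>x. g x $ i)"
proof -
  have "integrable lebesgue (\<lambda>x. (indicator K x *\<^sub>R g x) $ i)" if "compact K" "K \<subseteq> E" for K
    using assms that integrable_bounded_linear[OF bounded_linear_vec_nth]
    unfolding locally_integrable_def set_integrable_def by blast
  then show ?thesis unfolding locally_integrable_def set_integrable_def by simp
qed

lemma locally_integrable_diff:
  "locally_integrable E g \<Longrightarrow> locally_integrable E h \<Longrightarrow> locally_integrable E (\<lambda>x. g x - h x)"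
  unfolding locally_integrable_def by (auto intro: set_integral_diff)

lemma has_weak_gradient_diff:
  assumes "open E" "has_weak_gradient E u g" "has_weak_gradient E v k"
  shows "has_weak_gradient E (\<lambda>x. u x - v x) (\<lambda>x. g x - k x)"
  unfolding has_weak_gradient_def
proof (intro conjI ballI allI)
  fix \<psi> i assume \<psi>: "\<psi> \<in> test_functions E"
  have li: "locally_integrable E u" "locally_integrable E v" "locally_integrable E (\<lambda>x. g x $ i)" "locally_integrable E (\<lambda>x. k x $ i)"
    using assms locally_integrable_component unfolding has_weak_gradient_def by blast+
  show "(\<integral>x. (u x - v x) * partial_deriv i \<psi> x \<partial>lebesgue_on E) = - (\<integral>x. (g x - k x) $ i * \<psi> x \<partial>lebesgue_on E)"
    using assms \<psi> unfolding has_weak_gradient_def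
    by (simp add: left_diff_distrib test_integrable_on[OF li(1) assms(1) \<psi>] test_integrable_on[OF li(2) assms(1) \<psi>]
        test_integrable_on[OF li(3) assms(1) \<psi>] test_integrable_on[OF li(4) assms(1) \<psi>])
qed (use assms in \<open>auto simp: has_weak_gradient_def intro: locally_integrable_diff\<close>)

text \<open>The fundamental lemma, applied to each component of the difference.\<close>

lemma weak_gradient_unique:
  assumes E: "open E" and 1: "has_weak_gradient E u g" and 2: "has_weak_gradient E u k"
  shows "AE x in lebesgue. x \<in> E \<longrightarrow> g x = k x"
proof -
  have "locally_integrable E g" "locally_integrable E k" using 1 2 by (auto simp: has_weak_gradient_def)
  then have li: "locally_integrable E (\<lambda>x. g x $ i)" "locally_integrable E (\<lambda>x. k x $ i)" for i
    by (auto intro: locally_integrable_component)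
  have "AE x in lebesgue. x \<in> E \<longrightarrow> g x $ i - k x $ i = 0" for i
  proof (rule fundamental_lemma[OF E])
    show "locally_integrable E (\<lambda>x. g x $ i - k x $ i)"
      by (rule locally_integrable_diff[OF li(1)[of i] li(2)[of i]])
  next
    fix \<psi> assume \<psi>: "\<psi> \<in> test_functions E"
    have "(\<integral>x. g x $ i * \<psi> x \<partial>lebesgue_on E) = (\<integral>x. k x $ i * \<psi> x \<partial>lebesgue_on E)"
      using 1 2 \<psi> unfolding has_weak_gradient_def by (metis (no_types, lifting) neg_equal_iff_equal)
    then show "(\<integral>x. (g x $ i - k x $ i) * \<psi> x \<partial>lebesgue_on E) = 0"
      by (simp add: left_diff_distrib test_integrable_on(1)[OF li(1)[of i] E \<psi>] test_integrable_on(1)[OF li(2)[of i] E \<psi>])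
  qed
  then have "AE x in lebesgue. \<forall>i\<in>UNIV. x \<in> E \<longrightarrow> g x $ i - k x $ i = 0"
    by (subst AE_finite_all) auto
  then show ?thesis by eventually_elim (auto simp: vec_eq_iff)
qed

text \<open>The single place where the choice operator in \<open>weak_gradient\<close> is opened;
  afterwards any explicit weak gradient may be substituted almost everywhere.\<close>

lemma weak_gradient_AE:
  assumes "open E" "has_weak_gradient E u g"
  shows "has_weak_gradient E u (weak_gradient E u)" "AE x in lebesgue. x \<in> E \<longrightarrow> weak_gradient E u x = g x"
proof -
  show *: "has_weak_gradient E u (weak_gradient E u)"
    unfolding weak_gradient_def by (rule someI[of "has_weak_gradient E u"]) (rule assms)
  show "AE x in lebesgue. x \<in> E \<longrightarrow> weak_gradient E u x = g x" by (rule weak_gradient_unique[OF assms(1) * assms(2)])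
qed

section \<open>Modulars and the Orlicz-Sobolev space\<close>

context convex_young
begin

definition Lphi :: "('a::euclidean_space \<Rightarrow> 'b::euclidean_space) \<Rightarrow> bool" where
  "Lphi h \<longleftrightarrow> h \<in> borel_measurable lebesgue \<and> integrable lebesgue (\<lambda>x. \<Phi> (norm (h x)))"

lemma measurable_Phi:
  assumes "h \<in> borel_measurable M" shows "(\<lambda>x. \<Phi> (norm (h x))) \<in> borel_measurable M"
proof -
  have "continuous_on UNIV (\<lambda>t::real. \<Phi> (norm t))" by (intro continuous_Phi_norm continuous_intros)
  then have "(\<lambda>t::real. \<Phi> (norm t)) \<in> borel_measurable borel" by (rule borel_measurable_continuous_onI)
  moreover have "(\<lambda>x. norm (h x)) \<in> borel_measurable M" using assms by simp
  ultimately show ?thesis using measurable_compose[of "\<lambda>x. norm (h x)" M borel "\<lambda>t. \<Phi> (norm t)"] by simp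
qed

lemma Lphi_bound:
  assumes "h \<in> borel_measurable lebesgue" "integrable lebesgue g" "\<And>x. \<Phi> (norm (h x)) \<le> g x"
  shows "Lphi h" "rho h \<le> integral\<^sup>L lebesgue g"
proof -
  have "integrable lebesgue (\<lambda>x. \<Phi> (norm (h x)))"
    by (rule Bochner_Integration.integrable_bound[OF assms(2) measurable_Phi[OF assms(1)]])
      (use assms(3) Phi_nonneg in \<open>auto intro!: AE_I2 intro: order_trans[OF _ abs_ge_self]\<close>)
  then show "Lphi h" "rho h \<le> integral\<^sup>L lebesgue g"
    using assms by (auto simp: Lphi_def rho_def intro: integral_mono)
qed

lemma rho_nonneg: "0 \<le> rho h"
  unfolding rho_def by (intro integral_nonneg_AE AE_I2 Phi_nonneg) simp

lemma Lphi_add: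
  assumes "Lphi h" "Lphi k"
  shows "Lphi (\<lambda>x. h x + k x)" "rho (\<lambda>x. h x + k x) \<le> Kd * (rho h + rho k)"
proof -
  let ?g = "\<lambda>x. Kd * (\<Phi> (norm (h x)) + \<Phi> (norm (k x)))"
  have g: "integrable lebesgue ?g" using assms by (auto simp: Lphi_def)
  have le: "\<Phi> (norm (h x + k x)) \<le> ?g x" for x
    using Phi_mono[OF norm_ge_zero norm_triangle_ineq[of "h x" "k x"]] Phi_add_le[of "norm (h x)" "norm (k x)"] by simp
  have m: "(\<lambda>x. h x + k x) \<in> borel_measurable lebesgue" using assms by (auto simp: Lphi_def)
  show "Lphi (\<lambda>x. h x + k x)" by (rule Lphi_bound[OF m g le])
  have "rho (\<lambda>x. h x + k x) \<le> integral\<^sup>L lebesgue ?g" by (rule Lphi_bound[OF m g le])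
  also have "\<dots> = Kd * (rho h + rho k)" using assms by (simp add: Lphi_def rho_def)
  finally show "rho (\<lambda>x. h x + k x) \<le> Kd * (rho h + rho k)" .
qed

lemma Lphi_minus: "Lphi h \<Longrightarrow> Lphi (\<lambda>x. - h x)" "rho (\<lambda>x. - h x) = rho h"
  by (auto simp: Lphi_def rho_def)

lemma Lphi_diff:
  assumes "Lphi h" "Lphi k"
  shows "Lphi (\<lambda>x. h x - k x)" "rho (\<lambda>x. h x - k x) \<le> Kd * (rho h + rho k)"
  using Lphi_add[OF assms(1) Lphi_minus(1)[OF assms(2)]] by (auto simp: Lphi_minus)

lemma rho_scale:
  assumes "c \<ge> 0"
  shows "\<exists>K>0. \<forall>h :: 'a::euclidean_space \<Rightarrow> 'b::euclidean_space. Lphi h \<longrightarrow> Lphi (\<lambda>x. c *\<^sub>R h x) \<and> rho (\<lambda>x. c *\<^sub>R h x) \<le> K * rho h"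
proof -
  obtain K where K: "K > 0" "\<And>t. t \<ge> 0 \<Longrightarrow> \<Phi> (c * t) \<le> K * \<Phi> t" using Phi_mult_bound[OF assms] by blast
  have "Lphi (\<lambda>x. c *\<^sub>R h x) \<and> rho (\<lambda>x. c *\<^sub>R h x) \<le> K * rho h" if h: "Lphi h" for h :: "'a \<Rightarrow> 'b"
  proof -
    have g: "integrable lebesgue (\<lambda>x. K * \<Phi> (norm (h x)))" using h by (auto simp: Lphi_def)
    have m: "(\<lambda>x. c *\<^sub>R h x) \<in> borel_measurable lebesgue" using h by (auto simp: Lphi_def)
    have le: "\<Phi> (norm (c *\<^sub>R h x)) \<le> K * \<Phi> (norm (h x))" for x using K(2)[of "norm (h x)"] assms by simp
    show ?thesis using Lphi_bound[OF m g le] h by (simp add: Lphi_def rho_def)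
  qed
  then show ?thesis using K(1) by blast
qed

lemma Lphi_scaleR: "Lphi h \<Longrightarrow> Lphi (\<lambda>x. c *\<^sub>R h x)"
  using rho_scale[of "\<bar>c\<bar>"] Lphi_minus(1)[of "\<lambda>x. \<bar>c\<bar> *\<^sub>R h x"] by (cases "c \<ge> 0") force+

section \<open>The modular against the Luxemburg norm\<close>

lemma nn_integral_rho:
  assumes "Lphi h" shows "(\<integral>\<^sup>+x. ennreal (\<Phi> (norm (h x))) \<partial>lebesgue) = ennreal (rho h)"
  unfolding rho_def using assms by (intro nn_integral_eq_integral) (auto simp: Lphi_def Phi_nonneg)

lemma nn_integral_rho_le:
  assumes "Lphi h" "E \<in> sets lebesgue"
  shows "(\<integral>\<^sup>+x. ennreal (\<Phi> (norm (h x))) \<partial>lebesgue_on E) \<le> ennreal (rho h)"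
proof -
  have "(\<integral>\<^sup>+x. ennreal (\<Phi> (norm (h x))) \<partial>lebesgue_on E) = (\<integral>\<^sup>+x. ennreal (\<Phi> (norm (h x))) * indicator E x \<partial>lebesgue)"
    using assms by (subst nn_integral_restrict_space) auto
  also have "\<dots> \<le> (\<integral>\<^sup>+x. ennreal (\<Phi> (norm (h x))) \<partial>lebesgue)"
    by (intro nn_integral_mono) (auto simp: indicator_def)
  finally show ?thesis using nn_integral_rho[OF assms(1)] by simp
qed

text \<open>Passes from extended integrals over \<open>E\<close>, in which \<open>orlicz\<close> is
  stated, to the real modular of the extension by zero.\<close>

lemma Lphi_extension:
  assumes E: "E \<in> sets lebesgue" and h: "h \<in> borel_measurable (lebesgue_on E)"
    and fin: "(\<integral>\<^sup>+x. ennreal (\<Phi> (norm (h x))) \<partial>lebesgue_on E) < \<infinity>"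
  shows "Lphi (\<lambda>x. indicator E x *\<^sub>R h x)"
    "ennreal (rho (\<lambda>x. indicator E x *\<^sub>R h x)) = (\<integral>\<^sup>+x. ennreal (\<Phi> (norm (h x))) \<partial>lebesgue_on E)"
proof -
  let ?h = "\<lambda>x. indicator E x *\<^sub>R h x"
  have m: "?h \<in> borel_measurable lebesgue"
    using h E by (subst (asm) borel_measurable_restrict_space_iff) auto
  have eq: "(\<integral>\<^sup>+x. ennreal (\<Phi> (norm (h x))) \<partial>lebesgue_on E) = (\<integral>\<^sup>+x. ennreal (\<Phi> (norm (?h x))) \<partial>lebesgue)"
    using E by (subst nn_integral_restrict_space) (auto intro!: nn_integral_cong simp: indicator_def)
  have "integrable lebesgue (\<lambda>x. \<Phi> (norm (?h x)))"
    using fin measurable_Phi[OF m] unfolding eq by (intro integrableI_nonneg) (auto simp: Phi_nonneg)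
  then show L: "Lphi ?h" using m by (simp add: Lphi_def)
  show "ennreal (rho ?h) = (\<integral>\<^sup>+x. ennreal (\<Phi> (norm (h x))) \<partial>lebesgue_on E)"
    using nn_integral_rho[OF L] eq by simp
qed

text \<open>Doubling bounds the modular of \<open>h / \<epsilon>\<close> by
  \<open>K * rho h\<close>, and once this is at most 1 the number \<open>\<epsilon>\<close> itself
  is admissible in the infimum. The threshold depends neither on \<open>h\<close> nor on
  \<open>E\<close>.\<close>

lemma orlicz_norm_le:
  assumes "\<epsilon> > 0"
  shows "\<exists>\<delta>>0. \<forall>(h :: 'a::euclidean_space \<Rightarrow> 'b::euclidean_space) E. Lphi h \<and> E \<in> sets lebesgue \<and> rho h \<le> \<delta> \<longrightarrow> \<bar>orlicz_norm \<Phi> E (\<lambda>x. norm (h x))\<bar> \<le> \<epsilon>"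
proof -
  obtain K where K: "K > 0" "\<And>h :: 'a \<Rightarrow> 'b. Lphi h \<Longrightarrow> Lphi (\<lambda>x. (1 / \<epsilon>) *\<^sub>R h x) \<and> rho (\<lambda>x. (1 / \<epsilon>) *\<^sub>R h x) \<le> K * rho h"
    using rho_scale[of "1 / \<epsilon>"] assms by auto
  have "\<bar>orlicz_norm \<Phi> E (\<lambda>x. norm (h x))\<bar> \<le> \<epsilon>" if h: "Lphi h" "E \<in> sets lebesgue" "rho h \<le> 1 / K" for h :: "'a \<Rightarrow> 'b" and E
  proof -
    have "(\<integral>\<^sup>+x. ennreal (\<Phi> (\<bar>norm (h x)\<bar> / \<epsilon>)) \<partial>lebesgue_on E) = (\<integral>\<^sup>+x. ennreal (\<Phi> (norm ((1 / \<epsilon>) *\<^sub>R h x))) \<partial>lebesgue_on E)"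
      using assms by simp
    also have "\<dots> \<le> ennreal (rho (\<lambda>x. (1 / \<epsilon>) *\<^sub>R h x))"
      using K(2)[OF h(1)] h(2) by (intro nn_integral_rho_le) simp_all
    also have "\<dots> \<le> ennreal 1"
    proof (rule ennreal_leI)
      have "K * rho h \<le> K * (1 / K)" using h(3) K(1) by (intro mult_left_mono) auto
      then show "rho (\<lambda>x. (1 / \<epsilon>) *\<^sub>R h x) \<le> 1" using K(2)[OF h(1)] K(1) by simp
    qed
    finally have mem: "\<epsilon> \<in> {c. c > 0 \<and> (\<integral>\<^sup>+x. ennreal (\<Phi> (\<bar>norm (h x)\<bar> / c)) \<partial>lebesgue_on E) \<le> 1}"
      using assms by simp
    have "orlicz_norm \<Phi> E (\<lambda>x. norm (h x)) \<le> \<epsilon>"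
      unfolding orlicz_norm_def by (rule cInf_lower[OF mem]) (auto intro!: bdd_belowI[of _ 0])
    moreover have "0 \<le> orlicz_norm \<Phi> E (\<lambda>x. norm (h x))"
      unfolding orlicz_norm_def by (rule cInf_greatest) (use mem in blast, auto)
    ultimately show ?thesis by simp
  qed
  then show ?thesis using K(1) by (intro exI[of _ "1 / K"]) auto
qed

text \<open>The set whose infimum is the Luxemburg norm is nonempty, without which
  \<open>Inf\<close> would be an unspecified number. By convexity a finite modular \<open>r\<close>
  drops to at most 1 after division by \<open>max 1 r\<close>.\<close>

lemma orlicz_norm_attained:
  assumes E: "E \<in> sets lebesgue"
    and fin: "(\<integral>\<^sup>+x. ennreal (\<Phi> (norm (h x))) \<partial>lebesgue_on E) < \<infinity>"
    and h: "h \<in> borel_measurable (lebesgue_on E)"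
  shows "\<exists>c>0. (\<integral>\<^sup>+x. ennreal (\<Phi> (\<bar>norm (h x)\<bar> / c)) \<partial>lebesgue_on E) \<le> 1"
proof -
  let ?I = "\<lambda>c. \<integral>\<^sup>+x. ennreal (\<Phi> (\<bar>norm (h x)\<bar> / c)) \<partial>lebesgue_on E"
  obtain r where r: "?I 1 = ennreal r" "0 \<le> r" using fin by (cases "?I 1") auto
  define b where "b = max 1 r"
  have b: "b \<ge> 1" "r \<le> b" by (auto simp: b_def)
  have "?I b \<le> (\<integral>\<^sup>+x. ennreal (1 / b) * ennreal (\<Phi> (norm (h x))) \<partial>lebesgue_on E)"
  proof (rule nn_integral_mono)
    fix x
    have "\<Phi> ((1 / b) * norm (h x)) \<le> (1 / b) * \<Phi> (norm (h x))" by (rule Phi_scale_le) (use b in auto)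
    then show "ennreal (\<Phi> (\<bar>norm (h x)\<bar> / b)) \<le> ennreal (1 / b) * ennreal (\<Phi> (norm (h x)))"
      using b Phi_nonneg[of "norm (h x)"] by (simp flip: ennreal_mult)
  qed
  also have "\<dots> = ennreal (1 / b) * ?I 1"
    using measurable_Phi[OF h] by (simp add: nn_integral_cmult)
  also have "\<dots> = ennreal (r / b)" unfolding r(1) using b r by (simp flip: ennreal_mult)
  also have "\<dots> \<le> ennreal 1" using b by (intro ennreal_leI) (simp add: divide_le_eq)
  finally show ?thesis using b by (intro exI[of _ b]) simp
qed

text \<open>Some admissible \<open>c\<close> lies below \<open>\<epsilon>\<close>, and
  \<open>\<Phi> t \<le> c * \<Phi> (t / c)\<close> because \<open>c \<le> 1\<close>. Together with
  \<open>orlicz_norm_le\<close> this identifies convergence in norm with convergence in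
  modular.\<close>

lemma rho_le_of_orlicz_norm:
  assumes E: "E \<in> sets lebesgue" and h: "h \<in> borel_measurable (lebesgue_on E)"
    and fin: "(\<integral>\<^sup>+x. ennreal (\<Phi> (norm (h x))) \<partial>lebesgue_on E) < \<infinity>"
    and le: "orlicz_norm \<Phi> E (\<lambda>x. norm (h x)) < \<epsilon>" and \<epsilon>: "\<epsilon> \<le> 1"
  shows "rho (\<lambda>x. indicator E x *\<^sub>R h x) < \<epsilon>"
proof -
  let ?I = "\<lambda>c. \<integral>\<^sup>+x. ennreal (\<Phi> (\<bar>norm (h x)\<bar> / c)) \<partial>lebesgue_on E"
  have m: "(\<lambda>x. \<Phi> (norm (h x) / c)) \<in> borel_measurable (lebesgue_on E)" if "c > 0" for c
    using measurable_Phi[of "\<lambda>x. (1 / c) *\<^sub>R h x" "lebesgue_on E"] h that by simp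
  obtain b where "b > 0" "?I b \<le> 1" using orlicz_norm_attained[OF E fin h] by (elim exE conjE) (rule that)
  then have ne: "b \<in> {c. c > 0 \<and> ?I c \<le> 1}" by simp
  have "\<exists>c\<in>{c. c > 0 \<and> ?I c \<le> 1}. c < \<epsilon>"
    by (rule cInf_lessD[OF _ le[unfolded orlicz_norm_def]]) (rule ex_in_conv[THEN iffD1, OF exI, OF ne])
  then obtain c where c: "0 < c" "?I c \<le> 1" "c < \<epsilon>" by (elim bexE CollectE conjE) (rule that)
  have "ennreal (rho (\<lambda>x. indicator E x *\<^sub>R h x)) = (\<integral>\<^sup>+x. ennreal (\<Phi> (norm (h x))) \<partial>lebesgue_on E)"
    by (rule Lphi_extension[OF E h fin])
  also have "\<dots> \<le> (\<integral>\<^sup>+x. ennreal c * ennreal (\<Phi> (norm (h x) / c)) \<partial>lebesgue_on E)"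
  proof (rule nn_integral_mono)
    fix x
    have "\<Phi> (c * (norm (h x) / c)) \<le> c * \<Phi> (norm (h x) / c)" by (rule Phi_scale_le) (use c \<epsilon> in auto)
    then show "ennreal (\<Phi> (norm (h x))) \<le> ennreal c * ennreal (\<Phi> (norm (h x) / c))"
      using c Phi_nonneg[of "norm (h x) / c"] by (simp flip: ennreal_mult)
  qed
  also have "\<dots> = ennreal c * ?I c"
    using m[OF c(1)] by (simp add: nn_integral_cmult)
  also have "\<dots> \<le> ennreal c * 1" using c by (intro mult_left_mono) auto
  finally have "rho (\<lambda>x. indicator E x *\<^sub>R h x) \<le> c" using c by (simp add: ennreal_le_iff)
  then show ?thesis using c by simp
qed

lemma L1_bound:
  assumes h: "Lphi h" and S: "S \<in> lmeasurable" and e: "e > 0"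
  shows "integrable lebesgue (\<lambda>x. indicator S x *\<^sub>R h x)"
    "(\<integral>x. indicator S x * norm (h x) \<partial>lebesgue) \<le> e * measure lebesgue S + e / \<Phi> e * rho h"
proof -
  let ?g = "\<lambda>x. e * indicator S x + e / \<Phi> e * \<Phi> (norm (h x))"
  have g: "integrable lebesgue ?g" using h S by (auto simp: Lphi_def fmeasurable_def)
  have Sm[measurable]: "S \<in> sets lebesgue" using S by auto
  have m: "(\<lambda>x. indicator S x *\<^sub>R h x) \<in> borel_measurable lebesgue"
    using h by (intro borel_measurable_scaleR) (auto simp: Lphi_def)
  have le: "norm (indicator S x *\<^sub>R h x) \<le> ?g x" for x
    using le_Phi[OF e, of "norm (h x)"] Phi_nonneg[of "norm (h x)"] Phi_pos[OF e] e by (auto simp: indicator_def)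
  show i: "integrable lebesgue (\<lambda>x. indicator S x *\<^sub>R h x)"
    by (rule Bochner_Integration.integrable_bound[OF g m]) (use le in \<open>auto intro!: AE_I2 intro: order_trans[OF _ abs_ge_self]\<close>)
  have "(\<integral>x. indicator S x * norm (h x) \<partial>lebesgue) \<le> integral\<^sup>L lebesgue ?g"
    by (rule integral_mono[OF _ g]) (use integrable_norm[OF i] le in \<open>auto simp: abs_mult\<close>)
  also have "\<dots> = e * measure lebesgue S + e / \<Phi> e * rho h"
    using h S by (simp add: Lphi_def rho_def fmeasurable_def)
  finally show "(\<integral>x. indicator S x * norm (h x) \<partial>lebesgue) \<le> e * measure lebesgue S + e / \<Phi> e * rho h" .
qed

text \<open>First \<open>e\<close> makes the term with the measure of \<open>S\<close> small, then
  \<open>\<delta>\<close> the modular term.\<close>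

lemma L1_small:
  assumes S: "S \<in> lmeasurable" and \<epsilon>: "\<epsilon> > 0"
  shows "\<exists>\<delta>>0. \<forall>h :: 'a::euclidean_space \<Rightarrow> 'b::euclidean_space. Lphi h \<and> rho h < \<delta> \<longrightarrow> (\<integral>x. indicator S x * norm (h x) \<partial>lebesgue) < \<epsilon>"
proof -
  obtain e where e: "e > 0" "e * measure lebesgue S \<le> \<epsilon> / 2"
    using small_factor[of "measure lebesgue S" "\<epsilon> / 2"] \<epsilon> by (auto simp: mult.commute)
  have p: "\<Phi> e > 0" by (rule Phi_pos[OF e(1)])
  define \<delta> where "\<delta> = \<Phi> e / e * (\<epsilon> / 2)"
  have "(\<integral>x. indicator S x * norm (h x) \<partial>lebesgue) < \<epsilon>" if "Lphi h" "rho h < \<delta>" for h :: "'a \<Rightarrow> 'b"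
  proof -
    have "e / \<Phi> e * rho h < e / \<Phi> e * \<delta>" using that p e by (intro mult_strict_left_mono) auto
    also have "\<dots> = \<epsilon> / 2" using p e by (simp add: \<delta>_def)
    finally show ?thesis using L1_bound(2)[OF that(1) S e(1)] e by linarith
  qed
  moreover have "\<delta> > 0" using p e \<epsilon> by (simp add: \<delta>_def)
  ultimately show ?thesis by blast
qed

text \<open>Elements of \<open>W1_0\<close> are handled as pairs of a function and its gradient on the whole space,
  vanishing outside \<open>E\<close>; this makes the domains \<open>\<Omega>\<^sub>k\<close> and \<open>\<Omega>\<close> comparable. By the doubling
  property, closure in the modular \<open>rho\<close> is closure in norm.\<close>

definition W0pair :: "(real^'n) set \<Rightarrow> (real^'n \<Rightarrow> real) \<Rightarrow> (real^'n \<Rightarrow> real^'n) \<Rightarrow> bool" where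
  "W0pair E U G \<longleftrightarrow> U \<in> borel_measurable lebesgue \<and> G \<in> borel_measurable lebesgue \<and>
     (\<forall>x. x \<notin> E \<longrightarrow> U x = 0 \<and> G x = 0) \<and>
     (\<forall>\<delta>>0. \<exists>\<psi>\<in>test_functions E. Lphi (\<lambda>x. U x - \<psi> x) \<and> rho (\<lambda>x. U x - \<psi> x) < \<delta> \<and>
        Lphi (\<lambda>x. G x - grad \<psi> x) \<and> rho (\<lambda>x. G x - grad \<psi> x) < \<delta>)"

lemma W0pairE:
  assumes "W0pair E U G" "\<delta> > 0"
  obtains \<psi> where "\<psi> \<in> test_functions E" "Lphi (\<lambda>x. U x - \<psi> x)" "rho (\<lambda>x. U x - \<psi> x) < \<delta>"
    "Lphi (\<lambda>x. G x - grad \<psi> x)" "rho (\<lambda>x. G x - grad \<psi> x) < \<delta>"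
  using assms unfolding W0pair_def by blast

lemma test_Lphi:
  assumes "\<psi> \<in> test_functions E" shows "Lphi \<psi>" "Lphi (grad \<psi>)"
proof -
  obtain K where K: "compact K" "\<And>x. x \<notin> K \<Longrightarrow> \<psi> x = 0" "\<And>x. x \<notin> K \<Longrightarrow> grad \<psi> x = 0"
    using assms by (metis test_functionsE)
  have "integrable lebesgue (\<lambda>x. \<Phi> (norm (\<psi> x)))"
    by (rule compact_support_integrable[OF continuous_Phi_norm[OF test_continuous[OF assms]] K(1)]) (simp add: K)
  moreover have "integrable lebesgue (\<lambda>x. \<Phi> (norm (grad \<psi> x)))"
    by (rule compact_support_integrable[OF continuous_Phi_norm[OF test_continuous_grad[OF assms]] K(1)]) (simp add: K)
  ultimately show "Lphi \<psi>" "Lphi (grad \<psi>)" using test_measurable[OF assms] by (auto simp: Lphi_def)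
qed

lemma test_outside: "\<psi> \<in> test_functions E \<Longrightarrow> x \<notin> E \<Longrightarrow> \<psi> x = 0 \<and> grad \<psi> x = 0"
  by (erule test_functionsE) blast

lemma rho_zero [simp]: "rho (\<lambda>x. 0) = 0" "Lphi (\<lambda>x. 0)"
  by (auto simp: rho_def Lphi_def)

lemma W0pair_test: "\<psi> \<in> test_functions E \<Longrightarrow> W0pair E \<psi> (grad \<psi>)"
  unfolding W0pair_def using test_measurable[of \<psi> E] test_outside[of \<psi> E]
  by (auto intro!: bexI[of _ \<psi>])

lemma W0pair_Lphi:
  assumes "W0pair E U G" shows "Lphi U" "Lphi G"
proof -
  obtain \<psi> where \<psi>: "\<psi> \<in> test_functions E" "Lphi (\<lambda>x. U x - \<psi> x)" "Lphi (\<lambda>x. G x - grad \<psi> x)"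
    using W0pairE[OF assms zero_less_one] by blast
  show "Lphi U" "Lphi G"
    using Lphi_add(1)[OF \<psi>(2) test_Lphi(1)[OF \<psi>(1)]] Lphi_add(1)[OF \<psi>(3) test_Lphi(2)[OF \<psi>(1)]] by simp_all
qed

lemma W0pair_outside: "W0pair E U G \<Longrightarrow> x \<notin> E \<Longrightarrow> U x = 0" "W0pair E U G \<Longrightarrow> x \<notin> E \<Longrightarrow> G x = 0"
  by (auto simp: W0pair_def)

text \<open>Both members of the pair live on the whole space, so the zero extension to
  \<open>E'\<close> is the pair itself.\<close>

lemma W0pair_mono: "W0pair E U G \<Longrightarrow> E \<subseteq> E' \<Longrightarrow> W0pair E' U G"
  unfolding W0pair_def using test_mono[of E E'] by (meson subsetD)

lemma W0pair_add:
  assumes 1: "W0pair E U G" and 2: "W0pair E V H"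
  shows "W0pair E (\<lambda>x. U x + V x) (\<lambda>x. G x + H x)"
  unfolding W0pair_def
proof (intro conjI allI impI)
  fix \<delta> :: real assume \<delta>: "\<delta> > 0"
  define d where "d = \<delta> / (2 * Kd)"
  have d: "d > 0" "Kd * (d + d) = \<delta>" using \<delta> Kd_pos by (auto simp: d_def)
  obtain \<psi> where \<psi>: "\<psi> \<in> test_functions E" "Lphi (\<lambda>x. U x - \<psi> x)" "rho (\<lambda>x. U x - \<psi> x) < d"
    "Lphi (\<lambda>x. G x - grad \<psi> x)" "rho (\<lambda>x. G x - grad \<psi> x) < d" using W0pairE[OF 1 d(1)] by blast
  obtain \<eta> where \<eta>: "\<eta> \<in> test_functions E" "Lphi (\<lambda>x. V x - \<eta> x)" "rho (\<lambda>x. V x - \<eta> x) < d"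
    "Lphi (\<lambda>x. H x - grad \<eta> x)" "rho (\<lambda>x. H x - grad \<eta> x) < d" using W0pairE[OF 2 d(1)] by blast
  have less: "Kd * (a + b) < \<delta>" if "a < d" "b < d" for a b
  proof -
    have "Kd * (a + b) < Kd * (d + d)" by (intro mult_strict_left_mono add_strict_mono Kd_pos that)
    then show ?thesis using d(2) by simp
  qed
  have e1: "(\<lambda>x. U x + V x - (\<psi> x + \<eta> x)) = (\<lambda>x. (U x - \<psi> x) + (V x - \<eta> x))" by auto
  have e2: "(\<lambda>x. G x + H x - grad (\<lambda>x. \<psi> x + \<eta> x) x) = (\<lambda>x. (G x - grad \<psi> x) + (H x - grad \<eta> x))"
    by (auto simp: grad_add[OF \<psi>(1) \<eta>(1)])
  show "\<exists>\<psi>\<in>test_functions E. Lphi (\<lambda>x. U x + V x - \<psi> x) \<and> rho (\<lambda>x. U x + V x - \<psi> x) < \<delta> \<and>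
      Lphi (\<lambda>x. G x + H x - grad \<psi> x) \<and> rho (\<lambda>x. G x + H x - grad \<psi> x) < \<delta>"
  proof (intro bexI[of _ "\<lambda>x. \<psi> x + \<eta> x"] conjI test_add \<psi>(1) \<eta>(1))
    show "Lphi (\<lambda>x. U x + V x - (\<psi> x + \<eta> x))" unfolding e1 by (rule Lphi_add(1)[OF \<psi>(2) \<eta>(2)])
    show "rho (\<lambda>x. U x + V x - (\<psi> x + \<eta> x)) < \<delta>"
      unfolding e1 using Lphi_add(2)[OF \<psi>(2) \<eta>(2)] less[OF \<psi>(3) \<eta>(3)] by linarith
    show "Lphi (\<lambda>x. G x + H x - grad (\<lambda>x. \<psi> x + \<eta> x) x)" unfolding e2 by (rule Lphi_add(1)[OF \<psi>(4) \<eta>(4)])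
    show "rho (\<lambda>x. G x + H x - grad (\<lambda>x. \<psi> x + \<eta> x) x) < \<delta>"
      unfolding e2 using Lphi_add(2)[OF \<psi>(4) \<eta>(4)] less[OF \<psi>(5) \<eta>(5)] by linarith
  qed
qed (use 1 2 in \<open>auto simp: W0pair_def\<close>)

lemma W0pair_cmult:
  fixes E :: "(real^'n) set"
  assumes 1: "W0pair E U G"
  shows "W0pair E (\<lambda>x. c * U x) (\<lambda>x. c *\<^sub>R G x)"
  unfolding W0pair_def
proof (intro conjI allI impI)
  fix \<delta> :: real assume \<delta>: "\<delta> > 0"
  obtain K where K: "K > 0" "\<And>h :: real^'n \<Rightarrow> real. Lphi h \<Longrightarrow> rho (\<lambda>x. \<bar>c\<bar> *\<^sub>R h x) \<le> K * rho h"
    using rho_scale[of "\<bar>c\<bar>"] by force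
  obtain L where L: "L > 0" "\<And>h :: real^'n \<Rightarrow> real^'n. Lphi h \<Longrightarrow> rho (\<lambda>x. \<bar>c\<bar> *\<^sub>R h x) \<le> L * rho h"
    using rho_scale[of "\<bar>c\<bar>"] by force
  define d where "d = min (\<delta> / K) (\<delta> / L)"
  have d: "d > 0" "K * d \<le> \<delta>" "L * d \<le> \<delta>" using \<delta> K(1) L(1) by (auto simp: d_def min_def field_simps)
  obtain \<psi> where \<psi>: "\<psi> \<in> test_functions E" "Lphi (\<lambda>x. U x - \<psi> x)" "rho (\<lambda>x. U x - \<psi> x) < d"
    "Lphi (\<lambda>x. G x - grad \<psi> x)" "rho (\<lambda>x. G x - grad \<psi> x) < d" using W0pairE[OF 1 d(1)] by blast
  have abs: "rho (\<lambda>x. c *\<^sub>R h x) = rho (\<lambda>x. \<bar>c\<bar> *\<^sub>R h x)" for h :: "real^'n \<Rightarrow> 'z::euclidean_space"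
    by (simp add: rho_def)
  have e1: "(\<lambda>x. c * U x - c * \<psi> x) = (\<lambda>x. c *\<^sub>R (U x - \<psi> x))" by (auto simp: algebra_simps)
  have e2: "(\<lambda>x. c *\<^sub>R G x - grad (\<lambda>x. c * \<psi> x) x) = (\<lambda>x. c *\<^sub>R (G x - grad \<psi> x))"
    by (auto simp: grad_cmult[OF \<psi>(1)] scaleR_diff_right)
  show "\<exists>\<psi>\<in>test_functions E. Lphi (\<lambda>x. c * U x - \<psi> x) \<and> rho (\<lambda>x. c * U x - \<psi> x) < \<delta> \<and>
      Lphi (\<lambda>x. c *\<^sub>R G x - grad \<psi> x) \<and> rho (\<lambda>x. c *\<^sub>R G x - grad \<psi> x) < \<delta>"
  proof (intro bexI[of _ "\<lambda>x. c * \<psi> x"] conjI test_cmult \<psi>(1))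
    show "Lphi (\<lambda>x. c * U x - c * \<psi> x)" unfolding e1 by (rule Lphi_scaleR[OF \<psi>(2)])
    show "rho (\<lambda>x. c * U x - c * \<psi> x) < \<delta>"
      unfolding e1 abs using K(2)[OF \<psi>(2)] mult_strict_left_mono[OF \<psi>(3) K(1)] d by linarith
    show "Lphi (\<lambda>x. c *\<^sub>R G x - grad (\<lambda>x. c * \<psi> x) x)" unfolding e2 by (rule Lphi_scaleR[OF \<psi>(4)])
    show "rho (\<lambda>x. c *\<^sub>R G x - grad (\<lambda>x. c * \<psi> x) x) < \<delta>"
      unfolding e2 abs using L(2)[OF \<psi>(4)] mult_strict_left_mono[OF \<psi>(5) L(1)] d by linarith
  qed
qed (use 1 in \<open>auto simp: W0pair_def\<close>)

lemma W0pair_diff: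
  assumes "W0pair E U G" "W0pair E V H"
  shows "W0pair E (\<lambda>x. U x - V x) (\<lambda>x. G x - H x)"
  using W0pair_add[OF assms(1) W0pair_cmult[OF assms(2), of "-1"]] by simp

section \<open>Weak gradients of zero extensions\<close>

lemma Lphi_locally_integrable:
  assumes "Lphi h" shows "locally_integrable E h"
  unfolding locally_integrable_def set_integrable_def
  using L1_bound(1)[OF assms _ zero_less_one] by (auto intro: lmeasurable_compact)

lemma Lphi_mult_integrable:
  fixes h :: "real^'n \<Rightarrow> real"
  assumes "Lphi h" and "continuous_on UNIV q" "compact K" "\<And>x. x \<notin> K \<Longrightarrow> q x = 0"
  shows "integrable lebesgue (\<lambda>x. h x * q x)"
  using locally_integrable_mult[OF Lphi_locally_integrable[OF assms(1)] open_UNIV assms(2,3) _ assms(4)]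
  by (simp add: integrable_restrict_space)

text \<open>Continuity in the modular of the pairing with a fixed function; it carries integration
  by parts from test functions to their limits.\<close>

lemma Lphi_mult_small:
  fixes q :: "real^'n \<Rightarrow> real"
  assumes "continuous_on UNIV q" "compact K" "\<And>x. x \<notin> K \<Longrightarrow> q x = 0" "\<epsilon> > 0"
  shows "\<exists>\<delta>>0. \<forall>h :: real^'n \<Rightarrow> real. Lphi h \<and> rho h < \<delta> \<longrightarrow> \<bar>\<integral>x. h x * q x \<partial>lebesgue\<bar> < \<epsilon>"
proof -
  obtain B0 where B0: "\<And>x. x \<in> K \<Longrightarrow> norm (q x) \<le> B0"
    using compact_imp_bounded[OF compact_continuous_image[OF continuous_on_subset[OF assms(1)] assms(2)]]
    by (auto simp: bounded_iff)
  define B where "B = \<bar>B0\<bar> + 1"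
  have B: "B > 0" "\<And>x. x \<in> K \<Longrightarrow> \<bar>q x\<bar> \<le> B" using B0 by (force simp: B_def)+
  have K: "K \<in> lmeasurable" using assms(2) by (rule lmeasurable_compact)
  obtain \<delta> where \<delta>: "\<delta> > 0" "\<And>h :: real^'n \<Rightarrow> real. Lphi h \<Longrightarrow> rho h < \<delta> \<Longrightarrow> (\<integral>x. indicator K x * norm (h x) \<partial>lebesgue) < \<epsilon> / B"
    using L1_small[OF K, of "\<epsilon> / B"] assms(4) B(1) by (metis divide_pos_pos)
  have "\<bar>\<integral>x. h x * q x \<partial>lebesgue\<bar> < \<epsilon>" if h: "Lphi h" "rho h < \<delta>" for h :: "real^'n \<Rightarrow> real"
  proof -
    have i: "integrable lebesgue (\<lambda>x. indicator K x *\<^sub>R h x)" by (rule L1_bound(1)[OF h(1) K zero_less_one])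
    have "\<bar>\<integral>x. h x * q x \<partial>lebesgue\<bar> \<le> (\<integral>x. B * (indicator K x * norm (h x)) \<partial>lebesgue)"
    proof (rule order_trans[OF integral_abs_bound], rule integral_mono)
      show "integrable lebesgue (\<lambda>x. \<bar>h x * q x\<bar>)"
        by (intro integrable_abs Lphi_mult_integrable[OF h(1) assms(1,2,3)])
      show "integrable lebesgue (\<lambda>x. B * (indicator K x * norm (h x)))"
        using integrable_norm[OF i] by (intro integrable_mult_right) (simp add: abs_mult)
      show "\<bar>h x * q x\<bar> \<le> B * (indicator K x * norm (h x))" for x
        using B(2)[of x] assms(3)[of x] mult_left_mono[of "\<bar>q x\<bar>" B "\<bar>h x\<bar>"]
        by (auto simp: indicator_def abs_mult mult.commute)
    qed
    also have "\<dots> = B * (\<integral>x. indicator K x * norm (h x) \<partial>lebesgue)" by simp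
    also have "\<dots> < B * (\<epsilon> / B)" using \<delta>(2)[OF h] B(1) by (intro mult_strict_left_mono)
    finally show ?thesis using B(1) by simp
  qed
  then show ?thesis using \<delta>(1) by blast
qed

lemma Lphi_component:
  fixes G :: "real^'n \<Rightarrow> real^'n"
  assumes "Lphi G" shows "Lphi (\<lambda>x. G x $ i)" "rho (\<lambda>x. G x $ i) \<le> rho G"
proof -
  have g: "integrable lebesgue (\<lambda>x. \<Phi> (norm (G x)))" using assms by (simp add: Lphi_def)
  have m: "(\<lambda>x. G x $ i) \<in> borel_measurable lebesgue"
    using assms unfolding Lphi_def
    by (auto intro!: measurable_compose[of G _ borel "\<lambda>v. v $ i"] borel_measurable_continuous_onI continuous_intros)
  have le: "\<Phi> (norm (G x $ i)) \<le> \<Phi> (norm (G x))" for x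
    using component_le_norm_cart[of "G x" i] by (intro Phi_mono) auto
  show "Lphi (\<lambda>x. G x $ i)" "rho (\<lambda>x. G x $ i) \<le> rho G"
    using Lphi_bound[OF m g le] by (auto simp: rho_def)
qed

text \<open>\<open>\<eta>\<close> need not be supported in \<open>E\<close>: the approximants of
  \<open>U\<close> have compact support, so \<open>test_by_parts\<close> holds for them on the whole
  space and survives the limit. Hence \<open>G\<close> is the gradient of the zero extension across
  the boundary of \<open>E\<close> as well.\<close>

lemma W0pair_by_parts:
  fixes E :: "(real^'n) set"
  assumes W: "W0pair E U G" and \<eta>: "\<eta> \<in> test_functions E'"
  shows "(\<integral>x. U x * partial_deriv i \<eta> x \<partial>lebesgue) = - (\<integral>x. G x $ i * \<eta> x \<partial>lebesgue)"
proof -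
  obtain K where K: "compact K" "\<And>x. x \<notin> K \<Longrightarrow> \<eta> x = 0" "\<And>x. x \<notin> K \<Longrightarrow> grad \<eta> x = 0"
    using \<eta> by (metis test_functionsE)
  have p0: "partial_deriv i \<eta> x = 0" if "x \<notin> K" for x using K(3)[OF that] by (metis grad_nth zero_index)
  note c = test_continuous[OF \<eta>, of UNIV] test_continuous_partial[OF \<eta>, of UNIV i]
  have "\<bar>(\<integral>x. U x * partial_deriv i \<eta> x \<partial>lebesgue) + (\<integral>x. G x $ i * \<eta> x \<partial>lebesgue)\<bar> \<le> \<epsilon>" if \<epsilon>: "\<epsilon> > 0" for \<epsilon>
  proof -
    obtain d1 where d1: "d1 > 0" "\<And>h :: real^'n \<Rightarrow> real. Lphi h \<Longrightarrow> rho h < d1 \<Longrightarrow> \<bar>\<integral>x. h x * partial_deriv i \<eta> x \<partial>lebesgue\<bar> < \<epsilon> / 2"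
      using Lphi_mult_small[OF c(2) K(1) p0, of "\<epsilon> / 2"] \<epsilon> by (meson half_gt_zero)
    obtain d2 where d2: "d2 > 0" "\<And>h :: real^'n \<Rightarrow> real. Lphi h \<Longrightarrow> rho h < d2 \<Longrightarrow> \<bar>\<integral>x. h x * \<eta> x \<partial>lebesgue\<bar> < \<epsilon> / 2"
      using Lphi_mult_small[OF c(1) K(1,2), of "\<epsilon> / 2"] \<epsilon> by (meson half_gt_zero)
    obtain \<psi> where \<psi>: "\<psi> \<in> test_functions E" "Lphi (\<lambda>x. U x - \<psi> x)" "rho (\<lambda>x. U x - \<psi> x) < min d1 d2"
      "Lphi (\<lambda>x. G x - grad \<psi> x)" "rho (\<lambda>x. G x - grad \<psi> x) < min d1 d2"
      using W0pairE[OF W, of "min d1 d2"] d1(1) d2(1) by auto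
    note L = W0pair_Lphi[OF W] test_Lphi[OF \<psi>(1)]
    have comp: "Lphi (\<lambda>x. (G x - grad \<psi> x) $ i)" "rho (\<lambda>x. (G x - grad \<psi> x) $ i) < d2"
      using Lphi_component[OF \<psi>(4), of i] \<psi>(5) by auto
    have i1: "(\<integral>x. U x * partial_deriv i \<eta> x \<partial>lebesgue) - (\<integral>x. \<psi> x * partial_deriv i \<eta> x \<partial>lebesgue)
        = (\<integral>x. (U x - \<psi> x) * partial_deriv i \<eta> x \<partial>lebesgue)"
      using Lphi_mult_integrable[OF L(1) c(2) K(1) p0] Lphi_mult_integrable[OF L(3) c(2) K(1) p0]
      by (simp add: left_diff_distrib)
    have i2: "(\<integral>x. G x $ i * \<eta> x \<partial>lebesgue) - (\<integral>x. partial_deriv i \<psi> x * \<eta> x \<partial>lebesgue)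
        = (\<integral>x. (G x - grad \<psi> x) $ i * \<eta> x \<partial>lebesgue)"
      using Lphi_mult_integrable[OF Lphi_component(1)[OF L(2)] c(1) K(1,2), of i]
        Lphi_mult_integrable[OF Lphi_component(1)[OF L(4)] c(1) K(1,2), of i]
      by (simp add: left_diff_distrib)
    have "\<bar>\<integral>x. (U x - \<psi> x) * partial_deriv i \<eta> x \<partial>lebesgue\<bar> < \<epsilon> / 2" using d1(2)[OF \<psi>(2)] \<psi>(3) by simp
    moreover have "\<bar>\<integral>x. (G x - grad \<psi> x) $ i * \<eta> x \<partial>lebesgue\<bar> < \<epsilon> / 2" by (rule d2(2)[OF comp])
    ultimately show ?thesis using i1 i2 test_by_parts[OF \<psi>(1) \<eta>, of i] by linarith
  qed
  then have "\<bar>(\<integral>x. U x * partial_deriv i \<eta> x \<partial>lebesgue) + (\<integral>x. G x $ i * \<eta> x \<partial>lebesgue)\<bar> \<le> 0"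
    by (rule field_le_epsilon) simp
  then show ?thesis by simp
qed

lemma W0pair_weak_gradient:
  fixes E E' :: "(real^'n) set"
  assumes W: "W0pair E U G" and E': "open E'"
  shows "has_weak_gradient E' U G"
  unfolding has_weak_gradient_def
proof (intro conjI ballI allI)
  have m: "U \<in> borel_measurable lebesgue" "G \<in> borel_measurable lebesgue" using W by (auto simp: W0pair_def)
  show "U \<in> borel_measurable (lebesgue_on E')" "G \<in> borel_measurable (lebesgue_on E')"
    using m by (auto intro: measurable_restrict_space1)
  show "locally_integrable E' U" "locally_integrable E' G"
    by (intro Lphi_locally_integrable W0pair_Lphi[OF W])+
  have restr: "(\<integral>x. h x \<partial>lebesgue_on E') = (\<integral>x. h x \<partial>lebesgue)"
    if h: "\<And>x. indicator E' x *\<^sub>R h x = h x" for h :: "real^'n \<Rightarrow> real"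
  proof -
    have "E' \<inter> space lebesgue \<in> sets lebesgue" using E' by auto
    from integral_restrict_space[OF this, of h] show ?thesis unfolding h .
  qed
  fix \<eta> i assume \<eta>: "\<eta> \<in> test_functions E'"
  have "(\<integral>x. U x * partial_deriv i \<eta> x \<partial>lebesgue_on E') = (\<integral>x. U x * partial_deriv i \<eta> x \<partial>lebesgue)"
  proof -
    have "indicator E' x *\<^sub>R (U x * partial_deriv i \<eta> x) = U x * partial_deriv i \<eta> x" for x
      using test_outside[OF \<eta>, of x] grad_nth[of \<eta> x i] by (auto simp: indicator_def simp del: grad_nth)
    then show ?thesis by (rule restr)
  qed
  moreover have "(\<integral>x. G x $ i * \<eta> x \<partial>lebesgue_on E') = (\<integral>x. G x $ i * \<eta> x \<partial>lebesgue)"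
  proof -
    have "indicator E' x *\<^sub>R (G x $ i * \<eta> x) = G x $ i * \<eta> x" for x
      using test_outside[OF \<eta>, of x] by (auto simp: indicator_def)
    then show ?thesis by (rule restr)
  qed
  ultimately show "(\<integral>x. U x * partial_deriv i \<eta> x \<partial>lebesgue_on E') = - (\<integral>x. G x $ i * \<eta> x \<partial>lebesgue_on E')"
    using W0pair_by_parts[OF W \<eta>] by simp
qed

text \<open>\<open>orlicz_norm_le\<close> is applied to both parts of the norm, after the chosen
  \<open>weak_gradient\<close> on \<open>E'\<close> has been replaced by \<open>G\<close>, with
  which it agrees almost everywhere there.\<close>

lemma W1_norm_small:
  assumes \<epsilon>: "\<epsilon> > 0"
  shows "\<exists>\<delta>>0. \<forall>(U :: real^'n \<Rightarrow> real) G E E'. W0pair E U G \<and> open E' \<and> rho U \<le> \<delta> \<and> rho G \<le> \<delta> \<longrightarrow> \<bar>W1_norm \<Phi> E' U\<bar> \<le> \<epsilon>"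
proof -
  obtain d1 where d1: "d1 > 0" "\<And>(h :: real^'n \<Rightarrow> real) E. Lphi h \<Longrightarrow> E \<in> sets lebesgue \<Longrightarrow> rho h \<le> d1 \<Longrightarrow> \<bar>orlicz_norm \<Phi> E (\<lambda>x. norm (h x))\<bar> \<le> \<epsilon> / 2"
    using orlicz_norm_le[of "\<epsilon> / 2"] \<epsilon> by (metis half_gt_zero)
  obtain d2 where d2: "d2 > 0" "\<And>(h :: real^'n \<Rightarrow> real^'n) E. Lphi h \<Longrightarrow> E \<in> sets lebesgue \<Longrightarrow> rho h \<le> d2 \<Longrightarrow> \<bar>orlicz_norm \<Phi> E (\<lambda>x. norm (h x))\<bar> \<le> \<epsilon> / 2"
    using orlicz_norm_le[of "\<epsilon> / 2"] \<epsilon> by (metis half_gt_zero)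
  have "\<bar>W1_norm \<Phi> E' U\<bar> \<le> \<epsilon>" if W: "W0pair E U G" and E': "open E'" and r: "rho U \<le> min d1 d2" "rho G \<le> min d1 d2"
    for U :: "real^'n \<Rightarrow> real" and G E E'
  proof -
    have m: "E' \<in> sets lebesgue" using E' by auto
    have 1: "\<bar>orlicz_norm \<Phi> E' U\<bar> \<le> \<epsilon> / 2"
      using d1(2)[OF W0pair_Lphi(1)[OF W] m] r by (simp add: orlicz_norm_def)
    have "AE x in lebesgue_on E'. weak_gradient E' U x = G x"
      using weak_gradient_AE(2)[OF E' W0pair_weak_gradient[OF W E']] m by (simp add: AE_restrict_space_iff)
    then have "(\<integral>\<^sup>+x. ennreal (\<Phi> (\<bar>norm (weak_gradient E' U x)\<bar> / c)) \<partial>lebesgue_on E') =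
        (\<integral>\<^sup>+x. ennreal (\<Phi> (\<bar>norm (G x)\<bar> / c)) \<partial>lebesgue_on E')" for c
      by (intro nn_integral_cong_AE) (auto elim: eventually_mono)
    then have "orlicz_norm \<Phi> E' (\<lambda>x. norm (weak_gradient E' U x)) = orlicz_norm \<Phi> E' (\<lambda>x. norm (G x))"
      unfolding orlicz_norm_def by simp
    moreover have "\<bar>orlicz_norm \<Phi> E' (\<lambda>x. norm (G x))\<bar> \<le> \<epsilon> / 2" using d2(2)[OF W0pair_Lphi(2)[OF W] m] r by simp
    ultimately show ?thesis using 1 unfolding W1_norm_def by linarith
  qed
  then show ?thesis using d1(1) d2(1) by (intro exI[of _ "min d1 d2"]) auto
qed

lemma Lphi_orlicz:
  assumes "Lphi h" "E \<in> sets lebesgue" shows "(\<lambda>x. norm (h x)) \<in> orlicz \<Phi> E"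
  unfolding orlicz_def using nn_integral_rho_le[OF assms] assms(1)
  by (auto simp: Lphi_def intro!: measurable_restrict_space1 intro: order.strict_trans1)

lemma W0pair_imp_W1_0:
  fixes E :: "(real^'n) set"
  assumes W: "W0pair E U G" and E': "open E'" "E \<subseteq> E'"
  shows "U \<in> W1_0 \<Phi> E'"
proof -
  have m: "E' \<in> sets lebesgue" using E' by auto
  have "U \<in> orlicz \<Phi> E'"
    using Lphi_orlicz[OF W0pair_Lphi(1)[OF W] m] W
    by (auto simp: orlicz_def W0pair_def intro: measurable_restrict_space1)
  then have "U \<in> W1 \<Phi> E'"
    using W0pair_weak_gradient[OF W E'(1)] Lphi_orlicz[OF W0pair_Lphi(2)[OF W] m] by (auto simp: W1_def)
  moreover have "\<exists>\<psi>\<in>test_functions E'. W1_norm \<Phi> E' (\<lambda>x. U x - \<psi> x) < \<epsilon>" if \<epsilon>: "\<epsilon> > 0" for \<epsilon>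
  proof -
    obtain \<delta> where \<delta>: "\<delta> > 0" "\<And>(U :: real^'n \<Rightarrow> real) G E E'. W0pair E U G \<Longrightarrow> open E' \<Longrightarrow> rho U \<le> \<delta> \<Longrightarrow> rho G \<le> \<delta> \<Longrightarrow> \<bar>W1_norm \<Phi> E' U\<bar> \<le> \<epsilon> / 2"
      using W1_norm_small[of "\<epsilon> / 2"] \<epsilon> by (metis half_gt_zero)
    obtain \<psi> where \<psi>: "\<psi> \<in> test_functions E" "rho (\<lambda>x. U x - \<psi> x) < \<delta>" "rho (\<lambda>x. G x - grad \<psi> x) < \<delta>"
      using W0pairE[OF W \<delta>(1)] by blast
    have "\<bar>W1_norm \<Phi> E' (\<lambda>x. U x - \<psi> x)\<bar> \<le> \<epsilon> / 2"
      by (rule \<delta>(2)[OF W0pair_diff[OF W W0pair_test[OF \<psi>(1)]] E'(1)]) (use \<psi> in auto)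
    then show ?thesis using \<epsilon> test_mono[OF E'(2) \<psi>(1)] by (intro bexI[of _ \<psi>]) auto
  qed
  ultimately show ?thesis by (simp add: W1_0_def)
qed

text \<open>The bridge from the definition by norms to pairs: the same test functions approximate
  the zero extensions, smallness in norm being converted to smallness in modular.\<close>

lemma W1_0_imp_W0pair:
  fixes u :: "real^'n \<Rightarrow> real"
  assumes E: "open E" and u: "u \<in> W1_0 \<Phi> E"
  shows "has_weak_gradient E u (weak_gradient E u)"
    "W0pair E (\<lambda>x. indicator E x *\<^sub>R u x) (\<lambda>x. indicator E x *\<^sub>R weak_gradient E u x)"
proof -
  have m: "E \<in> sets lebesgue" using E by auto
  obtain g where g: "has_weak_gradient E u g" "(\<lambda>x. norm (g x)) \<in> orlicz \<Phi> E" and uo: "u \<in> orlicz \<Phi> E"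
    using u by (auto simp: W1_0_def W1_def)
  define k where "k = weak_gradient E u"
  have k: "has_weak_gradient E u k" "AE x in lebesgue. x \<in> E \<longrightarrow> k x = g x"
    using weak_gradient_AE[OF E g(1)] by (auto simp: k_def)
  show "has_weak_gradient E u (weak_gradient E u)" using k(1) by (simp add: k_def)
  have um: "u \<in> borel_measurable (lebesgue_on E)" and km: "k \<in> borel_measurable (lebesgue_on E)"
    using k(1) by (auto simp: has_weak_gradient_def)
  have ufin: "(\<integral>\<^sup>+x. ennreal (\<Phi> (norm (u x))) \<partial>lebesgue_on E) < \<infinity>" using uo by (simp add: orlicz_def)
  have "AE x in lebesgue_on E. k x = g x" using k(2) m by (simp add: AE_restrict_space_iff)
  then have "(\<integral>\<^sup>+x. ennreal (\<Phi> (norm (k x))) \<partial>lebesgue_on E) = (\<integral>\<^sup>+x. ennreal (\<Phi> (norm (g x))) \<partial>lebesgue_on E)"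
    by (intro nn_integral_cong_AE) (auto elim: eventually_mono)
  then have kfin: "(\<integral>\<^sup>+x. ennreal (\<Phi> (norm (k x))) \<partial>lebesgue_on E) < \<infinity>" using g(2) by (simp add: orlicz_def)
  note LU = Lphi_extension(1)[OF m um ufin] and LK = Lphi_extension(1)[OF m km kfin]
  have fin_restrict: "(\<integral>\<^sup>+x. ennreal (\<Phi> (norm (h x))) \<partial>lebesgue_on E) < \<infinity>"
    if "Lphi (\<lambda>x. indicator E x *\<^sub>R h x)" for h :: "real^'n \<Rightarrow> 'z::euclidean_space"
  proof -
    have "(\<integral>\<^sup>+x. ennreal (\<Phi> (norm (h x))) \<partial>lebesgue_on E) = (\<integral>\<^sup>+x. ennreal (\<Phi> (norm (indicator E x *\<^sub>R h x))) \<partial>lebesgue_on E)"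
      by (intro nn_integral_cong) (simp add: space_restrict_space)
    then show ?thesis using nn_integral_rho_le[OF that m] by (simp add: order.strict_trans1)
  qed
  have approx: "\<exists>\<psi>\<in>test_functions E. Lphi (\<lambda>x. indicator E x *\<^sub>R u x - \<psi> x) \<and> rho (\<lambda>x. indicator E x *\<^sub>R u x - \<psi> x) < \<delta> \<and>
        Lphi (\<lambda>x. indicator E x *\<^sub>R k x - grad \<psi> x) \<and> rho (\<lambda>x. indicator E x *\<^sub>R k x - grad \<psi> x) < \<delta>" if \<delta>: "\<delta> > 0" for \<delta>
  proof -
    \<comment> \<open>The cap at 1 is what \<open>rho_le_of_orlicz_norm\<close> requires.\<close>
    define d where "d = min \<delta> 1"
    have d: "d > 0" "d \<le> 1" "d \<le> \<delta>" using \<delta> by (auto simp: d_def)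
    obtain \<psi> where \<psi>: "\<psi> \<in> test_functions E" "W1_norm \<Phi> E (\<lambda>x. u x - \<psi> x) < d"
      using u d(1) by (auto simp: W1_0_def)
    let ?w = "weak_gradient E (\<lambda>x. u x - \<psi> x)"
    have hw: "has_weak_gradient E (\<lambda>x. u x - \<psi> x) (\<lambda>x. k x - grad \<psi> x)"
      by (rule has_weak_gradient_diff[OF E k(1) W0pair_weak_gradient[OF W0pair_test[OF \<psi>(1)] E]])
    have ae: "AE x in lebesgue_on E. ?w x = k x - grad \<psi> x"
      using weak_gradient_AE(2)[OF E hw] m by (simp add: AE_restrict_space_iff)
    have e1: "(\<lambda>x. indicator E x *\<^sub>R (u x - \<psi> x)) = (\<lambda>x. indicator E x *\<^sub>R u x - \<psi> x)"
      using test_outside[OF \<psi>(1)] by (auto simp: indicator_def fun_eq_iff)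
    have e2: "(\<lambda>x. indicator E x *\<^sub>R (k x - grad \<psi> x)) = (\<lambda>x. indicator E x *\<^sub>R k x - grad \<psi> x)"
      using test_outside[OF \<psi>(1)] by (auto simp: indicator_def fun_eq_iff)
    have L1: "Lphi (\<lambda>x. indicator E x *\<^sub>R (u x - \<psi> x))" unfolding e1 by (rule Lphi_diff(1)[OF LU test_Lphi(1)[OF \<psi>(1)]])
    have L2: "Lphi (\<lambda>x. indicator E x *\<^sub>R (k x - grad \<psi> x))" unfolding e2 by (rule Lphi_diff(1)[OF LK test_Lphi(2)[OF \<psi>(1)]])
    have um': "(\<lambda>x. u x - \<psi> x) \<in> borel_measurable (lebesgue_on E)"
      by (rule borel_measurable_diff[OF um measurable_restrict_space1[OF test_measurable(1)[OF \<psi>(1)]]])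
    have km': "(\<lambda>x. k x - grad \<psi> x) \<in> borel_measurable (lebesgue_on E)"
      by (rule borel_measurable_diff[OF km measurable_restrict_space1[OF test_measurable(3)[OF \<psi>(1)]]])
    \<comment> \<open>Both summands of \<open>W1_norm\<close> must be known to be nonnegative before
      a bound on the sum bounds each of them.\<close>
    have on0: "0 \<le> orlicz_norm \<Phi> E h" if "\<exists>c>0. (\<integral>\<^sup>+x. ennreal (\<Phi> (\<bar>h x\<bar> / c)) \<partial>lebesgue_on E) \<le> 1" for h
      unfolding orlicz_norm_def using that by (intro cInf_greatest) auto
    have ow: "orlicz_norm \<Phi> E (\<lambda>x. norm (?w x)) = orlicz_norm \<Phi> E (\<lambda>x. norm (k x - grad \<psi> x))"
    proof -
      have "(\<integral>\<^sup>+x. ennreal (\<Phi> (\<bar>norm (?w x)\<bar> / c)) \<partial>lebesgue_on E) =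
          (\<integral>\<^sup>+x. ennreal (\<Phi> (\<bar>norm (k x - grad \<psi> x)\<bar> / c)) \<partial>lebesgue_on E)" for c
        using ae by (intro nn_integral_cong_AE) (auto elim: eventually_mono)
      then show ?thesis unfolding orlicz_norm_def by simp
    qed
    have nn1: "0 \<le> orlicz_norm \<Phi> E (\<lambda>x. norm (u x - \<psi> x))"
      by (rule on0[OF orlicz_norm_attained[OF m fin_restrict[OF L1]]]) (rule um')
    have nn2: "0 \<le> orlicz_norm \<Phi> E (\<lambda>x. norm (k x - grad \<psi> x))"
      by (rule on0[OF orlicz_norm_attained[OF m fin_restrict[OF L2]]]) (rule km')
    have on1: "orlicz_norm \<Phi> E (\<lambda>x. norm (u x - \<psi> x)) = orlicz_norm \<Phi> E (\<lambda>x. u x - \<psi> x)" by (simp add: orlicz_norm_def)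
    have lt: "orlicz_norm \<Phi> E (\<lambda>x. norm (u x - \<psi> x)) < d" "orlicz_norm \<Phi> E (\<lambda>x. norm (k x - grad \<psi> x)) < d"
      using \<psi>(2) nn1 nn2 ow on1 by (auto simp: W1_norm_def)
    have "rho (\<lambda>x. indicator E x *\<^sub>R (u x - \<psi> x)) < d"
      by (rule rho_le_of_orlicz_norm[OF m _ fin_restrict[OF L1] lt(1) d(2)]) (rule um')
    moreover have "rho (\<lambda>x. indicator E x *\<^sub>R (k x - grad \<psi> x)) < d"
      by (rule rho_le_of_orlicz_norm[OF m _ fin_restrict[OF L2] lt(2) d(2)]) (rule km')
    ultimately show ?thesis using L1 L2 \<psi>(1) d unfolding e1 e2 by (intro bexI[of _ \<psi>]) auto
  qed
  show "W0pair E (\<lambda>x. indicator E x *\<^sub>R u x) (\<lambda>x. indicator E x *\<^sub>R weak_gradient E u x)"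
    unfolding W0pair_def k_def[symmetric]
    using approx LU LK by (auto simp: Lphi_def)
qed

end

section \<open>Hausdorff convergence of complements\<close>

text \<open>The distance is a maximum of real suprema and controls single points only once these
  suprema are over bounded sets. They are: a point of \<open>D\<close> sees the fixed point
  \<open>p\<close> outside \<open>D\<close>, and a point already in the complement has distance 0 to
  it.\<close>

lemma hausdorff_compl_near:
  fixes A B D :: "'a::euclidean_space set"
  assumes D: "bounded D" "A \<subseteq> D" "B \<subseteq> D" and r: "hausdorff_compl_dist A B < r"
  shows "x \<notin> A \<Longrightarrow> \<exists>y. y \<notin> B \<and> dist x y < r" "x \<notin> B \<Longrightarrow> \<exists>y. y \<notin> A \<and> dist x y < r"
proof -
  have "D \<noteq> UNIV" using D(1) not_bounded_UNIV by auto
  then obtain p where p: "p \<notin> D" by auto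
  obtain R where R: "\<And>x. x \<in> D \<Longrightarrow> norm x \<le> R" using D(1) by (auto simp: bounded_iff)
  have bound: "infdist x (- T) \<le> \<bar>R\<bar> + norm p" if T: "T \<subseteq> D" for x T
  proof (cases "x \<in> T")
    case True
    have "infdist x (- T) \<le> dist x p" using p T by (intro infdist_le) auto
    also have "\<dots> \<le> norm x + norm p" by (simp add: dist_norm norm_triangle_ineq4)
    finally show ?thesis using R[of x] True T by force
  qed simp
  have bdd: "bdd_above ((\<lambda>x. infdist x (- T)) ` S)" if "T \<subseteq> D" for T S
    using bound[OF that] by (auto intro!: bdd_aboveI)
  have near: "\<exists>y. y \<notin> T \<and> dist x y < r" if T: "T \<subseteq> D" and x: "infdist x (- T) < r" for T x
  proof -
    have "- T \<noteq> {}" using p T by auto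
    then have "\<exists>z\<in>dist x ` (- T). z < r" using x by (intro cInf_lessD) (auto simp: infdist_notempty)
    then show ?thesis by auto
  qed
  show "\<exists>y. y \<notin> B \<and> dist x y < r" if "x \<notin> A"
  proof (rule near[OF D(3)])
    have "infdist x (- B) \<le> (SUP x\<in>- A. infdist x (- B))"
      using that by (intro cSUP_upper bdd[OF D(3)]) auto
    then show "infdist x (- B) < r" using r by (simp add: hausdorff_compl_dist_def hausdorff_dist_def)
  qed
  show "\<exists>y. y \<notin> A \<and> dist x y < r" if "x \<notin> B"
  proof (rule near[OF D(2)])
    have "infdist x (- A) \<le> (SUP x\<in>- B. infdist x (- A))"
      using that by (intro cSUP_upper bdd[OF D(2)]) auto
    then show "infdist x (- A) < r" using r by (simp add: hausdorff_compl_dist_def hausdorff_dist_def)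
  qed
qed

text \<open>The compact support keeps a positive distance \<open>d\<close> from the complement of
  \<open>\<Omega>\<close>. Once the complements are closer than \<open>d\<close>, no point of the
  support lies outside \<open>\<Omega>s k\<close>.\<close>

lemma eventually_test_function:
  assumes D: "bounded D" "\<And>k. \<Omega>s k \<subseteq> D" "\<Omega> \<subseteq> D" "open \<Omega>"
    and lim: "(\<lambda>k. hausdorff_compl_dist (\<Omega>s k) \<Omega>) \<longlonglongrightarrow> 0" and \<psi>: "\<psi> \<in> test_functions \<Omega>"
  shows "eventually (\<lambda>k. \<psi> \<in> test_functions (\<Omega>s k)) sequentially"
proof -
  obtain K where K: "compact K" "K \<subseteq> \<Omega>" "\<And>x. x \<notin> K \<Longrightarrow> \<psi> x = 0" using \<psi> by (metis test_functionsE)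
  obtain d where d: "d > 0" "\<And>x y. x \<in> K \<Longrightarrow> y \<notin> \<Omega> \<Longrightarrow> d \<le> dist x y"
    using separate_compact_closed[OF K(1) closed_Compl[OF D(4)]] K(2) by (metis ComplI Compl_disjoint2 disjoint_eq_subset_Compl double_complement)
  have "eventually (\<lambda>k. hausdorff_compl_dist (\<Omega>s k) \<Omega> < d) sequentially"
    by (rule order_tendstoD(2)[OF lim d(1)])
  then show ?thesis
  proof eventually_elim
    case (elim k)
    have "K \<subseteq> \<Omega>s k"
    proof
      fix x assume x: "x \<in> K"
      show "x \<in> \<Omega>s k"
      proof (rule ccontr)
        assume "x \<notin> \<Omega>s k"
        then obtain y where "y \<notin> \<Omega>" "dist x y < d" using hausdorff_compl_near(1)[OF D(1,2,3) elim] by metis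
        then show False using d(2)[OF x] by force
      qed
    qed
    then show ?case using K test_Ck[OF \<psi>] by (intro test_functionsI[of \<psi> K]) auto
  qed
qed

context convex_young
begin

section \<open>Measurability of the nonlinear terms\<close>

lemma measurable_phi:
  assumes "h \<in> borel_measurable M" shows "(\<lambda>x. \<phi> (norm (h x))) \<in> borel_measurable M"
proof -
  have "continuous_on UNIV (\<lambda>t::real. \<phi> (norm t))"
    by (rule continuous_on_compose2[OF continuous_on_phi]) (auto intro: continuous_intros)
  then have "(\<lambda>t::real. \<phi> (norm t)) \<in> borel_measurable borel" by (rule borel_measurable_continuous_onI)
  moreover have "(\<lambda>x. norm (h x)) \<in> borel_measurable M" using assms by simp
  ultimately show ?thesis using measurable_compose[of "\<lambda>x. norm (h x)" M borel "\<lambda>t. \<phi> (norm t)"] by simp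
qed

lemma measurable_flux:
  assumes "G \<in> borel_measurable M" shows "(\<lambda>x. flux \<phi> (G x)) \<in> borel_measurable M"
  unfolding flux_def using measurable_phi[OF assms] assms
  by (intro borel_measurable_scaleR borel_measurable_divide) auto

lemma young_conj_nonneg: "0 \<le> t \<Longrightarrow> 0 \<le> young_conj \<Phi> t"
  using young_ineq[of t 0] by simp

lemma young_conj_mono: assumes "0 \<le> s" "s \<le> t" shows "young_conj \<Phi> s \<le> young_conj \<Phi> t"
  unfolding young_conj_def
proof (rule cSUP_mono)
  show "\<exists>m\<in>{0<..}. s * n - \<Phi> n \<le> t * m - \<Phi> m" if "n \<in> {0<..}" for n
    using that assms by (intro bexI[of _ n]) auto
qed (use conj_bdd[of t] assms in \<open>auto intro: gt_ex\<close>)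

text \<open>Monotone functions are Borel; precomposition with \<open>max 0\<close> extends
  monotonicity to the whole line.\<close>

lemma measurable_young_conj:
  assumes "h \<in> borel_measurable M" shows "(\<lambda>x. young_conj \<Phi> \<bar>h x\<bar>) \<in> borel_measurable M"
proof -
  have "mono (\<lambda>t. young_conj \<Phi> (max 0 t))" by (rule monoI) (auto intro!: young_conj_mono)
  then have "(\<lambda>t. young_conj \<Phi> (max 0 t)) \<in> borel_measurable borel" by (rule borel_measurable_mono)
  moreover have "(\<lambda>x. \<bar>h x\<bar>) \<in> borel_measurable M" using assms by simp
  ultimately show ?thesis using measurable_compose[of "\<lambda>x. \<bar>h x\<bar>" M borel "\<lambda>t. young_conj \<Phi> (max 0 t)"] by simp
qed

end

section \<open>Energies of weak solutions\<close>

locale dirichlet_data = convex_young \<Phi> \<phi> pp for \<Phi> \<phi> :: "real \<Rightarrow> real" and pp :: real +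
  fixes D :: "(real^'n) set" and f :: "real^'n \<Rightarrow> real"
  assumes open_D: "open D" and bounded_D: "bounded D"
    and f_orlicz: "f \<in> orlicz (young_conj \<Phi>) D"
    and embedding: "set_integrable lborel {1..} (\<lambda>t. PhiInv t / t powr (1 + 1 / real CARD('n)))"
begin

section \<open>Pairing with the datum\<close>

definition F :: "real^'n \<Rightarrow> real" where "F x = indicator D x *\<^sub>R f x"

text \<open>The integrable first term in Young's inequality for the datum, see
  \<open>F_young\<close>.\<close>

definition Y :: "real^'n \<Rightarrow> real" where "Y x = indicator D x *\<^sub>R young_conj \<Phi> \<bar>f x\<bar>"

lemma D_sets: "D \<in> sets lebesgue" and D_lmeasurable: "D \<in> lmeasurable"
  using open_D bounded_D lmeasurable_open by auto

lemma F_measurable: "F \<in> borel_measurable lebesgue"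
  using f_orlicz D_sets unfolding orlicz_def F_def[abs_def] by (auto simp: borel_measurable_restrict_space_iff)

lemma Y_integrable: "integrable lebesgue Y" and Y_nonneg: "0 \<le> Y x"
proof -
  have fm: "f \<in> borel_measurable (lebesgue_on D)" using f_orlicz by (simp add: orlicz_def)
  have "integrable (lebesgue_on D) (\<lambda>x. young_conj \<Phi> \<bar>f x\<bar>)"
    using f_orlicz measurable_young_conj[OF fm]
    by (intro integrableI_nonneg) (auto simp: orlicz_def young_conj_nonneg)
  then show "integrable lebesgue Y" unfolding Y_def[abs_def] using D_sets by (subst (asm) integrable_restrict_space) auto
  show "0 \<le> Y x" by (simp add: Y_def young_conj_nonneg)
qed

lemma F_young: "0 \<le> t \<Longrightarrow> \<bar>F x\<bar> * t \<le> Y x + \<Phi> t"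
  using young_ineq[of "\<bar>f x\<bar>" t] Phi_nonneg[of t] by (auto simp: F_def Y_def indicator_def)

text \<open>Young's inequality at \<open>t = 1\<close>, integrated over the bounded set
  \<open>D\<close>. The resulting L1 norm is what multiplies sup bounds in the energy
  estimates.\<close>

lemma F_integrable: "integrable lebesgue F"
proof (rule Bochner_Integration.integrable_bound[OF _ F_measurable])
  show "integrable lebesgue (\<lambda>x. Y x + \<Phi> 1 * indicator D x)"
    using Y_integrable D_lmeasurable by (auto simp: fmeasurable_def)
  have "\<bar>F x\<bar> \<le> Y x + \<Phi> 1 * indicator D x" for x
    using F_young[of 1 x] Y_nonneg[of x] by (auto simp: F_def indicator_def)
  then show "AE x in lebesgue. norm (F x) \<le> norm (Y x + \<Phi> 1 * indicator D x)"
    by (intro AE_I2) (metis abs_ge_self order_trans real_norm_def)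
qed

lemma F_mult_integrable: assumes "Lphi V" shows "integrable lebesgue (\<lambda>x. F x * V x)"
proof (rule Bochner_Integration.integrable_bound)
  show "integrable lebesgue (\<lambda>x. Y x + \<Phi> (norm (V x)))" using Y_integrable assms by (auto simp: Lphi_def)
  show "(\<lambda>x. F x * V x) \<in> borel_measurable lebesgue"
    using F_measurable assms by (auto simp: Lphi_def)
  show "AE x in lebesgue. norm (F x * V x) \<le> norm (Y x + \<Phi> (norm (V x)))"
  proof (intro AE_I2)
    fix x show "norm (F x * V x) \<le> norm (Y x + \<Phi> (norm (V x)))"
      using F_young[of "norm (V x)" x] by (simp add: abs_mult)
  qed
qed

text \<open>Young's inequality is applied to \<open>h / e\<close> and multiplied by
  \<open>e\<close>. The datum then contributes \<open>e * Y\<close>, small by the choice of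
  \<open>e\<close>; doubling absorbs the factor \<open>1 / e\<close>, and \<open>\<delta>\<close> is
  chosen last.\<close>

lemma F_mult_small:
  assumes "\<epsilon> > 0"
  shows "\<exists>\<delta>>0. \<forall>h. Lphi h \<and> rho h < \<delta> \<longrightarrow> \<bar>\<integral>x. F x * h x \<partial>lebesgue\<bar> < \<epsilon>"
proof -
  define I where "I = integral\<^sup>L lebesgue Y"
  have I: "I \<ge> 0" unfolding I_def by (intro integral_nonneg_AE AE_I2 Y_nonneg)
  obtain e where e: "e > 0" and eI: "e * I \<le> \<epsilon> / 2"
    using small_factor[OF I, of "\<epsilon> / 2"] assms by (metis half_gt_zero)
  obtain K where K: "K > 0" "\<And>t. t \<ge> 0 \<Longrightarrow> \<Phi> (1 / e * t) \<le> K * \<Phi> t" using Phi_mult_bound[of "1 / e"] e by auto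
  define \<delta> where "\<delta> = \<epsilon> / (2 * e * K)"
  have "\<bar>\<integral>x. F x * h x \<partial>lebesgue\<bar> < \<epsilon>" if h: "Lphi h" "rho h < \<delta>" for h
  proof -
    have hi: "integrable lebesgue (\<lambda>x. \<Phi> (norm (h x)))" using h by (simp add: Lphi_def)
    have "\<bar>\<integral>x. F x * h x \<partial>lebesgue\<bar> \<le> (\<integral>x. e * Y x + e * K * \<Phi> (norm (h x)) \<partial>lebesgue)"
    proof (rule order_trans[OF integral_abs_bound], rule integral_mono)
      show "integrable lebesgue (\<lambda>x. \<bar>F x * h x\<bar>)" by (intro integrable_abs F_mult_integrable h)
      show "integrable lebesgue (\<lambda>x. e * Y x + e * K * \<Phi> (norm (h x)))" using Y_integrable hi by auto
      fix x
      have "\<bar>F x * h x\<bar> = e * (\<bar>F x\<bar> * (1 / e * \<bar>h x\<bar>))" using e by (simp add: abs_mult)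
      also have "\<dots> \<le> e * (Y x + \<Phi> (1 / e * \<bar>h x\<bar>))" using e by (intro mult_left_mono F_young) auto
      also have "\<dots> \<le> e * (Y x + K * \<Phi> (norm (h x)))" using e K(2)[of "\<bar>h x\<bar>"] by (intro mult_left_mono add_left_mono) auto
      finally show "\<bar>F x * h x\<bar> \<le> e * Y x + e * K * \<Phi> (norm (h x))" by (simp add: algebra_simps)
    qed
    also have "\<dots> = e * I + e * K * rho h" using Y_integrable hi by (simp add: I_def rho_def)
    also have "\<dots> < \<epsilon> / 2 + e * K * \<delta>" using eI h e K by (intro add_le_less_mono mult_strict_left_mono) auto
    also have "\<dots> = \<epsilon>" using e K by (simp add: \<delta>_def)
    finally show ?thesis .
  qed
  moreover have "\<delta> > 0" using assms e K by (simp add: \<delta>_def)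
  ultimately show ?thesis by blast
qed

section \<open>The energy and its minimisers\<close>

definition J :: "(real^'n \<Rightarrow> real) \<Rightarrow> (real^'n \<Rightarrow> real^'n) \<Rightarrow> real" where
  "J U G = rho G - (\<integral>x. F x * U x \<partial>lebesgue)"

lemma flux_integrable:
  assumes "Lphi G" "Lphi H" shows "integrable lebesgue (\<lambda>x. flux \<phi> (G x) \<bullet> H x)"
proof (rule Bochner_Integration.integrable_bound)
  show "integrable lebesgue (\<lambda>x. Kd * (\<Phi> (norm (G x)) + \<Phi> (norm (H x))))" using assms by (auto simp: Lphi_def)
  show "(\<lambda>x. flux \<phi> (G x) \<bullet> H x) \<in> borel_measurable lebesgue"
    using assms unfolding Lphi_def by (intro borel_measurable_inner measurable_flux) auto
  have "norm (flux \<phi> (G x) \<bullet> H x) \<le> Kd * (\<Phi> (norm (G x)) + \<Phi> (norm (H x)))" for x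
    using Cauchy_Schwarz_ineq2[of "flux \<phi> (G x)" "H x"] phi_mult_le[of "norm (G x)" "norm (H x)"] by simp
  then show "AE x in lebesgue. norm (flux \<phi> (G x) \<bullet> H x) \<le> norm (Kd * (\<Phi> (norm (G x)) + \<Phi> (norm (H x))))"
    by (intro AE_I2) (metis abs_ge_self order_trans real_norm_def)
qed

text \<open>\<open>Phi_flux_uniform\<close> is integrated with \<open>a = G x\<close> and
  \<open>b = H x\<close>. The flux term is the weak equation tested with competitor minus solution,
  so it equals the difference of the linear terms.\<close>

lemma weak_solution_energy:
  fixes u :: "real^'n \<Rightarrow> real"
  assumes E: "open E" "E \<subseteq> D" and u: "weak_solution \<Phi> \<phi> E f u" and W: "W0pair E V H"
  defines "U \<equiv> \<lambda>x. indicator E x *\<^sub>R u x" and "G \<equiv> \<lambda>x. indicator E x *\<^sub>R weak_gradient E u x"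
  shows "J U G + 2 * rho (\<lambda>x. (1/2) *\<^sub>R (H x - G x)) \<le> J V H"
proof -
  have m: "E \<in> sets lebesgue" "E \<inter> space lebesgue \<in> sets lebesgue" using E(1) by auto
  have uW: "u \<in> W1_0 \<Phi> E" using u by (simp add: weak_solution_def)
  have W0: "W0pair E U G" unfolding U_def G_def by (rule W1_0_imp_W0pair(2)[OF E(1) uW])
  note L = W0pair_Lphi[OF W0] W0pair_Lphi[OF W]
  define v where "v x = V x - U x" for x
  define k where "k x = H x - G x" for x
  have Wv: "W0pair E v k" unfolding v_def[abs_def] k_def[abs_def] by (rule W0pair_diff[OF W W0])
  note Lv = W0pair_Lphi[OF Wv]
  have vW: "v \<in> W1_0 \<Phi> E" by (rule W0pair_imp_W1_0[OF Wv E(1) subset_refl])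
  have eq: "(\<integral>x. flux \<phi> (weak_gradient E u x) \<bullet> weak_gradient E v x \<partial>lebesgue_on E) = (\<integral>x. f x * v x \<partial>lebesgue_on E)"
    using u vW by (simp add: weak_solution_def)
  have hv: "has_weak_gradient E v (weak_gradient E v)" "AE x in lebesgue. x \<in> E \<longrightarrow> weak_gradient E v x = k x"
    using weak_gradient_AE[OF E(1) W0pair_weak_gradient[OF Wv E(1)]] by auto
  have um: "weak_gradient E u \<in> borel_measurable (lebesgue_on E)"
    using W1_0_imp_W0pair(1)[OF E(1) uW] by (simp add: has_weak_gradient_def)
  have vm: "weak_gradient E v \<in> borel_measurable (lebesgue_on E)"
    using hv(1) by (simp add: has_weak_gradient_def)
  \<comment> \<open>The weak equation is moved to the whole space: off \<open>E\<close> the flux of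
    \<open>G\<close> vanishes, and on \<open>E\<close> the chosen gradient of \<open>v\<close> is
    \<open>k\<close> almost everywhere.\<close>
  have "(\<integral>x. flux \<phi> (weak_gradient E u x) \<bullet> weak_gradient E v x \<partial>lebesgue_on E)
      = (\<integral>x. indicator E x *\<^sub>R (flux \<phi> (weak_gradient E u x) \<bullet> weak_gradient E v x) \<partial>lebesgue)"
    by (rule integral_restrict_space[OF m(2)])
  also have "\<dots> = (\<integral>x. flux \<phi> (G x) \<bullet> k x \<partial>lebesgue)"
  proof (rule integral_cong_AE)
    have "(\<lambda>x. flux \<phi> (weak_gradient E u x) \<bullet> weak_gradient E v x) \<in> borel_measurable (lebesgue_on E)"
      by (intro borel_measurable_inner measurable_flux um vm)
    then show "(\<lambda>x. indicator E x *\<^sub>R (flux \<phi> (weak_gradient E u x) \<bullet> weak_gradient E v x)) \<in> borel_measurable lebesgue"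
      by (rule borel_measurable_restrict_space_iff[OF m(2), THEN iffD1])
    show "(\<lambda>x. flux \<phi> (G x) \<bullet> k x) \<in> borel_measurable lebesgue" using flux_integrable[OF L(2) Lv(2)] by auto
    show "AE x in lebesgue. indicator E x *\<^sub>R (flux \<phi> (weak_gradient E u x) \<bullet> weak_gradient E v x) = flux \<phi> (G x) \<bullet> k x"
      using hv(2) by eventually_elim (auto simp: G_def indicator_def flux_def)
  qed
  finally have lhs: "(\<integral>x. flux \<phi> (weak_gradient E u x) \<bullet> weak_gradient E v x \<partial>lebesgue_on E) = (\<integral>x. flux \<phi> (G x) \<bullet> k x \<partial>lebesgue)" .
  have fF: "indicator E x *\<^sub>R (f x * v x) = F x * v x" for x
    using W0pair_outside(1)[OF Wv, of x] E(2) by (auto simp: F_def indicator_def)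
  have rhs: "(\<integral>x. f x * v x \<partial>lebesgue_on E) = (\<integral>x. F x * v x \<partial>lebesgue)"
    using integral_restrict_space[OF m(2), of "\<lambda>x. f x * v x"] unfolding fF .
  have key: "(\<integral>x. flux \<phi> (G x) \<bullet> k x \<partial>lebesgue) = (\<integral>x. F x * V x \<partial>lebesgue) - (\<integral>x. F x * U x \<partial>lebesgue)"
    using eq F_mult_integrable[OF L(3)] F_mult_integrable[OF L(1)]
    unfolding lhs rhs by (simp add: v_def right_diff_distrib)
  have Lk: "Lphi (\<lambda>x. (1/2) *\<^sub>R k x)" by (rule Lphi_scaleR[OF Lv(2)])
  have "(\<integral>x. \<Phi> (norm (G x)) + flux \<phi> (G x) \<bullet> k x + 2 * \<Phi> (norm ((1/2) *\<^sub>R k x)) \<partial>lebesgue) \<le> rho H"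
    unfolding rho_def
  proof (rule integral_mono)
    show "integrable lebesgue (\<lambda>x. \<Phi> (norm (G x)) + flux \<phi> (G x) \<bullet> k x + 2 * \<Phi> (norm ((1/2) *\<^sub>R k x)))"
      using L(2) flux_integrable[OF L(2) Lv(2)] Lk unfolding Lphi_def
      by (intro Bochner_Integration.integrable_add integrable_mult_right) auto
    show "integrable lebesgue (\<lambda>x. \<Phi> (norm (H x)))" using L(4) by (simp add: Lphi_def)
    show "\<Phi> (norm (G x)) + flux \<phi> (G x) \<bullet> k x + 2 * \<Phi> (norm ((1/2) *\<^sub>R k x)) \<le> \<Phi> (norm (H x))" for x
      unfolding k_def by (rule Phi_flux_uniform)
  qed
  also have "(\<integral>x. \<Phi> (norm (G x)) + flux \<phi> (G x) \<bullet> k x + 2 * \<Phi> (norm ((1/2) *\<^sub>R k x)) \<partial>lebesgue)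
      = rho G + (\<integral>x. flux \<phi> (G x) \<bullet> k x \<partial>lebesgue) + 2 * rho (\<lambda>x. (1/2) *\<^sub>R k x)"
    using L(2) flux_integrable[OF L(2) Lv(2)] Lk unfolding Lphi_def rho_def
    by (subst Bochner_Integration.integral_add Bochner_Integration.integral_mult_right_zero; auto)+
  finally show ?thesis using key unfolding J_def k_def by linarith
qed

text \<open>\<open>Phi_perturb\<close> bounds the gradient energy of an approximant by that of
  \<open>G\<close> with a factor near 1, and \<open>F_mult_small\<close> handles the linear term.
  One and the same \<open>\<psi>\<close> is close and has small energy excess.\<close>

lemma energy_approx:
  assumes W: "W0pair E U G" and \<delta>: "\<delta> > 0"
  obtains \<psi> where "\<psi> \<in> test_functions E" "Lphi (\<lambda>x. U x - \<psi> x)" "rho (\<lambda>x. U x - \<psi> x) < \<delta>"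
    "Lphi (\<lambda>x. G x - grad \<psi> x)" "rho (\<lambda>x. G x - grad \<psi> x) < \<delta>" "J \<psi> (grad \<psi>) \<le> J U G + \<delta>"
proof -
  note L = W0pair_Lphi[OF W]
  obtain d where d: "0 < d" "d < 1" and dr: "d * rho G \<le> \<delta> / 3"
    using small_factor[OF rho_nonneg, of "\<delta> / 3"] \<delta> by auto
  obtain K where K: "K > 0" "\<And>a h. a \<ge> 0 \<Longrightarrow> h \<ge> 0 \<Longrightarrow> \<Phi> (a + h) \<le> (1 + d) * \<Phi> a + K * \<Phi> h"
    using Phi_perturb[OF d] by blast
  obtain \<delta>1 where \<delta>1: "\<delta>1 > 0" "\<And>h. Lphi h \<Longrightarrow> rho h < \<delta>1 \<Longrightarrow> \<bar>\<integral>x. F x * h x \<partial>lebesgue\<bar> < \<delta> / 3"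
    using F_mult_small[of "\<delta> / 3"] \<delta> by auto
  \<comment> \<open>Three losses of at most \<open>\<delta> / 3\<close> each: the factor
    \<open>1 + d\<close>, the gradient error times \<open>K\<close>, and the linear term.\<close>
  define m where "m = min \<delta> (min \<delta>1 (\<delta> / (3 * K)))"
  have m: "m > 0" "m \<le> \<delta>" "m \<le> \<delta>1" "m \<le> \<delta> / (3 * K)" using \<delta> \<delta>1 K by (auto simp: m_def)
  obtain \<psi> where \<psi>: "\<psi> \<in> test_functions E" "Lphi (\<lambda>x. U x - \<psi> x)" "rho (\<lambda>x. U x - \<psi> x) < m"
    "Lphi (\<lambda>x. G x - grad \<psi> x)" "rho (\<lambda>x. G x - grad \<psi> x) < m" using W0pairE[OF W m(1)] by blast
  note Lp = test_Lphi[OF \<psi>(1)]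
  have "rho (grad \<psi>) \<le> (\<integral>x. (1 + d) * \<Phi> (norm (G x)) + K * \<Phi> (norm (G x - grad \<psi> x)) \<partial>lebesgue)"
  proof (rule Lphi_bound(2))
    show "grad \<psi> \<in> borel_measurable lebesgue" using Lp by (simp add: Lphi_def)
    show "integrable lebesgue (\<lambda>x. (1 + d) * \<Phi> (norm (G x)) + K * \<Phi> (norm (G x - grad \<psi> x)))"
      using L(2) \<psi>(4) by (auto simp: Lphi_def)
    fix x
    have "norm (grad \<psi> x) \<le> norm (G x) + norm (G x - grad \<psi> x)"
      using norm_triangle_ineq4[of "G x" "G x - grad \<psi> x"] by simp
    then have "\<Phi> (norm (grad \<psi> x)) \<le> \<Phi> (norm (G x) + norm (G x - grad \<psi> x))" by (intro Phi_mono) auto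
    also have "\<dots> \<le> (1 + d) * \<Phi> (norm (G x)) + K * \<Phi> (norm (G x - grad \<psi> x))" by (intro K(2)) auto
    finally show "\<Phi> (norm (grad \<psi> x)) \<le> (1 + d) * \<Phi> (norm (G x)) + K * \<Phi> (norm (G x - grad \<psi> x))" .
  qed
  also have "\<dots> = (1 + d) * rho G + K * rho (\<lambda>x. G x - grad \<psi> x)"
    using L(2) \<psi>(4) by (simp add: Lphi_def rho_def)
  also have "\<dots> \<le> rho G + 2 * \<delta> / 3"
  proof -
    have "K * rho (\<lambda>x. G x - grad \<psi> x) \<le> K * (\<delta> / (3 * K))" using \<psi>(5) m K by (intro mult_left_mono) auto
    then show ?thesis using dr K(1) by (simp add: algebra_simps)
  qed
  finally have 1: "rho (grad \<psi>) \<le> rho G + 2 * \<delta> / 3" .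
  have "(\<integral>x. F x * U x \<partial>lebesgue) - (\<integral>x. F x * \<psi> x \<partial>lebesgue) = (\<integral>x. F x * (U x - \<psi> x) \<partial>lebesgue)"
    using F_mult_integrable[OF L(1)] F_mult_integrable[OF Lp(1)] by (simp add: right_diff_distrib)
  moreover have "\<bar>\<integral>x. F x * (U x - \<psi> x) \<partial>lebesgue\<bar> < \<delta> / 3" using \<delta>1(2)[OF \<psi>(2)] \<psi>(3) m by simp
  ultimately have "J \<psi> (grad \<psi>) \<le> J U G + \<delta>" using 1 unfolding J_def by linarith
  then show thesis using \<psi> m by (intro that[of \<psi>]) auto
qed

text \<open>The linear term is at most the L1 norm of \<open>F\<close> times the sup of
  \<open>\<psi>\<close>, so it grows like the square root of the modular and is dominated by it.
  Level 1 suffices because the zero function has energy 0 and approximants of minimisers exceed that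
  by at most 1.\<close>

lemma energy_bound:
  obtains M where "M \<ge> 1" "\<And>\<psi>. \<psi> \<in> test_functions D \<Longrightarrow> J \<psi> (grad \<psi>) \<le> 1 \<Longrightarrow> rho (grad \<psi>) \<le> M"
proof -
  obtain C where C: "C > 0"
    "\<And>(\<psi> :: real^'n \<Rightarrow> real) x M. \<psi> \<in> test_functions D \<Longrightarrow> M \<ge> 1 \<Longrightarrow> rho (grad \<psi>) \<le> M \<Longrightarrow> \<bar>\<psi> x\<bar> \<le> C * sqrt M"
    using sup_bound[OF embedding bounded_D] by blast
  define N where "N = (\<integral>x. \<bar>F x\<bar> \<partial>lebesgue)"
  have N: "N \<ge> 0" by (simp add: N_def)
  define c where "c = C * N"
  have c: "c \<ge> 0" using C N by (simp add: c_def)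
  have "rho (grad \<psi>) \<le> (1 + c)\<^sup>2" if \<psi>: "\<psi> \<in> test_functions D" and J1: "J \<psi> (grad \<psi>) \<le> 1" for \<psi>
  proof (cases "rho (grad \<psi>) \<le> 1")
    case True
    then show ?thesis using c by (smt (verit) one_le_power)
  next
    case False
    define s where "s = sqrt (rho (grad \<psi>))"
    have s: "s \<ge> 1" "s\<^sup>2 = rho (grad \<psi>)" using False by (auto simp: s_def)
    have b: "\<bar>\<psi> x\<bar> \<le> C * s" for x unfolding s_def by (rule C(2)[OF \<psi>]) (use False in auto)
    have "(\<integral>x. F x * \<psi> x \<partial>lebesgue) \<le> (\<integral>x. (C * s) * \<bar>F x\<bar> \<partial>lebesgue)"
    proof (rule integral_mono)
      show "integrable lebesgue (\<lambda>x. F x * \<psi> x)" by (rule F_mult_integrable[OF test_Lphi(1)[OF \<psi>]])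
      show "integrable lebesgue (\<lambda>x. (C * s) * \<bar>F x\<bar>)" using F_integrable by auto
      fix x
      have "F x * \<psi> x \<le> \<bar>F x\<bar> * \<bar>\<psi> x\<bar>" by (simp flip: abs_mult)
      also have "\<dots> \<le> \<bar>F x\<bar> * (C * s)" using b by (intro mult_left_mono) auto
      finally show "F x * \<psi> x \<le> (C * s) * \<bar>F x\<bar>" by (simp add: mult.commute)
    qed
    also have "\<dots> = c * s" by (simp add: N_def c_def)
    finally have "s\<^sup>2 \<le> 1 + c * s" using J1 s(2) unfolding J_def by linarith
    \<comment> \<open>The constant 1 is absorbed using \<open>s \<ge> 1\<close>.\<close>
    then have "s * s \<le> s * (1 + c)" using s(1) by (simp add: power2_eq_square algebra_simps)
    then have "s \<le> 1 + c" using s(1) by simp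
    then have "s\<^sup>2 \<le> (1 + c)\<^sup>2" using s(1) by (intro power_mono) auto
    then show ?thesis using s(2) by simp
  qed
  moreover have "(1 + c)\<^sup>2 \<ge> 1" using c by (intro one_le_power) auto
  ultimately show thesis using that by blast
qed

text \<open>If the modular of the gradient is tiny, that of \<open>\<psi> / t\<close> is still at
  most 1, so the sup bound gives \<open>\<bar>\<psi> x\<bar> \<le> t * C\<close>; over the bounded
  set \<open>D\<close> the modular is then at most \<open>t * \<Phi> C\<close> times the
  measure.\<close>

lemma poincare_small:
  assumes \<epsilon>: "\<epsilon> > 0"
  obtains s where "s > 0" "\<And>\<psi>. \<psi> \<in> test_functions D \<Longrightarrow> rho (grad \<psi>) \<le> s \<Longrightarrow> rho \<psi> \<le> \<epsilon>"
proof -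
  obtain C where C: "C > 0"
    "\<And>(\<psi> :: real^'n \<Rightarrow> real) x M. \<psi> \<in> test_functions D \<Longrightarrow> M \<ge> 1 \<Longrightarrow> rho (grad \<psi>) \<le> M \<Longrightarrow> \<bar>\<psi> x\<bar> \<le> C * sqrt M"
    using sup_bound[OF embedding bounded_D] by blast
  define A where "A = \<Phi> C * measure lebesgue D"
  have A: "A \<ge> 0" using C by (simp add: A_def Phi_nonneg)
  obtain t where t: "0 < t" "t < 1" and tA: "t * A \<le> \<epsilon>" using small_factor[OF A \<epsilon>] by blast
  obtain K where K: "K > 0" "\<And>h :: real^'n \<Rightarrow> real^'n. Lphi h \<Longrightarrow> rho (\<lambda>x. (1 / t) *\<^sub>R h x) \<le> K * rho h"
    using rho_scale[of "1 / t"] t by force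
  have "rho \<psi> \<le> \<epsilon>" if \<psi>: "\<psi> \<in> test_functions D" and r: "rho (grad \<psi>) \<le> 1 / K" for \<psi>
  proof -
    have g: "grad (\<lambda>x. 1 / t * \<psi> x) = (\<lambda>x. (1 / t) *\<^sub>R grad \<psi> x)" using grad_cmult[OF \<psi>] by blast
    have "rho (\<lambda>x. (1 / t) *\<^sub>R grad \<psi> x) \<le> K * rho (grad \<psi>)" by (rule K(2)[OF test_Lphi(2)[OF \<psi>]])
    also have "\<dots> \<le> K * (1 / K)" using r K(1) by (intro mult_left_mono) auto
    finally have "rho (grad (\<lambda>x. 1 / t * \<psi> x)) \<le> 1" using K(1) unfolding g by simp
    then have "\<bar>1 / t * \<psi> x\<bar> \<le> C" for x
      using C(2)[OF test_cmult[OF \<psi>, of "1 / t"], of 1 x] by simp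
    then have b: "\<bar>\<psi> x\<bar> \<le> t * C" for x using t(1) by (simp add: abs_mult field_simps)
    have "rho \<psi> \<le> (\<integral>x. (t * \<Phi> C) * indicator D x \<partial>lebesgue)"
    proof (rule Lphi_bound(2))
      show "\<psi> \<in> borel_measurable lebesgue" by (rule test_measurable[OF \<psi>])
      show "integrable lebesgue (\<lambda>x. (t * \<Phi> C) * indicator D x)" using D_lmeasurable by (auto simp: fmeasurable_def)
      fix x
      have "\<Phi> (norm (\<psi> x)) \<le> \<Phi> (t * C)" using b by (intro Phi_mono) auto
      also have "\<dots> \<le> t * \<Phi> C" using t C by (intro Phi_scale_le) auto
      finally show "\<Phi> (norm (\<psi> x)) \<le> (t * \<Phi> C) * indicator D x"
        using test_outside[OF \<psi>, of x] by (auto simp: indicator_def)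
    qed
    also have "\<dots> = t * A" by (simp add: A_def)
    finally show ?thesis using tA by linarith
  qed
  then show thesis using K(1) by (intro that[of "1 / K"]) auto
qed

lemma solutions_converge:
  fixes \<Omega> :: "(real^'n) set" and \<Omega>s :: "nat \<Rightarrow> (real^'n) set" and u us
  assumes \<Omega>s: "\<And>k. open (\<Omega>s k)" "\<And>k. \<Omega>s k \<subseteq> D" and \<Omega>: "open \<Omega>" "\<Omega> \<subseteq> D"
    and lim: "(\<lambda>k. hausdorff_compl_dist (\<Omega>s k) \<Omega>) \<longlonglongrightarrow> 0"
    and us: "\<And>k. weak_solution \<Phi> \<phi> (\<Omega>s k) f (us k)" and u: "weak_solution \<Phi> \<phi> \<Omega> f u"
    and \<epsilon>: "\<epsilon> > 0"
  defines "U \<equiv> \<lambda>x. indicator \<Omega> x *\<^sub>R u x" and "G \<equiv> \<lambda>x. indicator \<Omega> x *\<^sub>R weak_gradient \<Omega> u x"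
    and "Us \<equiv> \<lambda>k x. indicator (\<Omega>s k) x *\<^sub>R us k x" and "Gs \<equiv> \<lambda>k x. indicator (\<Omega>s k) x *\<^sub>R weak_gradient (\<Omega>s k) (us k) x"
  shows "eventually (\<lambda>k. rho (\<lambda>x. Us k x - U x) \<le> \<epsilon> \<and> rho (\<lambda>x. Gs k x - G x) \<le> \<epsilon>) sequentially"
proof -
  have W: "W0pair \<Omega> U G"
    unfolding U_def G_def by (rule W1_0_imp_W0pair(2)[OF \<Omega>(1)]) (use u in \<open>simp add: weak_solution_def\<close>)
  have Ws: "W0pair (\<Omega>s k) (Us k) (Gs k)" for k
    unfolding Us_def Gs_def by (rule W1_0_imp_W0pair(2)[OF \<Omega>s(1)]) (use us in \<open>simp add: weak_solution_def\<close>)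
  have min: "J U G + 2 * rho (\<lambda>x. (1/2) *\<^sub>R (H x - G x)) \<le> J V H" if "W0pair \<Omega> V H" for V H
    unfolding U_def G_def by (rule weak_solution_energy[OF \<Omega> u that])
  have mins: "J (Us k) (Gs k) + 2 * rho (\<lambda>x. (1/2) *\<^sub>R (H x - Gs k x)) \<le> J V H" if "W0pair (\<Omega>s k) V H" for V H k
    unfolding Us_def Gs_def by (rule weak_solution_energy[OF \<Omega>s us that])
  obtain M where M: "M \<ge> 1" "\<And>\<psi>. \<psi> \<in> test_functions D \<Longrightarrow> J \<psi> (grad \<psi>) \<le> 1 \<Longrightarrow> rho (grad \<psi>) \<le> M"
    using energy_bound by blast
  obtain \<omega> :: "nat \<Rightarrow> real" where \<omega>: "\<omega> \<longlonglongrightarrow> 0" "\<And>J. 0 \<le> \<omega> J"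
    "\<And>\<Omega> (\<psi> :: real^'n \<Rightarrow> real) J x y M. \<psi> \<in> test_functions \<Omega> \<Longrightarrow> M \<ge> 1 \<Longrightarrow> rho (grad \<psi>) \<le> M \<Longrightarrow>
       norm (x - y) \<le> (1/2) ^ J \<Longrightarrow> \<bar>\<psi> x - \<psi> y\<bar> \<le> sqrt M * \<omega> J"
  proof (rule morrey_modulus_scaled[OF embedding], goal_cases)
    case (1 \<omega>)
    show ?case by (rule 1(1)[OF 1(2,3) 1(4)])
  qed
  obtain K2 where K2: "K2 > 0" "\<And>h :: real^'n \<Rightarrow> real^'n. Lphi h \<Longrightarrow> rho (\<lambda>x. 2 *\<^sub>R h x) \<le> K2 * rho h"
    using rho_scale[of 2] by force
  define N where "N = (\<integral>x. \<bar>F x\<bar> \<partial>lebesgue)"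
  have N: "N \<ge> 0" by (simp add: N_def)
  \<comment> \<open>Balances the final triangle inequality: two errors \<open>\<epsilon>1\<close>
    with loss \<open>Kd * Kd\<close> and one error \<open>\<epsilon> / (4 * Kd)\<close> with loss
    \<open>Kd\<close> add up to \<open>\<epsilon> / 2 + \<epsilon> / 4\<close>.\<close>
  define \<epsilon>1 where "\<epsilon>1 = \<epsilon> / (4 * Kd * Kd)"
  have \<epsilon>1: "\<epsilon>1 > 0" using \<epsilon> Kd_pos by (simp add: \<epsilon>1_def)
  obtain s where s: "s > 0" "\<And>\<psi>. \<psi> \<in> test_functions D \<Longrightarrow> rho (grad \<psi>) \<le> s \<Longrightarrow> rho \<psi> \<le> \<epsilon>1"
    using poincare_small[OF \<epsilon>1] by blast
  \<comment> \<open>\<open>2 * K2 * \<delta>\<close> will bound the distance of the gradients of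
    \<open>\<psi>\<close> and of the solution on \<open>\<Omega>s k\<close>; adding an approximation
    error \<open>\<delta>\<close> costs the factor \<open>Kd\<close>.\<close>
  define c where "c = Kd * (1 + 2 * K2)"
  have c: "c > 0" using Kd_pos K2(1) by (simp add: c_def)
  \<comment> \<open>In turn: energy of the approximants at most 1, the threshold of the Poincare
    estimate, the final gradient bound, and the errors of the two approximants as functions.\<close>
  define \<delta> where "\<delta> = Min {1, s / c, \<epsilon> / c, \<epsilon>1, \<epsilon> / (4 * Kd)}"
  have \<delta>: "\<delta> > 0" "\<delta> \<le> 1" "\<delta> \<le> s / c" "\<delta> \<le> \<epsilon> / c" "\<delta> \<le> \<epsilon>1" "\<delta> \<le> \<epsilon> / (4 * Kd)"
    using s(1) c \<epsilon> \<epsilon>1 Kd_pos by (auto simp: \<delta>_def)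
  have c\<delta>: "c * \<delta> \<le> s" "c * \<delta> \<le> \<epsilon>" using \<delta>(3,4) c by (auto simp: field_simps)
  obtain \<psi> where \<psi>: "\<psi> \<in> test_functions \<Omega>" "Lphi (\<lambda>x. U x - \<psi> x)" "rho (\<lambda>x. U x - \<psi> x) < \<delta>"
    "Lphi (\<lambda>x. G x - grad \<psi> x)" "rho (\<lambda>x. G x - grad \<psi> x) < \<delta>" "J \<psi> (grad \<psi>) \<le> J U G + \<delta>"
    using energy_approx[OF W \<delta>(1)] by blast
  \<comment> \<open>Order of choices: \<open>e\<close> bounds the truncation cost
    \<open>2 * e * N\<close>, then the scale \<open>j\<close> brings the oscillation below
    \<open>e\<close>, and only then is \<open>k\<close> taken large.\<close>
  obtain e where e: "e > 0" and "e * (2 * N) \<le> \<delta>" using small_factor[of "2 * N" \<delta>] N \<delta>(1) by auto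
  then have eN: "2 * e * N \<le> \<delta>" by (simp add: ac_simps)
  have "eventually (\<lambda>j. sqrt M * \<omega> j < e) sequentially"
  proof (rule order_tendstoD(2))
    show "(\<lambda>j. sqrt M * \<omega> j) \<longlonglongrightarrow> 0" by (rule tendsto_mult_right_zero[OF \<omega>(1)])
  qed (rule e)
  then obtain j where j: "sqrt M * \<omega> j < e" unfolding eventually_sequentially by blast
  have "eventually (\<lambda>k. hausdorff_compl_dist (\<Omega>s k) \<Omega> < (1/2) ^ j) sequentially"
    by (rule order_tendstoD(2)[OF lim]) simp
  with eventually_test_function[OF bounded_D \<Omega>s(2) \<Omega>(2,1) lim \<psi>(1)] show ?thesis
  proof eventually_elim
    case (elim k)
    obtain \<eta> where \<eta>: "\<eta> \<in> test_functions (\<Omega>s k)" "Lphi (\<lambda>x. Us k x - \<eta> x)" "rho (\<lambda>x. Us k x - \<eta> x) < \<delta>"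
      "Lphi (\<lambda>x. Gs k x - grad \<eta> x)" "rho (\<lambda>x. Gs k x - grad \<eta> x) < \<delta>" "J \<eta> (grad \<eta>) \<le> J (Us k) (Gs k) + \<delta>"
      using energy_approx[OF Ws \<delta>(1)] by blast
    have \<eta>D: "\<eta> \<in> test_functions D" by (rule test_mono[OF \<Omega>s(2) \<eta>(1)])
    have \<psi>D: "\<psi> \<in> test_functions D" by (rule test_mono[OF \<Omega>(2) \<psi>(1)])
    \<comment> \<open>The zero function competes on every \<open>\<Omega>s k\<close>; this bounds
      the energies by 0 and hence the modulars of all approximants by the same
      \<open>M\<close>.\<close>
    have "J (Us k) (Gs k) \<le> J (\<lambda>x. 0) (grad (\<lambda>x. 0))"
      using mins[OF W0pair_test[OF test_zero]] rho_nonneg by (smt (verit))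
    also have "grad (\<lambda>x::real^'n. 0) = (\<lambda>x. 0)" by (rule ext) simp
    finally have "J (Us k) (Gs k) \<le> 0" by (simp add: J_def)
    then have \<eta>M: "rho (grad \<eta>) \<le> M" using \<eta>(6) \<delta>(2) by (intro M(2)[OF \<eta>D]) linarith
    \<comment> \<open>A point outside \<open>\<Omega>\<close> is within \<open>(1/2) ^ j\<close> of
      a point outside \<open>\<Omega>s k\<close>, where \<open>\<eta>\<close> vanishes, so the
      modulus of continuity keeps \<open>\<eta>\<close> below \<open>e\<close> there.\<close>
    have sub: "{x. e \<le> \<bar>\<eta> x\<bar>} \<subseteq> \<Omega>"
    proof (rule ccontr)
      assume "\<not> {x. e \<le> \<bar>\<eta> x\<bar>} \<subseteq> \<Omega>"
      then obtain x where x: "e \<le> \<bar>\<eta> x\<bar>" "x \<notin> \<Omega>" by auto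
      obtain y where y: "y \<notin> \<Omega>s k" "dist x y < (1/2) ^ j"
        using hausdorff_compl_near(2)[OF bounded_D \<Omega>s(2) \<Omega>(2) elim(2) x(2)] by blast
      have "\<bar>\<eta> x - \<eta> y\<bar> \<le> sqrt M * \<omega> j"
        by (rule \<omega>(3)[OF \<eta>(1) M(1) \<eta>M]) (use y in \<open>simp add: dist_norm\<close>)
      then show False using test_outside[OF \<eta>(1) y(1)] j x(1) by simp
    qed
    define w where "w x = trunc e (\<eta> x)" for x
    have w: "w \<in> test_functions \<Omega>" "norm (grad w x) \<le> norm (grad \<eta> x)" for x
      unfolding w_def[abs_def] using test_trunc[OF \<eta>(1) e sub] by auto
    have "rho (grad w) \<le> rho (grad \<eta>)"
      unfolding rho_def using test_Lphi[OF w(1)] test_Lphi[OF \<eta>(1)] w(2)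
      by (intro integral_mono Phi_mono) (auto simp: Lphi_def)
    moreover have "(\<integral>x. F x * \<eta> x \<partial>lebesgue) - (\<integral>x. F x * w x \<partial>lebesgue) \<le> 2 * e * N"
    proof -
      have i: "integrable lebesgue (\<lambda>x. F x * \<eta> x)" "integrable lebesgue (\<lambda>x. F x * w x)"
        using F_mult_integrable test_Lphi(1) \<eta>(1) w(1) by blast+
      have "(\<integral>x. F x * \<eta> x \<partial>lebesgue) - (\<integral>x. F x * w x \<partial>lebesgue) = (\<integral>x. F x * \<eta> x - F x * w x \<partial>lebesgue)"
        using i by simp
      also have "\<dots> \<le> (\<integral>x. (2 * e) * \<bar>F x\<bar> \<partial>lebesgue)"
      proof (rule integral_mono)
        show "integrable lebesgue (\<lambda>x. F x * \<eta> x - F x * w x)" using i by simp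
        show "integrable lebesgue (\<lambda>x. (2 * e) * \<bar>F x\<bar>)" using F_integrable by auto
        fix x
        have "F x * \<eta> x - F x * w x = F x * (\<eta> x - w x)" by (simp add: algebra_simps)
        also have "\<dots> \<le> \<bar>F x\<bar> * \<bar>\<eta> x - w x\<bar>" by (simp flip: abs_mult)
        also have "\<dots> \<le> \<bar>F x\<bar> * (2 * e)"
          using trunc_close[OF e, of "\<eta> x"] by (intro mult_left_mono) (auto simp: w_def abs_minus_commute)
        finally show "F x * \<eta> x - F x * w x \<le> (2 * e) * \<bar>F x\<bar>" by (simp add: mult.commute)
      qed
      also have "\<dots> = 2 * e * N" by (simp add: N_def)
      finally show ?thesis .
    qed
    ultimately have "J w (grad w) \<le> J \<eta> (grad \<eta>) + \<delta>" using eN unfolding J_def by linarith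
    \<comment> \<open>The truncation competes on \<open>\<Omega>\<close>; this yields the lower
      bound for the energies on the varying domains.\<close>
    moreover have "J U G \<le> J w (grad w)"
      using min[OF W0pair_test[OF w(1)]] rho_nonneg by (smt (verit))
    ultimately have JJ: "J U G \<le> J (Us k) (Gs k) + 2 * \<delta>" using \<eta>(6) by linarith
    have Lh: "Lphi (\<lambda>x. grad \<psi> x - Gs k x)"
      by (rule Lphi_diff(1)[OF test_Lphi(2)[OF \<psi>(1)] W0pair_Lphi(2)[OF Ws]])
    \<comment> \<open>\<open>\<psi>\<close> competes on \<open>\<Omega>s k\<close> with energy at
      most \<open>J U G + \<delta>\<close>, hence at most
      \<open>J (Us k) (Gs k) + 3 * \<delta>\<close>; the gap term is bounded by the excess.\<close>
    have "2 * rho (\<lambda>x. (1/2) *\<^sub>R (grad \<psi> x - Gs k x)) \<le> 3 * \<delta>"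
      using mins[OF W0pair_test[OF elim(1)]] JJ \<psi>(6) by linarith
    then have half: "rho (\<lambda>x. (1/2) *\<^sub>R (grad \<psi> x - Gs k x)) \<le> 2 * \<delta>" using \<delta>(1) by linarith
    have "rho (\<lambda>x. grad \<psi> x - Gs k x) \<le> K2 * rho (\<lambda>x. (1/2) *\<^sub>R (grad \<psi> x - Gs k x))"
      using K2(2)[OF Lphi_scaleR[OF Lh, of "1/2"]] by simp
    also have "\<dots> \<le> K2 * (2 * \<delta>)" using half K2(1) by (intro mult_left_mono) auto
    finally have \<psi>G: "rho (\<lambda>x. grad \<psi> x - Gs k x) \<le> 2 * K2 * \<delta>" by simp
    have csum: "Kd * (a + b) \<le> c * \<delta>" if "a \<le> \<delta>" "b \<le> 2 * K2 * \<delta>" for a b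
    proof -
      have "Kd * (a + b) \<le> Kd * (\<delta> + 2 * K2 * \<delta>)" using that Kd_pos by (intro mult_left_mono add_mono) auto
      then show ?thesis by (simp add: c_def algebra_simps)
    qed
    have "rho (\<lambda>x. (G x - grad \<psi> x) + (grad \<psi> x - Gs k x)) \<le> c * \<delta>"
      using Lphi_add(2)[OF \<psi>(4) Lh] csum[OF _ \<psi>G, of "rho (\<lambda>x. G x - grad \<psi> x)"] \<psi>(5) by linarith
    then have "rho (\<lambda>x. G x - Gs k x) \<le> \<epsilon>" using c\<delta>(2) by simp
    then have GG: "rho (\<lambda>x. Gs k x - G x) \<le> \<epsilon>" by (simp add: rho_def norm_minus_commute)
    \<comment> \<open>The Poincare estimate is available for test functions only, so it is applied
      to the difference of \<open>\<psi>\<close> and \<open>\<eta>\<close> rather than of the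
      solutions.\<close>
    have "rho (\<lambda>x. (Gs k x - grad \<eta> x) + (grad \<psi> x - Gs k x)) \<le> c * \<delta>"
      using Lphi_add(2)[OF \<eta>(4) Lh] csum[OF _ \<psi>G, of "rho (\<lambda>x. Gs k x - grad \<eta> x)"] \<eta>(5) by linarith
    moreover have "grad (\<lambda>x. \<psi> x - \<eta> x) = (\<lambda>x. (Gs k x - grad \<eta> x) + (grad \<psi> x - Gs k x))"
      using grad_diff[OF \<psi>D \<eta>D] by auto
    ultimately have "rho (grad (\<lambda>x. \<psi> x - \<eta> x)) \<le> s" using c\<delta>(1) by simp
    then have \<psi>\<eta>: "rho (\<lambda>x. \<psi> x - \<eta> x) \<le> \<epsilon>1" by (rule s(2)[OF test_diff[OF \<psi>D \<eta>D]])
    have L1: "Lphi (\<lambda>x. \<psi> x - \<eta> x)" by (rule test_Lphi(1)[OF test_diff[OF \<psi>D \<eta>D]])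
    note L2 = Lphi_add[OF \<psi>(2) L1]
    note L3 = Lphi_diff[OF L2(1) \<eta>(2)]
    have "rho (\<lambda>x. U x - Us k x) = rho (\<lambda>x. ((U x - \<psi> x) + (\<psi> x - \<eta> x)) - (Us k x - \<eta> x))" by simp
    also have "\<dots> \<le> Kd * (Kd * (\<epsilon>1 + \<epsilon>1) + \<epsilon> / (4 * Kd))"
    proof (rule order_trans[OF L3(2)], intro mult_left_mono add_mono)
      show "rho (\<lambda>x. (U x - \<psi> x) + (\<psi> x - \<eta> x)) \<le> Kd * (\<epsilon>1 + \<epsilon>1)"
        by (rule order_trans[OF L2(2)], intro mult_left_mono add_mono) (use \<psi>(3) \<delta>(5) \<psi>\<eta> Kd_pos in auto)
    qed (use \<eta>(3) \<delta>(6) Kd_pos in auto)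
    also have "\<dots> \<le> \<epsilon>" using Kd_pos \<epsilon> by (simp add: \<epsilon>1_def field_simps)
    finally have "rho (\<lambda>x. Us k x - U x) \<le> \<epsilon>" by (simp add: rho_def abs_minus_commute)
    then show ?case using GG by simp
  qed
qed

end

theorem theorem3p13:
  fixes D \<Omega> :: "(real^'n) set" and \<Omega>s :: "nat \<Rightarrow> (real^'n) set"
    and \<Phi> \<phi> :: "real \<Rightarrow> real" and pm pp :: real
    and f u :: "real^'n \<Rightarrow> real" and us :: "nat \<Rightarrow> real^'n \<Rightarrow> real"
  assumes "open D" and "bounded D" and "lipschitz_boundary D"
    and "young_function \<Phi> \<phi>"
    and "\<And>t. t > 0 \<Longrightarrow> \<phi> field_differentiable (at t)"
    and "1 < pm"
    and "\<And>t. t > 0 \<Longrightarrow> pm \<le> t * deriv \<phi> t / \<phi> t"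
    and "\<And>t. t > 0 \<Longrightarrow> t * deriv \<phi> t / \<phi> t \<le> pp"
    and "convex_on {0..} \<phi>"
    and "set_integrable lborel {1..}
           (\<lambda>t. the_inv_into {0..} \<Phi> t / t powr (1 + 1 / real CARD('n)))"
    and "f \<in> orlicz (young_conj \<Phi>) D"
    and "\<And>k. open (\<Omega>s k)" and "\<And>k. \<Omega>s k \<subseteq> D"
    and "open \<Omega>" and "\<Omega> \<subseteq> D"
    and "(\<lambda>k. hausdorff_compl_dist (\<Omega>s k) \<Omega>) \<longlonglongrightarrow> 0"
    and "\<And>k. weak_solution \<Phi> \<phi> (\<Omega>s k) f (us k)"
    and "weak_solution \<Phi> \<phi> \<Omega> f u"
  shows "weakly_converges (W1_0 \<Phi> D) (W1_norm \<Phi> D)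
           (\<lambda>k. zero_extension (\<Omega>s k) (us k)) (zero_extension \<Omega> u)"
proof -
  interpret convex_young \<Phi> \<phi> pp by unfold_locales (use assms in auto)
  interpret dirichlet_data \<Phi> \<phi> pp D f by unfold_locales (use assms in \<open>auto simp: PhiInv_def\<close>)
  define U where "U = zero_extension \<Omega> u"
  define G where "G x = indicator \<Omega> x *\<^sub>R weak_gradient \<Omega> u x" for x
  define Us where "Us k = zero_extension (\<Omega>s k) (us k)" for k
  define Gs where "Gs k x = indicator (\<Omega>s k) x *\<^sub>R weak_gradient (\<Omega>s k) (us k) x" for k x
  have U: "U = (\<lambda>x. indicator \<Omega> x *\<^sub>R u x)"
    by (auto simp: U_def zero_extension_def)
  have Us: "Us k = (\<lambda>x. indicator (\<Omega>s k) x *\<^sub>R us k x)" for k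
    by (auto simp: Us_def zero_extension_def)
  have W: "W0pair D U G"
  proof (rule W0pair_mono)
    show "W0pair \<Omega> U G"
      unfolding U G_def[abs_def] by (rule W1_0_imp_W0pair(2)) (use assms in \<open>auto simp: weak_solution_def\<close>)
  qed (use assms in auto)
  have Ws: "W0pair D (Us k) (Gs k)" for k
  proof (rule W0pair_mono)
    show "W0pair (\<Omega>s k) (Us k) (Gs k)"
      unfolding Us Gs_def[abs_def] by (rule W1_0_imp_W0pair(2)) (use assms in \<open>auto simp: weak_solution_def\<close>)
  qed (use assms in auto)
  have conv: "eventually (\<lambda>k. rho (\<lambda>x. Us k x - U x) \<le> \<epsilon> \<and> rho (\<lambda>x. Gs k x - G x) \<le> \<epsilon>) sequentially" if "\<epsilon> > 0" for \<epsilon>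
    unfolding U Us G_def Gs_def by (rule solutions_converge) (use assms that in auto)
  \<comment> \<open>The solutions converge in norm; each functional then follows from its own
    bound.\<close>
  have norm0: "(\<lambda>k. W1_norm \<Phi> D (\<lambda>x. Us k x - U x)) \<longlonglongrightarrow> 0"
    unfolding tendsto_iff
  proof (intro allI impI)
    fix e :: real assume e: "e > 0"
    obtain \<delta> where \<delta>: "\<delta> > 0" "\<And>(U :: real^'n \<Rightarrow> real) G E E'. W0pair E U G \<Longrightarrow> open E' \<Longrightarrow> rho U \<le> \<delta> \<Longrightarrow> rho G \<le> \<delta> \<Longrightarrow> \<bar>W1_norm \<Phi> E' U\<bar> \<le> e / 2"
      using W1_norm_small[of "e / 2"] e by (metis half_gt_zero)
    from conv[OF \<delta>(1)] show "eventually (\<lambda>k. dist (W1_norm \<Phi> D (\<lambda>x. Us k x - U x)) 0 < e) sequentially"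
    proof eventually_elim
      case (elim k)
      have "\<bar>W1_norm \<Phi> D (\<lambda>x. Us k x - U x)\<bar> \<le> e / 2"
        by (rule \<delta>(2)[OF W0pair_diff[OF Ws W] open_D]) (use elim in auto)
      then show ?case using e by simp
    qed
  qed
  \<comment> \<open>Linearity and the bound of \<open>l\<close> are granted only on
    \<open>W1_0\<close>; pairs over \<open>D\<close> supply all the memberships.\<close>
  have mem: "V \<in> W1_0 \<Phi> D" if "W0pair D V H" for V H by (rule W0pair_imp_W1_0[OF that open_D subset_refl])
  show ?thesis
    unfolding weakly_converges_def U_def[symmetric] Us_def[symmetric]
  proof (intro conjI allI impI)
    show "Us k \<in> W1_0 \<Phi> D" for k by (rule mem[OF Ws])
    show "U \<in> W1_0 \<Phi> D" by (rule mem[OF W])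
    fix l assume l: "bounded_functional (W1_0 \<Phi> D) (W1_norm \<Phi> D) l"
    have add: "l (\<lambda>x. v x + w x) = l v + l w" if "v \<in> W1_0 \<Phi> D" "w \<in> W1_0 \<Phi> D" for v w
      using l that unfolding bounded_functional_def by blast
    have scale: "l (\<lambda>x. c * v x) = c * l v" if "v \<in> W1_0 \<Phi> D" for v c
      using l that unfolding bounded_functional_def by blast
    obtain C where C: "\<And>v. v \<in> W1_0 \<Phi> D \<Longrightarrow> \<bar>l v\<bar> \<le> C * W1_norm \<Phi> D v"
      using l unfolding bounded_functional_def by blast
    \<comment> \<open>The difference is read as a sum with \<open>- 1\<close> times
      \<open>U\<close>, matching the additivity and homogeneity in
      \<open>bounded_functional\<close>.\<close>
    have "l (\<lambda>x. Us k x - U x) = l (Us k) - l U" for k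
      using add[OF mem[OF Ws[of k]] mem[OF W0pair_cmult[OF W, of "- 1"]]] scale[OF mem[OF W], of "- 1"] by simp
    then have "\<bar>l (Us k) - l U\<bar> \<le> C * W1_norm \<Phi> D (\<lambda>x. Us k x - U x)" for k
      using C[OF mem[OF W0pair_diff[OF Ws W]]] by metis
    then have "(\<lambda>k. l (Us k) - l U) \<longlonglongrightarrow> 0"
      by (intro Lim_null_comparison[OF _ tendsto_mult_right_zero[OF norm0, of C]]) auto
    then show "(\<lambda>k. l (Us k)) \<longlonglongrightarrow> l U" by (rule LIM_zero_cancel)
  qed
qed

end
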